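(* Let $U\subset\mathbb{C}$ be a domain with coordinate $z$, let $\psi:U\to\mathbb{R}^3$ be an affine maxface with nowhere vanishing conormal map $N=(N_1,N_2,N_3)$ and Weierstrass pair $(g,\omega=\hat\omega\,dz)$, and let $p\in U$ be a non-degenerate singular point of $\psi$ with $g(p)\in\mathbb{C}$. Then $\psi$ has a cuspidal edge at $p$ if and only if $$\left(\left(N_1(1-g^2)+iN_2(1+g^2)+2gN_3\right)dg\right)(p)\neq0$$ and one of the following conditions holds: (1) $|g(p)|\neq1$ and $$\mathrm{Im}\left(\left(N_1(1+g^2)+iN_2(1-g^2)\right)^2\,\overline{g_z}\,\hat\omega\right)(p)\neq0;$$ (2) $|g(p)|=1$ and either of the following holds: (a) $\mathrm{Re}(g(p))\neq0$ and $$\mathrm{Im}\left(\left(N_2-iN_3\,\mathrm{Re}(g)\right)^2\,\overline{g_z}\,g^2\hat\omega\right)(p)\neq0,$$ or (b) $\mathrm{Im}(g(p))\neq0$ and $$\mathrm{Im}\left(\left(N_1+iN_3\,\mathrm{Im}(g)\right)^2\,\overline{g_z}\,g^2\hat\omega\right)(p)\neq0.$$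
   Context: Notation: $[\cdot,\cdot,\cdot]$ is the determinant of three vectors and $\times$ the cross product in $\mathbb{R}^3$, both extended complex-multilinearly to $\mathbb{C}^3$; $z=u+iv$. Affine maxface (on a planar domain $U$): a map $\psi:U\to\mathbb{R}^3$ given by $\psi=2\,\mathrm{Re}\left(i\int(\Phi+\overline{\Phi})\times d\Phi\right)$ for a holomorphic map $\Phi$ (on the universal cover of $U$) with $N:=\Phi+\overline{\Phi}$ and $\psi$ single-valued on $U$, such that $[\Phi+\overline{\Phi},d\Phi,\overline{d\Phi}]\not\equiv 0$ and such that the conormal map $N:U\to\mathbb{R}^3$ is a Euclidean conformal minimal immersion. Weierstrass pair: $d\Phi=\tfrac12(1-g^2,\,i(1+g^2),\,2g)\,\omega$ with $g$ meromorphic and $\omega=\hat\omega\,dz$ a holomorphic $1$-form on $U$ (as usual, after a rotation of $\mathbb{R}^3$ if $d\Phi_1-i\,d\Phi_2\equiv0$); the first fundamental form of $N$ is $(1+|g|^2)^2|\omega|^2$. Write $g_z=dg/dz$. Singular points: $p$ is a singular point if $\mathrm{rank}\,(d\psi)_p<2$. With the unit normal field $\boldsymbol{n}=N/|N|$ of $\psi$, put $\Lambda=[\psi_u,\psi_v,\boldsymbol{n}]$; its zeros are the singular points, and a singular point $p$ is non-degenerate if $(d\Lambda)_p\neq0$. Cuspidal edge: $\psi$ has a cuspidal edge at $p$ if the germ of $\psi$ at $p$ is equivalent, up to local diffeomorphisms of source and target, to $(u,v)\mapsto(u,v^2,v^3)$ at the origin. *)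

theory Defs
  imports "HOL-Complex_Analysis.Complex_Analysis"
begin

section \<open>Smooth maps and cuspidal edges\<close>

text \<open>
  \<open>Ck_on k S f\<close> is meant for open \<open>S\<close>: all iterated directional derivatives of \<open>f\<close> up to
  order \<open>k\<close> exist on \<open>S\<close>, those of order less than \<open>k\<close> are (totally) differentiable and those of
  order \<open>k\<close> are continuous.
\<close>

primrec Ck_on ::
  "nat \<Rightarrow> 'a::euclidean_space set \<Rightarrow> ('a \<Rightarrow> 'b::real_normed_vector) \<Rightarrow> bool" where
  "Ck_on 0 S f \<longleftrightarrow> continuous_on S f"
| "Ck_on (Suc k) S f \<longleftrightarrow>
     (\<forall>x\<in>S. f differentiable at x) \<and>
     (\<forall>v. Ck_on k S (\<lambda>x. frechet_derivative f (at x) v))"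

definition smooth_on :: "'a::euclidean_space set \<Rightarrow> ('a \<Rightarrow> 'b::real_normed_vector) \<Rightarrow> bool" where
  "smooth_on S f \<longleftrightarrow> (\<forall>k. Ck_on k S f)"

definition diffeomorphism ::
  "'a::euclidean_space set \<Rightarrow> 'b::euclidean_space set \<Rightarrow> ('a \<Rightarrow> 'b) \<Rightarrow> bool" where
  "diffeomorphism A B h \<longleftrightarrow>
     open A \<and> open B \<and> bij_betw h A B \<and> smooth_on A h \<and> smooth_on B (inv_into A h)"

text \<open>Equivalence of the germs of \<open>f\<close> at \<open>p\<close> and of \<open>f'\<close> at \<open>p'\<close>.\<close>

definition germ_equivalent ::
  "('a::euclidean_space \<Rightarrow> 'b::euclidean_space) \<Rightarrow> 'a \<Rightarrow>
   ('c::euclidean_space \<Rightarrow> 'd::euclidean_space) \<Rightarrow> 'c \<Rightarrow> bool" where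
  "germ_equivalent f p f' p' \<longleftrightarrow>
     (\<exists>A B h C D k.
        diffeomorphism A B h \<and> p \<in> A \<and> h p = p' \<and>
        diffeomorphism C D k \<and> f ` A \<subseteq> C \<and>
        (\<forall>x\<in>A. k (f x) = f' (h x)))"

definition cuspidal_edge_at :: "(complex \<Rightarrow> real^3) \<Rightarrow> complex \<Rightarrow> bool" where
  "cuspidal_edge_at \<psi> p \<longleftrightarrow>
     germ_equivalent \<psi> p (\<lambda>x::real^2. vector [x$1, (x$2)^2, (x$2)^3] :: real^3) 0"


section \<open>Surfaces in Euclidean space over planar domains\<close>

text \<open>Partial derivatives with respect to \<open>z = u + \<i> v\<close>.\<close>

definition d_u :: "(complex \<Rightarrow> 'b::real_normed_vector) \<Rightarrow> complex \<Rightarrow> 'b" where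
  "d_u f z = frechet_derivative f (at z) 1"

definition d_v :: "(complex \<Rightarrow> 'b::real_normed_vector) \<Rightarrow> complex \<Rightarrow> 'b" where
  "d_v f z = frechet_derivative f (at z) \<i>"

definition unit_normal :: "(complex \<Rightarrow> real^3) \<Rightarrow> complex \<Rightarrow> real^3" where
  "unit_normal f z = sgn (cross3 (d_u f z) (d_v f z))"

definition mean_curvature :: "(complex \<Rightarrow> real^3) \<Rightarrow> complex \<Rightarrow> real" where
  "mean_curvature f z =
    (let E = d_u f z \<bullet> d_u f z; F = d_u f z \<bullet> d_v f z; G = d_v f z \<bullet> d_v f z;
         n = unit_normal f z;
         l = d_u (d_u f) z \<bullet> n; m = d_u (d_v f) z \<bullet> n; r = d_v (d_v f) z \<bullet> n
     in (E * r - 2 * F * m + G * l) / (2 * (E * G - F\<^sup>2)))"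

definition conformal_minimal_immersion :: "complex set \<Rightarrow> (complex \<Rightarrow> real^3) \<Rightarrow> bool" where
  "conformal_minimal_immersion U f \<longleftrightarrow>
     smooth_on U f \<and>
     (\<forall>z\<in>U. inj (frechet_derivative f (at z)) \<and>
            d_u f z \<bullet> d_u f z = d_v f z \<bullet> d_v f z \<and> d_u f z \<bullet> d_v f z = 0 \<and>
            mean_curvature f z = 0)"


section \<open>Affine maxfaces\<close>

definition cvec :: "real^3 \<Rightarrow> complex^3" where
  "cvec x = (\<chi> j. complex_of_real (x $ j))"

definition cnj_vec :: "complex^3 \<Rightarrow> complex^3" where
  "cnj_vec x = (\<chi> j. cnj (x $ j))"

text \<open>The complex-bilinear extension of \<^const>\<open>cross3\<close>.\<close>

definition ccross3 :: "complex^3 \<Rightarrow> complex^3 \<Rightarrow> complex^3" where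
  "ccross3 a b = vector [a$2 * b$3 - a$3 * b$2, a$3 * b$1 - a$1 * b$3, a$1 * b$2 - a$2 * b$1]"

definition holomorphic_vec_on :: "(complex \<Rightarrow> complex^3) \<Rightarrow> complex set \<Rightarrow> bool" where
  "holomorphic_vec_on \<Phi> D \<longleftrightarrow> (\<forall>j. (\<lambda>w. \<Phi> w $ j) holomorphic_on D)"

definition deriv_vec :: "(complex \<Rightarrow> complex^3) \<Rightarrow> complex \<Rightarrow> complex^3" where
  "deriv_vec \<Phi> w = (\<chi> j. deriv (\<lambda>w. \<Phi> w $ j) w)"

text \<open>
  By uniformization the universal cover of a planar domain \<open>U\<close> is biholomorphic to the plane or the
  unit disc, so it can always be realised by a simply connected domain \<open>D\<close> of the complex plane
  together with a holomorphic covering map \<open>q\<close>.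
\<close>

definition universal_cover :: "complex set \<Rightarrow> complex set \<Rightarrow> (complex \<Rightarrow> complex) \<Rightarrow> bool" where
  "universal_cover U D q \<longleftrightarrow>
     open D \<and> simply_connected D \<and> q holomorphic_on D \<and> covering_space D q U"

text \<open>
  \<open>N\<close> and \<open>\<psi>\<close> are maps on \<open>U\<close> itself; their lifts to the cover \<open>D\<close> are given by \<open>\<Phi>\<close>, which
  expresses that they are single-valued. The indefinite integral defining \<open>\<psi>\<close> (up to an additive
  constant) is stated as: the increment of the lift of \<open>\<psi>\<close> along every path in \<open>D\<close> is the
  corresponding line integral.
\<close>

definition affine_maxface ::
  "complex set \<Rightarrow> complex set \<Rightarrow> (complex \<Rightarrow> complex) \<Rightarrow> (complex \<Rightarrow> complex^3) \<Rightarrow>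
   (complex \<Rightarrow> real^3) \<Rightarrow> (complex \<Rightarrow> real^3) \<Rightarrow> bool" where
  "affine_maxface U D q \<Phi> N \<psi> \<longleftrightarrow>
     open U \<and> connected U \<and> universal_cover U D q \<and> holomorphic_vec_on \<Phi> D \<and>
     (\<forall>w\<in>D. cvec (N (q w)) = \<Phi> w + cnj_vec (\<Phi> w)) \<and>
     (\<forall>\<gamma>. valid_path \<gamma> \<and> path_image \<gamma> \<subseteq> D \<longrightarrow>
        (\<forall>j. \<psi> (q (pathfinish \<gamma>)) $ j - \<psi> (q (pathstart \<gamma>)) $ j =
             2 * Re (\<i> * contour_integral \<gamma>
                      (\<lambda>w. ccross3 (\<Phi> w + cnj_vec (\<Phi> w)) (deriv_vec \<Phi> w) $ j)))) \<and>
     (\<exists>w\<in>D. det (vector [\<Phi> w + cnj_vec (\<Phi> w), deriv_vec \<Phi> w, cnj_vec (deriv_vec \<Phi> w)]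
                :: complex^3^3) \<noteq> 0) \<and>
     conformal_minimal_immersion U N"

text \<open>
  The identity of 1-forms \<open>d\<Phi> = (1/2) (1 - g\<^sup>2, \<i> (1 + g\<^sup>2), 2 g) \<omega>\<close> is pulled back to the cover,
  which accounts for the factor \<open>deriv q w\<close>; \<open>\<omega>h\<close> is the coefficient of \<open>\<omega> = \<omega>h dz\<close>.
  At poles of \<open>g\<close> (where the HOL value of \<open>g\<close> is meaningless) it is understood by continuation.
\<close>

definition weierstrass_pair ::
  "complex set \<Rightarrow> complex set \<Rightarrow> (complex \<Rightarrow> complex) \<Rightarrow> (complex \<Rightarrow> complex^3) \<Rightarrow>
   (complex \<Rightarrow> complex) \<Rightarrow> (complex \<Rightarrow> complex) \<Rightarrow> bool" where
  "weierstrass_pair U D q \<Phi> g \<omega>h \<longleftrightarrow>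
     g nicely_meromorphic_on U \<and> \<omega>h holomorphic_on U \<and>
     (\<forall>w\<in>D. \<not> is_pole g (q w) \<longrightarrow>
        deriv_vec \<Phi> w =
          (\<omega>h (q w) * deriv q w / 2) *s
            vector [1 - (g (q w))\<^sup>2, \<i> * (1 + (g (q w))\<^sup>2), 2 * g (q w)])"


section \<open>Singular points\<close>

definition singular_point :: "(complex \<Rightarrow> real^3) \<Rightarrow> complex \<Rightarrow> bool" where
  "singular_point \<psi> p \<longleftrightarrow> dim (range (frechet_derivative \<psi> (at p))) < 2"

definition Lambda :: "(complex \<Rightarrow> real^3) \<Rightarrow> (complex \<Rightarrow> real^3) \<Rightarrow> complex \<Rightarrow> real" where
  "Lambda N \<psi> z = det (vector [d_u \<psi> z, d_v \<psi> z, N z /\<^sub>R norm (N z)] :: real^3^3)"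

definition nondegenerate_singular_point ::
  "(complex \<Rightarrow> real^3) \<Rightarrow> (complex \<Rightarrow> real^3) \<Rightarrow> complex \<Rightarrow> bool" where
  "nondegenerate_singular_point N \<psi> p \<longleftrightarrow>
     singular_point \<psi> p \<and> frechet_derivative (Lambda N \<psi>) (at p) \<noteq> (\<lambda>_. 0)"

end

theory Submission
  imports Defs
begin

text \<open>
  Locally \<open>N = 2 Re F\<close> with \<open>F\<close> holomorphic, and \<open>d\<psi>(w) = N \<times> dN(\<i> w)\<close>. Hence \<open>\<psi>\<close> is singular where
  \<open>\<lambda> = [N, N\<^sub>u, N\<^sub>v]\<close> vanishes, and there its kernel is spanned by \<open>\<eta> = -\<i> cnj(\<omega> A)\<close> with
  \<open>A = N\<^sub>1 (1 - g\<^sup>2) + \<i> N\<^sub>2 (1 + g\<^sup>2) + 2 g N\<^sub>3\<close>. At a non-degenerate singular point \<open>\<psi>\<close> has a cuspidal edge iff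
  \<open>d\<lambda>(\<eta>) \<noteq> 0\<close>. If there is a cuspidal edge, then \<open>\<psi>\<close> is immersive along the singular curve, so \<open>\<eta>\<close> is
  transversal to it. Conversely, parametrize a neighbourhood by \<open>\<gamma>(s) + t \<eta>(\<gamma>(s))\<close> with \<open>\<gamma>\<close> running through
  the singular curve; \<open>\<psi>\<close> is analytic in \<open>t\<close> without linear term, so splitting it into its even and odd
  parts in \<open>t\<close> (by Cauchy integrals, which keep smoothness in \<open>s\<close>) writes it as \<open>L(s, t\<^sup>2, t\<^sup>3)\<close> for a local
  diffeomorphism \<open>L\<close>.

  As \<open>\<lambda>\<close> is a positive multiple of \<open>N \<bullet> W\<close>, where \<open>W = (2 Re g, 2 Im g, \<bar>g\<bar>\<^sup>2 - 1)\<close> is parallel to the Gauss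
  map of \<open>N\<close>, one finds that \<open>d\<lambda>\<close> is a positive multiple of \<open>Re(cnj A dg)\<close> at a singular point. Thus
  non-degeneracy means \<open>A dg \<noteq> 0\<close>, and transversality means \<open>Im(A\<^sup>2 cnj(g\<^sub>z) \<omega>) \<noteq> 0\<close>. Eliminating one of the
  \<open>N\<^sub>j\<close> through \<open>N \<bullet> W = 0\<close> gives the three cases of the statement.
\<close>

section \<open>Calculus of smooth maps\<close>

text \<open>\<open>cuspidal_edge_at\<close> asks for actual coordinate changes, so the criterion is
  proved by producing them. Splitting a merely smooth function into parts smooth in t^2 is Whitney's
  theorem; since \<open>\<psi>\<close> is built from holomorphic functions, a Cauchy integral does
  it explicitly. Its kernel 1/(u - t) may be corrected by - t/u^2 because the linear term vanishes.
  Let e = \<open>\<eta> p\<close>, n = N along the ray p + t e, and m = dN(\<i> e) along it. The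
  partial derivatives of L at 0 are independent as soon as [n, n', m'] is nonzero; differentiating
  |e|^2 lam = [N, dN(e), dN(\<i> e)] along the ray shows that this determinant is |e|^2 dlam(e). A
  is the complex bilinear product of N with the isotropic vector v = (1 - g^2, \<i> (1 + g^2), 2 g),
  and dN(w) = Re(\<omega> v w). So dN(\<i> \<open>\<eta>\<close>) = |\<omega>|^2 Re(v cnj A) is a
  positive multiple of the projection of N to the tangent plane of N; where N \<bullet> W = 0 it is
  a multiple of N, so \<open>\<eta>\<close> is null. In d(N \<bullet> W) only the variation of W
  survives, as dN is orthogonal to W.\<close>

lemma has_derivative_frechet:
  assumes "(f has_derivative f') (at x)"
  shows "frechet_derivative f (at x) = f'"
  using frechet_derivative_at[OF assms] by simp

section \<open>Maps of finite differentiability order\<close>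

lemma Ck_on_continuous_on: "Ck_on k S f \<Longrightarrow> continuous_on S f"
  by (cases k) (auto intro!: differentiable_imp_continuous_on differentiable_at_imp_differentiable_on)

lemma Ck_on_has_derivative:
  assumes "Ck_on (Suc k) S f" "x \<in> S"
  shows "(f has_derivative frechet_derivative f (at x)) (at x)"
  using assms by (simp add: frechet_derivative_works)

lemma Ck_on_mono: "Ck_on (Suc k) S f \<Longrightarrow> Ck_on k S f"
proof (induction k arbitrary: f)
  case 0
  then show ?case using Ck_on_continuous_on[OF "0"] by simp
next
  case (Suc k)
  then show ?case by (metis Ck_on.simps(2))
qed

lemma Ck_on_subset: "Ck_on k S f \<Longrightarrow> T \<subseteq> S \<Longrightarrow> Ck_on k T f"
  by (induction k arbitrary: f) (auto intro: continuous_on_subset)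

lemma Ck_on_cong:
  assumes "open S" "\<And>x. x \<in> S \<Longrightarrow> f x = g x" "Ck_on k S f"
  shows "Ck_on k S g"
  using assms(2,3)
proof (induction k arbitrary: f g)
  case 0
  then show ?case by (auto cong: continuous_on_cong)
next
  case (Suc k)
  have d: "f differentiable at x" if "x \<in> S" for x using Suc.prems that by auto
  have eq: "frechet_derivative f (at x) = frechet_derivative g (at x)" if "x \<in> S" for x
    using frechet_derivative_transform_within_open[OF d assms(1)] that Suc.prems by auto
  have "g differentiable at x" if "x \<in> S" for x
    using has_derivative_transform_within_open[OF Ck_on_has_derivative[OF Suc.prems(2) that] assms(1) that]
      Suc.prems(1) unfolding differentiable_def by metis
  moreover have "Ck_on k S (\<lambda>x. frechet_derivative g (at x) v)" for v
    by (rule Suc.IH[of "\<lambda>x. frechet_derivative f (at x) v"]) (use Suc.prems eq in auto)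
  ultimately show ?case by simp
qed

text \<open>Inductions on the order run through this form: any convenient formula for the derivative
  may stand in for \<open>frechet_derivative\<close>.\<close>

lemma Ck_on_SucI:
  assumes "open S" "\<And>x. x \<in> S \<Longrightarrow> (f has_derivative f' x) (at x)"
    "\<And>v. Ck_on k S (\<lambda>x. f' x v)"
  shows "Ck_on (Suc k) S f"
proof -
  have "Ck_on k S (\<lambda>x. frechet_derivative f (at x) v)" for v
    by (rule Ck_on_cong[OF assms(1) _ assms(3)[of v]]) (use has_derivative_frechet[OF assms(2)] in auto)
  then show ?thesis using assms(2) by (auto simp: differentiable_def)
qed

lemma Ck_on_const: "Ck_on k S (\<lambda>x. c)"
  by (induction k arbitrary: c) simp_all

lemma Ck_on_bounded_linear:
  assumes "bounded_linear h"
  shows "Ck_on k S h"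
proof (cases k)
  case 0
  then show ?thesis using linear_continuous_on[OF assms] by auto
next
  case (Suc j)
  have "frechet_derivative h (at x) = h" for x
    by (rule has_derivative_frechet) (rule bounded_linear_imp_has_derivative[OF assms])
  then show ?thesis
    using Suc bounded_linear_imp_differentiable[OF assms] by (auto simp: Ck_on_const)
qed

lemma Ck_on_linear_comp:
  assumes "open S" "bounded_linear h" "Ck_on k S f"
  shows "Ck_on k S (\<lambda>x. h (f x))"
  using assms(3)
proof (induction k arbitrary: f)
  case 0
  then show ?case using bounded_linear.continuous_on[OF assms(2)] by auto
next
  case (Suc k)
  show ?case
  proof (rule Ck_on_SucI[OF assms(1)])
    fix x assume x: "x \<in> S"
    have "(f has_derivative frechet_derivative f (at x)) (at x)"
      using Ck_on_has_derivative[OF Suc.prems x] by blast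
    then show "((\<lambda>x. h (f x)) has_derivative (\<lambda>v. h (frechet_derivative f (at x) v))) (at x)"
      by (rule bounded_linear.has_derivative[OF assms(2)])
  next
    fix v show "Ck_on k S (\<lambda>x. h (frechet_derivative f (at x) v))"
      by (rule Suc.IH) (use Suc.prems in auto)
  qed
qed

lemma Ck_on_add:
  assumes "open S" "Ck_on k S f" "Ck_on k S g"
  shows "Ck_on k S (\<lambda>x. f x + g x)"
  using assms(2,3)
proof (induction k arbitrary: f g)
  case 0
  then show ?case using continuous_on_add[of S f g] by simp
next
  case (Suc k)
  show ?case
  proof (rule Ck_on_SucI[OF assms(1)])
    fix x assume x: "x \<in> S"
    have "(f has_derivative frechet_derivative f (at x)) (at x)"
      "(g has_derivative frechet_derivative g (at x)) (at x)"
      using Ck_on_has_derivative[OF Suc.prems(1) x] Ck_on_has_derivative[OF Suc.prems(2) x] by blast+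
    then show "((\<lambda>x. f x + g x) has_derivative
        (\<lambda>v. frechet_derivative f (at x) v + frechet_derivative g (at x) v)) (at x)"
      by (rule has_derivative_add)
  next
    fix v show "Ck_on k S (\<lambda>x. frechet_derivative f (at x) v + frechet_derivative g (at x) v)"
      by (rule Suc.IH) (use Suc.prems in auto)
  qed
qed

lemma Ck_on_sum:
  assumes "open S" "\<And>i. i \<in> I \<Longrightarrow> Ck_on k S (f i)"
  shows "Ck_on k S (\<lambda>x. \<Sum>i\<in>I. f i x)"
  using assms(2)
proof (induction I rule: infinite_finite_induct)
  case (insert i I)
  then have "Ck_on k S (\<lambda>x. f i x + (\<Sum>i\<in>I. f i x))"
    by (intro Ck_on_add[OF assms(1)]) auto
  then show ?case using insert by simp
qed (simp_all add: Ck_on_const)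

lemma Ck_on_bilinear:
  assumes "open S" "bounded_bilinear bl" "Ck_on k S f" "Ck_on k S g"
  shows "Ck_on k S (\<lambda>x. bl (f x) (g x))"
  using assms(3,4)
proof (induction k arbitrary: f g)
  case 0
  then show ?case using bounded_bilinear.continuous_on[OF assms(2), of S f g] by simp
next
  case (Suc k)
  show ?case
  proof (rule Ck_on_SucI[OF assms(1)])
    fix x assume x: "x \<in> S"
    have "(f has_derivative frechet_derivative f (at x)) (at x)"
      "(g has_derivative frechet_derivative g (at x)) (at x)"
      using Ck_on_has_derivative[OF Suc.prems(1) x] Ck_on_has_derivative[OF Suc.prems(2) x] by blast+
    then show "((\<lambda>x. bl (f x) (g x)) has_derivative (\<lambda>v. bl (f x) (frechet_derivative g (at x) v) +
        bl (frechet_derivative f (at x) v) (g x))) (at x)"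
      by (rule bounded_bilinear.FDERIV[OF assms(2)])
  next
    fix v
    show "Ck_on k S (\<lambda>x. bl (f x) (frechet_derivative g (at x) v) +
        bl (frechet_derivative f (at x) v) (g x))"
      by (intro Ck_on_add[OF assms(1)] Suc.IH) (use Suc.prems Ck_on_mono[OF Suc.prems(1)] Ck_on_mono[OF Suc.prems(2)] in auto)
  qed
qed

text \<open>\<open>Ck_on\<close> controls derivatives in fixed directions only. Expanding in
  \<open>Basis\<close> turns a derivative applied to a moving vector into a finite sum of scalar
  functions times derivatives in fixed directions.\<close>

lemma has_derivative_basis_expand:
  fixes f :: "'a::euclidean_space \<Rightarrow> 'b::real_normed_vector"
  assumes "(f has_derivative f') F"
  shows "f' v = (\<Sum>b\<in>Basis. (v \<bullet> b) *\<^sub>R f' b)"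
proof -
  interpret bounded_linear f' using assms by (rule has_derivative_bounded_linear)
  have "f' v = f' (\<Sum>b\<in>Basis. (v \<bullet> b) *\<^sub>R b)" by (simp add: euclidean_representation)
  then show ?thesis by (simp add: sum scaleR)
qed

lemma Ck_on_compose:
  fixes g :: "'b::euclidean_space \<Rightarrow> 'c::real_normed_vector"
  assumes "open S" "open T" "f ` S \<subseteq> T" "Ck_on k S f" "Ck_on k T g"
  shows "Ck_on k S (\<lambda>x. g (f x))"
  using assms(4,5)
proof (induction k arbitrary: g)
  case 0
  then show ?case using continuous_on_compose2[of T g S f] assms(3) by auto
next
  case (Suc k)
  let ?Df = "\<lambda>x. frechet_derivative f (at x)"
  let ?Dg = "\<lambda>x. frechet_derivative g (at x)"
  show ?case
  proof (rule Ck_on_SucI[OF assms(1)])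
    fix x assume x: "x \<in> S"
    then have f: "(f has_derivative ?Df x) (at x)"
      using Ck_on_has_derivative[OF Suc.prems(1) x] by blast
    have g: "(g has_derivative ?Dg (f x)) (at (f x))"
      using Ck_on_has_derivative[OF Suc.prems(2), of "f x"] x assms(3) by blast
    have "((\<lambda>x. g (f x)) has_derivative (\<lambda>v. ?Dg (f x) (?Df x v))) (at x)"
      using has_derivative_compose[OF f g] .
    then show "((\<lambda>x. g (f x)) has_derivative
        (\<lambda>v. \<Sum>b\<in>Basis. (?Df x v \<bullet> b) *\<^sub>R ?Dg (f x) b)) (at x)"
      by (subst has_derivative_basis_expand[OF g, symmetric])
  next
    fix v
    show "Ck_on k S (\<lambda>x. \<Sum>b\<in>Basis. (?Df x v \<bullet> b) *\<^sub>R ?Dg (f x) b)"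
    proof (intro Ck_on_sum[OF assms(1)] Ck_on_bilinear[OF assms(1) bounded_bilinear_scaleR])
      fix b :: 'b
      show "Ck_on k S (\<lambda>x. ?Df x v \<bullet> b)"
        by (rule Ck_on_linear_comp[OF assms(1) bounded_linear_inner_left]) (use Suc.prems in auto)
      show "Ck_on k S (\<lambda>x. ?Dg (f x) b)"
        by (rule Suc.IH) (use Suc.prems Ck_on_mono[OF Suc.prems(1)] in auto)
    qed
  qed
qed

lemma Ck_on_componentwise:
  fixes f :: "'a::euclidean_space \<Rightarrow> 'b::euclidean_space"
  assumes "open S" "\<And>b. b \<in> Basis \<Longrightarrow> Ck_on k S (\<lambda>x. f x \<bullet> b)"
  shows "Ck_on k S f"
proof (rule Ck_on_cong[OF assms(1)])
  show "Ck_on k S (\<lambda>x. \<Sum>b\<in>Basis. (f x \<bullet> b) *\<^sub>R b)"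
    by (intro Ck_on_sum[OF assms(1)] Ck_on_linear_comp[OF assms(1) bounded_linear_scaleR_left] assms)
qed (simp add: euclidean_representation)

section \<open>Smooth maps\<close>

lemma smooth_on_imp_Ck_on: "smooth_on S f \<Longrightarrow> Ck_on k S f"
  by (simp add: smooth_on_def)

lemma smooth_on_subset: "smooth_on S f \<Longrightarrow> T \<subseteq> S \<Longrightarrow> smooth_on T f"
  by (auto simp: smooth_on_def intro: Ck_on_subset)

lemma smooth_on_cong: "open S \<Longrightarrow> smooth_on S f \<Longrightarrow> (\<And>x. x \<in> S \<Longrightarrow> f x = g x) \<Longrightarrow> smooth_on S g"
  unfolding smooth_on_def using Ck_on_cong by blast

lemma smooth_on_const: "smooth_on S (\<lambda>x. c)"
  by (simp add: smooth_on_def Ck_on_const)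

lemma smooth_on_bounded_linear: "bounded_linear h \<Longrightarrow> smooth_on S h"
  by (simp add: smooth_on_def Ck_on_bounded_linear)

lemma smooth_on_linear_comp:
  "open S \<Longrightarrow> bounded_linear h \<Longrightarrow> smooth_on S f \<Longrightarrow> smooth_on S (\<lambda>x. h (f x))"
  by (simp add: smooth_on_def Ck_on_linear_comp)

lemma smooth_on_add:
  "open S \<Longrightarrow> smooth_on S f \<Longrightarrow> smooth_on S g \<Longrightarrow> smooth_on S (\<lambda>x. f x + g x)"
  by (simp add: smooth_on_def Ck_on_add)

lemma smooth_on_bilinear:
  "open S \<Longrightarrow> bounded_bilinear bl \<Longrightarrow> smooth_on S f \<Longrightarrow> smooth_on S g
    \<Longrightarrow> smooth_on S (\<lambda>x. bl (f x) (g x))"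
  by (simp add: smooth_on_def Ck_on_bilinear)

lemmas smooth_on_mult = smooth_on_bilinear[OF _ bounded_bilinear_mult]
lemmas smooth_on_scaleR = smooth_on_bilinear[OF _ bounded_bilinear_scaleR]
lemmas smooth_on_inner = smooth_on_bilinear[OF _ bounded_bilinear_inner]

lemma smooth_on_uminus: "open S \<Longrightarrow> smooth_on S f \<Longrightarrow> smooth_on S (\<lambda>x. - f x)"
  using smooth_on_linear_comp[OF _ bounded_linear_minus[OF bounded_linear_ident]] .

lemma smooth_on_diff:
  assumes "open S" "smooth_on S f" "smooth_on S g"
  shows "smooth_on S (\<lambda>x. f x - g x)"
  using smooth_on_add[OF assms(1,2) smooth_on_uminus[OF assms(1,3)]] by simp

lemma smooth_on_power:
  fixes f :: "'a::euclidean_space \<Rightarrow> 'b::real_normed_algebra_1"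
  shows "open S \<Longrightarrow> smooth_on S f \<Longrightarrow> smooth_on S (\<lambda>x. f x ^ n)"
  by (induction n) (simp_all add: smooth_on_const smooth_on_mult)

lemma smooth_on_compose:
  fixes g :: "'b::euclidean_space \<Rightarrow> 'c::real_normed_vector"
  assumes "open S" "open T" "f ` S \<subseteq> T" "smooth_on S f" "smooth_on T g"
  shows "smooth_on S (\<lambda>x. g (f x))"
  using assms Ck_on_compose[of S T f _ g] unfolding smooth_on_def by blast

lemma smooth_on_componentwise:
  fixes f :: "'a::euclidean_space \<Rightarrow> 'b::euclidean_space"
  assumes "open S" "\<And>b. b \<in> Basis \<Longrightarrow> smooth_on S (\<lambda>x. f x \<bullet> b)"
  shows "smooth_on S f"
  using assms Ck_on_componentwise[of S _ f] unfolding smooth_on_def by blast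

lemma smooth_on_has_derivative:
  assumes "smooth_on S f" "x \<in> S"
  shows "(f has_derivative frechet_derivative f (at x)) (at x)"
  using Ck_on_has_derivative[OF smooth_on_imp_Ck_on[OF assms(1)] assms(2)] .

lemma smooth_on_frechet_derivative:
  assumes "smooth_on S f"
  shows "smooth_on S (\<lambda>x. frechet_derivative f (at x) v)"
proof -
  have "Ck_on (Suc k) S f" for k using assms by (rule smooth_on_imp_Ck_on)
  then show ?thesis by (simp add: smooth_on_def)
qed

lemma smooth_on_imp_continuous_on: "smooth_on S f \<Longrightarrow> continuous_on S f"
  by (metis Ck_on.simps(1) smooth_on_def)

lemma holomorphic_imp_smooth_on:
  assumes "open S" "f holomorphic_on S"
  shows "smooth_on S f"
  unfolding smooth_on_def
proof
  fix k show "Ck_on k S f" using assms(2)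
  proof (induction k arbitrary: f)
    case 0
    then show ?case by (simp add: holomorphic_on_imp_continuous_on)
  next
    case (Suc k)
    show ?case
    proof (rule Ck_on_SucI[OF assms(1)])
      fix x assume "x \<in> S"
      then have "(f has_field_derivative deriv f x) (at x)"
        using Suc.prems assms(1) holomorphic_derivI by blast
      then show "(f has_derivative (\<lambda>v. deriv f x * v)) (at x)"
        by (simp add: has_field_derivative_def)
    next
      fix v show "Ck_on k S (\<lambda>x. deriv f x * v)"
        by (intro Suc.IH holomorphic_intros holomorphic_deriv Suc.prems assms(1))
    qed
  qed
qed

section \<open>Integrals depending on a parameter\<close>

lemma continuous_on_parametric_integral:
  fixes f :: "'a::euclidean_space \<times> real \<Rightarrow> 'b::euclidean_space"
  assumes "open S" "continuous_on (S \<times> UNIV) f"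
  shows "continuous_on S (\<lambda>x. integral {a..b} (\<lambda>\<theta>. f (x, \<theta>)))"
proof -
  have "continuous_on S (\<lambda>x. integral (cbox a b) (\<lambda>\<theta>. f (x, \<theta>)))"
    by (rule integral_continuous_on_param) (use assms(2) in \<open>auto intro: continuous_on_subset\<close>)
  then show ?thesis by simp
qed

text \<open>Differentiation under the integral sign reproduces an integral of the same kind, with an
  integrand of one order less. The integrand lives on \<open>S \<times> UNIV\<close> rather than
  over \<open>{a..b}\<close>, so that its domain is open and \<open>Ck_on\<close> applies.\<close>

lemma Ck_on_parametric_integral:
  fixes f :: "'a::euclidean_space \<times> real \<Rightarrow> 'b::euclidean_space"
  assumes "open S" "Ck_on k (S \<times> UNIV) f"
  shows "Ck_on k S (\<lambda>x. integral {a..b} (\<lambda>\<theta>. f (x, \<theta>)))"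
  using assms(2)
proof (induction k arbitrary: f)
  case 0
  then show ?case using continuous_on_parametric_integral assms(1) by auto
next
  case (Suc k)
  let ?D = "\<lambda>x \<theta> v. frechet_derivative f (at (x, \<theta>)) (v, 0)"
  have der: "((\<lambda>x. f (x, \<theta>)) has_derivative ?D x \<theta>) (at x)" if "x \<in> S" for x \<theta>
  proof -
    have "(f has_derivative frechet_derivative f (at (x, \<theta>))) (at (x, \<theta>))"
      using Ck_on_has_derivative[OF Suc.prems, of "(x, \<theta>)"] that by blast
    moreover have "((\<lambda>x. (x, \<theta>)) has_derivative (\<lambda>v. (v, 0))) (at x)"
      by (auto intro!: derivative_eq_intros)
    ultimately show ?thesis using has_derivative_compose by blast
  qed
  have cont: "continuous_on (S \<times> UNIV) (\<lambda>x. frechet_derivative f (at x) v)" for v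
    by (rule Ck_on_continuous_on[of k]) (use Suc.prems in \<open>unfold Ck_on.simps, blast\<close>)
  show ?case
  proof (rule Ck_on_SucI[OF assms(1)])
    fix x assume x: "x \<in> S"
    obtain e where e: "e > 0" "ball x e \<subseteq> S" using assms(1) x openE by blast
    \<comment> \<open>\<open>leibniz_rule\<close> wants the derivative as a continuous family of
      bounded linear maps; in finite dimension this continuity can be tested on each vector
      separately.\<close>
    define fx where "fx = (\<lambda>y \<theta>. Blinfun (?D y \<theta>))"
    have fx: "blinfun_apply (fx y \<theta>) = ?D y \<theta>" if "y \<in> S" for y \<theta>
      unfolding fx_def using has_derivative_bounded_linear[OF der[OF that]]
      by (simp add: bounded_linear_Blinfun_apply)
    have contfx: "continuous_on (ball x e \<times> cbox a b) (\<lambda>(y, \<theta>). fx y \<theta>)"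
    proof (rule continuous_on_blinfun_componentwise)
      fix i :: 'a
      have "continuous_on (ball x e \<times> cbox a b) (\<lambda>z. frechet_derivative f (at z) (i, 0))"
        using cont by (rule continuous_on_subset) (use e in auto)
      then show "continuous_on (ball x e \<times> cbox a b) (\<lambda>y. blinfun_apply (case y of (y, \<theta>) \<Rightarrow> fx y \<theta>) i)"
        by (rule continuous_on_eq) (use e fx in auto)
    qed
    have int: "(\<lambda>\<theta>. fx x \<theta>) integrable_on cbox a b"
    proof (rule integrable_continuous)
      have "continuous_on (cbox a b) (\<lambda>\<theta>. (x, \<theta>))" by (intro continuous_intros)
      then show "continuous_on (cbox a b) (fx x)"
        using continuous_on_compose2[OF contfx, of "cbox a b" "\<lambda>\<theta>. (x, \<theta>)"] e by force
    qed
    have "((\<lambda>y. integral (cbox a b) (\<lambda>\<theta>. f (y, \<theta>))) has_derivative integral (cbox a b) (fx x))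
        (at x within ball x e)"
    proof (rule leibniz_rule[OF _ _ contfx])
      fix y \<theta> assume "y \<in> ball x e"
      then show "((\<lambda>x. f (x, \<theta>)) has_derivative fx y \<theta>) (at y within ball x e)"
        using der fx e has_derivative_at_withinI by (metis subsetD)
    next
      fix y assume y: "y \<in> ball x e"
      have "continuous_on (cbox a b) (\<lambda>\<theta>. f (y, \<theta>))"
        by (rule continuous_on_compose2[OF Ck_on_continuous_on[OF Suc.prems]])
          (use y e in \<open>auto intro!: continuous_intros\<close>)
      then show "(\<lambda>\<theta>. f (y, \<theta>)) integrable_on cbox a b" by (rule integrable_continuous)
    qed (use e in auto)
    moreover have "at x within ball x e = at x" by (rule at_within_open) (use e in auto)
    moreover have "blinfun_apply (integral (cbox a b) (fx x)) = (\<lambda>v. integral {a..b} (\<lambda>\<theta>. ?D x \<theta> v))"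
      using blinfun_apply_integral[OF int] fx[OF x] by auto
    ultimately show "((\<lambda>y. integral {a..b} (\<lambda>\<theta>. f (y, \<theta>))) has_derivative
        (\<lambda>v. integral {a..b} (\<lambda>\<theta>. ?D x \<theta> v))) (at x)" by simp
  next
    fix v
    show "Ck_on k S (\<lambda>x. integral {a..b} (\<lambda>\<theta>. ?D x \<theta> v))"
      by (rule Suc.IH) (use Suc.prems in auto)
  qed
qed

lemma smooth_on_parametric_integral:
  fixes f :: "'a::euclidean_space \<times> real \<Rightarrow> 'b::euclidean_space"
  assumes "open S" "smooth_on (S \<times> UNIV) f"
  shows "smooth_on S (\<lambda>x. integral {a..b} (\<lambda>\<theta>. f (x, \<theta>)))"
  using assms Ck_on_parametric_integral[of S _ f a b] unfolding smooth_on_def by blast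

section \<open>The smooth inverse function theorem\<close>

lemma smooth_inverse_step:
  fixes f g :: "'a::euclidean_space \<Rightarrow> 'a"
  assumes U: "open U" and f: "smooth_on U f"
    and gf: "\<And>x. x \<in> U \<Longrightarrow> g (f x) = x"
    and bij: "\<And>x. x \<in> U \<Longrightarrow> bij (frechet_derivative f (at x))"
    and x: "x \<in> U"
  shows "((\<lambda>y. inv (frechet_derivative f (at (g y))) v) has_derivative
      (\<lambda>a. - inv (frechet_derivative f (at x)) (\<Sum>j\<in>Basis. (inv (frechet_derivative f (at x)) v \<bullet> j) *\<^sub>R
        frechet_derivative (\<lambda>z. frechet_derivative f (at z) j) (at x)
          (inv (frechet_derivative f (at x)) a)))) (at (f x))"
proof -
  define T where "T = (\<lambda>x. frechet_derivative f (at x))"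
  define E where "E = (\<lambda>j x. frechet_derivative (\<lambda>z. T z j) (at x))"
  define w where "w = inv (T x) v"
  have derf: "(f has_derivative T x) (at x)" if "x \<in> U" for x
    unfolding T_def using smooth_on_has_derivative[OF f that] .
  have derT: "((\<lambda>z. T z j) has_derivative E j x) (at x)" if "x \<in> U" for x j
    unfolding E_def T_def using smooth_on_has_derivative[OF smooth_on_frechet_derivative[OF f] that] .
  have expand: "T x k = (\<Sum>j\<in>Basis. (k \<bullet> j) *\<^sub>R T x j)" if "x \<in> U" for x k
    using has_derivative_basis_expand[OF derf[OF that]] .
  \<comment> \<open>\<open>G\<close> is the tangent map (x, w) \<mapsto> (f x, Df(x) w) and
    \<open>H\<close> its inverse. Differentiating \<open>H\<close> as an inverse function yields the
    derivative of y \<mapsto> Df(g y)^(-1) v without any calculus for inversion of linear maps;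
    \<open>H'\<close> solves the block triangular system given by \<open>G'\<close>.\<close>
  define G where "G = (\<lambda>(x, w). (f x, \<Sum>j\<in>Basis. (w \<bullet> j) *\<^sub>R T x j))"
  define H where "H = (\<lambda>(y, u). (g y, inv (T (g y)) u))"
  define G' where "G' = (\<lambda>(h, k). (T x h, \<Sum>j\<in>Basis. (w \<bullet> j) *\<^sub>R E j x h + (k \<bullet> j) *\<^sub>R T x j))"
  define H' where "H' = (\<lambda>(a, b). (inv (T x) a, inv (T x) (b - (\<Sum>j\<in>Basis. (w \<bullet> j) *\<^sub>R E j x (inv (T x) a)))))"
  have derG: "(G has_derivative (\<lambda>(h, k). (T z h, \<Sum>j\<in>Basis. (u \<bullet> j) *\<^sub>R E j z h + (k \<bullet> j) *\<^sub>R T z j)))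
      (at (z, u))" if "z \<in> U" for z u
  proof -
    have fst: "((\<lambda>p. f (fst p)) has_derivative (\<lambda>p. T z (fst p))) (at (z, u))"
      using has_derivative_compose[OF has_derivative_fst[OF has_derivative_ident], of f "T z" "(z,u)"] derf[OF that] by simp
    have Tf: "((\<lambda>p. T (fst p) j) has_derivative (\<lambda>p. E j z (fst p))) (at (z, u))" for j
      using has_derivative_compose[OF has_derivative_fst[OF has_derivative_ident], of "\<lambda>z. T z j" "E j z" "(z,u)"]
        derT[OF that] by simp
    have s: "((\<lambda>p. snd p \<bullet> j) has_derivative (\<lambda>p. snd p \<bullet> j)) (at (z, u))" for j :: 'a
      by (auto intro!: derivative_eq_intros)
    have "((\<lambda>p. (f (fst p), \<Sum>j\<in>Basis. (snd p \<bullet> j) *\<^sub>R T (fst p) j)) has_derivative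
       (\<lambda>p. (T z (fst p), \<Sum>j\<in>Basis. (u \<bullet> j) *\<^sub>R E j z (fst p) + (snd p \<bullet> j) *\<^sub>R T z j))) (at (z, u))"
      using has_derivative_Pair[OF fst has_derivative_sum[where I = Basis, OF has_derivative_scaleR[OF s Tf]]]
      by simp
    then show ?thesis unfolding G_def by (simp add: case_prod_unfold)
  qed
  have "(H has_derivative H') (at (G (x, w)))"
  proof (rule has_derivative_inverse_strong[where f = G and x = "(x, w)" and S = "U \<times> UNIV"])
    show "open (U \<times> (UNIV :: 'a set))" using U by (intro open_Times) auto
    show "continuous_on (U \<times> UNIV) G"
      by (rule continuous_at_imp_continuous_on) (use has_derivative_continuous[OF derG] in auto)
    show "(G has_derivative G') (at (x, w))" using derG[OF x] unfolding G'_def .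
    show "H (G z) = z" if "z \<in> U \<times> UNIV" for z
      using that gf bij expand[symmetric]
      by (auto simp: H_def G_def T_def bij_def inv_f_f)
    have TK: "T x (inv (T x) a) = a" for a using bij[OF x] unfolding T_def by (simp add: bij_inv_eq_iff bij_is_surj surj_f_inv_f)
    show "G' \<circ> H' = id"
      using TK by (auto simp: G'_def H'_def fun_eq_iff sum.distrib expand[OF x, symmetric])
  qed (use x in auto)
  then have H: "(H has_derivative H') (at (f x, v))"
    using bij[OF x] expand[OF x, of w, symmetric] unfolding G_def w_def T_def by (simp add: bij_is_surj surj_f_inv_f)
  have P: "((\<lambda>y. (y, v)) has_derivative (\<lambda>a. (a, 0))) (at (f x))"
    by (auto intro!: derivative_eq_intros)
  have "((\<lambda>y. H (y, v)) has_derivative (\<lambda>a. H' (a, 0))) (at (f x))"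
    using has_derivative_compose[OF P H] .
  then have "((\<lambda>y. snd (H (y, v))) has_derivative (\<lambda>a. snd (H' (a, 0)))) (at (f x))"
    by (rule has_derivative_snd)
  moreover have "linear (inv (T x))"
    using inj_linear_imp_inv_linear[of "T x"] bij[OF x] has_derivative_linear[OF derf[OF x]] by (auto simp: T_def bij_def)
  ultimately show ?thesis unfolding H_def H'_def w_def E_def T_def
    by (simp add: linear_neg)
qed

text \<open>Bootstrapping: the derivative of \<open>g\<close> is \<open>K\<close>, and the
  derivative of each \<open>K v\<close> is a polynomial in \<open>K\<close> and in the second
  derivatives of \<open>f\<close> at \<open>g y\<close>. Hence one order for \<open>g\<close> and
  all \<open>K v\<close> together gives the next.\<close>

lemma smooth_on_inverse:
  fixes f g :: "'a::euclidean_space \<Rightarrow> 'a"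
  assumes U: "open U" and V: "open V" and f: "smooth_on U f"
    and gV: "g ` V = U" and gf: "\<And>x. x \<in> U \<Longrightarrow> g (f x) = x" and fg: "\<And>y. y \<in> V \<Longrightarrow> f (g y) = y"
    and bij: "\<And>x. x \<in> U \<Longrightarrow> bij (frechet_derivative f (at x))"
    and derg: "\<And>y. y \<in> V \<Longrightarrow> (g has_derivative inv (frechet_derivative f (at (g y)))) (at y)"
  shows "smooth_on V g"
proof -
  define K where "K = (\<lambda>v y. inv (frechet_derivative f (at (g y))) v)"
  define E where "E = (\<lambda>j i x. frechet_derivative (\<lambda>z. frechet_derivative f (at z) j) (at x) i)"
  have derK: "(K v has_derivative (\<lambda>a. \<Sum>b\<in>Basis. \<Sum>j\<in>Basis. \<Sum>i\<in>Basis.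
      (- ((K v y \<bullet> j) * (K a y \<bullet> i) * (E j i (g y) \<bullet> b))) *\<^sub>R K b y)) (at y)" if y: "y \<in> V" for y v
  proof -
    have gy: "g y \<in> U" using y gV by auto
    have lE: "frechet_derivative (\<lambda>z. frechet_derivative f (at z) j) (at (g y)) h = (\<Sum>i\<in>Basis. (h \<bullet> i) *\<^sub>R E j i (g y))" for j h
      unfolding E_def
      by (rule has_derivative_basis_expand[OF smooth_on_has_derivative[OF smooth_on_frechet_derivative[OF f] gy]])
    have lK: "K u y = (\<Sum>b\<in>Basis. (u \<bullet> b) *\<^sub>R K b y)" for u
      unfolding K_def by (rule has_derivative_basis_expand[OF derg[OF y]])
    have "(K v has_derivative (\<lambda>a. - K (\<Sum>j\<in>Basis. (K v y \<bullet> j) *\<^sub>R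
        frechet_derivative (\<lambda>z. frechet_derivative f (at z) j) (at (g y)) (K a y)) y)) (at y)"
      using smooth_inverse_step[OF U f gf bij gy, of v] fg[OF y] by (simp add: K_def)
    moreover have "- K (\<Sum>j\<in>Basis. (K v y \<bullet> j) *\<^sub>R
        frechet_derivative (\<lambda>z. frechet_derivative f (at z) j) (at (g y)) (K a y)) y =
        (\<Sum>b\<in>Basis. \<Sum>j\<in>Basis. \<Sum>i\<in>Basis.
      (- ((K v y \<bullet> j) * (K a y \<bullet> i) * (E j i (g y) \<bullet> b))) *\<^sub>R K b y)" for a
      unfolding lE by (subst lK) (simp add: inner_sum_left scaleR_sum_left sum_distrib_left sum_negf mult.assoc)
    ultimately show ?thesis by simp
  qed
  have "Ck_on k V g \<and> (\<forall>v. Ck_on k V (K v))" for k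
  proof (induction k)
    case 0
    have "continuous_on V g" "continuous_on V (K v)" for v
      using has_derivative_continuous[OF derg] has_derivative_continuous[OF derK]
      by (auto intro!: continuous_at_imp_continuous_on)
    then show ?case by simp
  next
    case (Suc k)
    have cE: "Ck_on k V (\<lambda>y. E j i (g y))" for i j
    proof (rule Ck_on_compose[OF V U, where g = "E j i" and f = g])
      show "Ck_on k U (E j i)" unfolding E_def
        by (rule smooth_on_imp_Ck_on) (intro smooth_on_frechet_derivative f)
    qed (use gV Suc in auto)
    have "Ck_on (Suc k) V g"
      by (rule Ck_on_SucI[OF V derg]) (use Suc in \<open>auto simp: K_def\<close>)
    moreover have "Ck_on (Suc k) V (K v)" for v
    proof (rule Ck_on_SucI[OF V derK])
      fix a
      have c: "Ck_on k V (\<lambda>y. K u y \<bullet> j)" for u j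
        by (rule Ck_on_linear_comp[OF V bounded_linear_inner_left]) (use Suc in auto)
      have cE': "Ck_on k V (\<lambda>y. E j i (g y) \<bullet> b)" for i j b
        by (rule Ck_on_linear_comp[OF V bounded_linear_inner_left cE])
      have "Ck_on k V (\<lambda>y. (- ((K v y \<bullet> j) * (K a y \<bullet> i) * (E j i (g y) \<bullet> b))) *\<^sub>R K b y)" for b j i
        by (intro Ck_on_bilinear[OF V bounded_bilinear_scaleR]
           Ck_on_linear_comp[OF V bounded_linear_minus[OF bounded_linear_ident]]
           Ck_on_bilinear[OF V bounded_bilinear_mult] c cE') (use Suc in auto)
      then show "Ck_on k V (\<lambda>y. \<Sum>b\<in>Basis. \<Sum>j\<in>Basis. \<Sum>i\<in>Basis.
          (- ((K v y \<bullet> j) * (K a y \<bullet> i) * (E j i (g y) \<bullet> b))) *\<^sub>R K b y)"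
        by (intro Ck_on_sum[OF V])
    qed
    ultimately show ?case by blast
  qed
  then show ?thesis by (simp add: smooth_on_def)
qed

text \<open>The inverse function theorem for C^1 maps supplies the inverse, and
  \<open>smooth_on_inverse\<close> raises its regularity.\<close>

lemma local_diffeomorphism_self:
  fixes f :: "'a::euclidean_space \<Rightarrow> 'a"
  assumes S: "open S" and f: "smooth_on S f" and x: "x \<in> S"
    and inj: "inj (frechet_derivative f (at x))"
  obtains V where "V \<subseteq> S" "x \<in> V" "diffeomorphism V (f ` V) f"
proof -
  let ?T = "\<lambda>x. frechet_derivative f (at x)"
  have derf: "(f has_derivative ?T x) (at x)" if "x \<in> S" for x
    using smooth_on_has_derivative[OF f that] .
  define f' where "f' = (\<lambda>x. Blinfun (?T x))"
  have f': "blinfun_apply (f' x) = ?T x" if "x \<in> S" for x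
    unfolding f'_def using has_derivative_bounded_linear[OF derf[OF that]]
    by (simp add: bounded_linear_Blinfun_apply)
  obtain h where h: "linear h" "h \<circ> ?T x = id"
    using linear_injective_left_inverse[OF has_derivative_linear[OF derf[OF x]] inj] by blast
  have cont: "continuous_on S f'"
  proof (rule continuous_on_blinfun_componentwise)
    fix i :: 'a
    show "continuous_on S (\<lambda>x. blinfun_apply (f' x) i)"
      by (rule continuous_on_eq[OF smooth_on_imp_continuous_on[OF smooth_on_frechet_derivative[OF f, of i]]])
        (simp add: f')
  qed
  obtain U V g g' where UV: "open U" "U \<subseteq> S" "x \<in> U" "open V" "homeomorphism U V f g"
    and g': "\<And>y. y \<in> V \<Longrightarrow> (g has_derivative (g' y)) (at y)"
      "\<And>y. y \<in> V \<Longrightarrow> g' y = inv (blinfun_apply (f'(g y)))"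
      "\<And>y. y \<in> V \<Longrightarrow> bij (blinfun_apply (f'(g y)))"
  proof (rule inverse_function_theorem[OF S _ cont x])
    show "(f has_derivative blinfun_apply (f' x)) (at x)" if "x \<in> S" for x
      using derf[OF that] f'[OF that] by simp
    show "Blinfun h o\<^sub>L f' x = id_blinfun"
      using h f'[OF x] linear_conv_bounded_linear[of h]
      by (intro blinfun_eqI) (simp add: bounded_linear_Blinfun_apply fun_eq_iff)
  qed (blast)
  have hom: "g ` V = U" "f ` U = V" "\<And>x. x \<in> U \<Longrightarrow> g (f x) = x" "\<And>y. y \<in> V \<Longrightarrow> f (g y) = y"
    using UV(5) by (auto simp: homeomorphism_def)
  have gS: "g y \<in> S" if "y \<in> V" for y using that hom UV by auto
  have "bij (?T x)" if "x \<in> U" for x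
    using g'(3)[of "f x"] f'[of x] hom(2,3) that UV(2) by auto
  then have "smooth_on V g"
    using smooth_on_inverse[OF UV(1,4) smooth_on_subset[OF f UV(2)] hom(1,3,4)] g' f'[OF gS] by simp
  moreover have inj_on: "inj_on f U" using hom(3) by (metis inj_onI)
  then have "inv_into U f y = g y" if "y \<in> V" for y
    using that hom inv_into_f_f[OF inj_on, of "g y"] by auto
  ultimately have "smooth_on V (inv_into U f)"
    using smooth_on_cong[OF UV(4), of g "inv_into U f"] by simp
  then have "diffeomorphism U (f ` U) f"
    using UV hom smooth_on_subset[OF f UV(2)] inj_on by (auto simp: diffeomorphism_def bij_betw_def)
  then show thesis using that UV by blast
qed

text \<open>Coordinate changes below go between \<open>complex\<close>, \<open>real^2\<close> and
  \<open>real \<times> real\<close>; a linear isomorphism \<open>J\<close> reduces them to a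
  self-map.\<close>

lemma local_diffeomorphism:
  fixes f :: "'a::euclidean_space \<Rightarrow> 'b::euclidean_space"
  assumes S: "open S" and f: "smooth_on S f" and x: "x \<in> S"
    and inj: "inj (frechet_derivative f (at x))" and dim: "DIM('a) = DIM('b)"
  obtains V where "V \<subseteq> S" "x \<in> V" "diffeomorphism V (f ` V) f"
proof -
  obtain J :: "'b \<Rightarrow> 'a" and J' where J: "linear J" "linear J'" "\<And>x. J' (J x) = x" "\<And>y. J (J' y) = y"
    using isomorphisms_UNIV_UNIV[OF dim[symmetric]] by metis
  have injJ: "inj J" using J(3) by (metis injI)
  have bl: "bounded_linear J" "bounded_linear J'"
    using J by (simp_all add: linear_conv_bounded_linear)
  let ?f = "\<lambda>x. J (f x)"
  have sf: "smooth_on S ?f" by (rule smooth_on_linear_comp[OF S bl(1) f])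
  have "frechet_derivative ?f (at x) = (\<lambda>v. J (frechet_derivative f (at x) v))"
    by (rule has_derivative_frechet)
      (rule bounded_linear.has_derivative[OF bl(1) smooth_on_has_derivative[OF f x]])
  then have "inj (frechet_derivative ?f (at x))"
    using inj_compose[OF injJ inj] by (simp add: o_def)
  then obtain V where V: "V \<subseteq> S" "x \<in> V" "diffeomorphism V (?f ` V) ?f"
    using local_diffeomorphism_self[OF S sf x] by blast
  have injf: "inj_on f V" using V(3) by (auto simp: diffeomorphism_def bij_betw_def inj_on_def)
  have im: "f ` V = J -` (?f ` V)" using injJ by (auto simp: inj_def)
  have op: "open (f ` V)" unfolding im
    by (rule open_vimage) (use V(3) bl in \<open>auto simp: diffeomorphism_def linear_continuous_on\<close>)
  have "smooth_on (f ` V) (\<lambda>y. inv_into V ?f (J y))"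
    by (rule smooth_on_compose[OF op _ _ smooth_on_bounded_linear[OF bl(1)], of "?f ` V"])
      (use V(3) in \<open>auto simp: diffeomorphism_def\<close>)
  moreover have "inv_into V ?f (J y) = inv_into V f y" if "y \<in> f ` V" for y
  proof -
    obtain z where z: "z \<in> V" "y = f z" using \<open>y \<in> f ` V\<close> by blast
    have "inj_on ?f V" using V(3) by (auto simp: diffeomorphism_def bij_betw_def)
    then show ?thesis using z inv_into_f_f[OF injf z(1)] inv_into_f_f[of ?f V z] by simp
  qed
  ultimately have "smooth_on (f ` V) (inv_into V f)" by (rule smooth_on_cong[OF op])
  then have "diffeomorphism V (f ` V) f"
    using V op injf smooth_on_subset[OF f V(1)] by (auto simp: diffeomorphism_def bij_betw_def)
  then show thesis using that V by blast
qed

lemma diffeomorphism_inverse: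
  assumes "diffeomorphism A B h"
  shows "diffeomorphism B A (inv_into A h)"
proof -
  have h: "open A" "open B" "bij_betw h A B" "smooth_on A h" "smooth_on B (inv_into A h)"
    using assms by (auto simp: diffeomorphism_def)
  have "inv_into B (inv_into A h) x = h x" if "x \<in> A" for x
    using inv_into_inv_into_eq[OF h(3) that] .
  then have "smooth_on A (inv_into B (inv_into A h))"
    using smooth_on_cong[OF h(1,4), of "inv_into B (inv_into A h)"] by simp
  then show ?thesis using h bij_betw_inv_into[OF h(3)] by (simp add: diffeomorphism_def)
qed

section \<open>Splitting off even and odd parts\<close>

lemma smooth_on_vec_lambda:
  fixes f :: "'a::euclidean_space \<Rightarrow> real^'n"
  assumes "open S" "\<And>i. smooth_on S (\<lambda>x. f x $ i)"
  shows "smooth_on S f"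
proof (rule smooth_on_componentwise[OF assms(1)])
  fix b :: "real^'n" assume "b \<in> Basis"
  then obtain i where "b = axis i 1" by (auto simp: Basis_vec_def)
  then show "smooth_on S (\<lambda>x. f x \<bullet> b)" using assms(2)[of i] by (simp add: inner_axis)
qed

lemma smooth_on_vec_nth: "smooth_on S f \<Longrightarrow> open S \<Longrightarrow> smooth_on S (\<lambda>x. f x $ i)"
  for f :: "'a::euclidean_space \<Rightarrow> real^'n"
  using smooth_on_linear_comp[OF _ bounded_linear_vec_nth] by blast

lemma smooth_on_holomorphic_comp:
  assumes "open S" "open T" "f ` S \<subseteq> T" "smooth_on S f" "h holomorphic_on T"
  shows "smooth_on S (\<lambda>x. h (f x))"
  using smooth_on_compose[OF assms(1-4) holomorphic_imp_smooth_on[OF assms(2,5)]] .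

text \<open>
  If \<open>Q(\<zeta>) = \<Sum> a\<^sub>k \<zeta>\<^sup>k\<close> with \<open>a\<^sub>1 = 0\<close>, the integral is
  \<open>\<Sum> a\<^sub>2\<^sub>k y\<^sup>k + z \<Sum> a\<^sub>2\<^sub>k\<^sub>+\<^sub>3 y\<^sup>k\<close>, which at \<open>y = t\<^sup>2, z = t\<^sup>3\<close> gives \<open>Q(t)\<close>.
\<close>

lemma cusp_factorization:
  fixes q :: "real \<times> complex \<Rightarrow> complex"
  assumes I: "open I" and r: "0 < r" "r < R" and q: "smooth_on (I \<times> ball 0 R) q"
    and hol: "\<And>s. s \<in> I \<Longrightarrow> (\<lambda>\<zeta>. q (s, \<zeta>)) holomorphic_on ball 0 R"
    and d0: "\<And>s. s \<in> I \<Longrightarrow> deriv (\<lambda>\<zeta>. q (s, \<zeta>)) 0 = 0"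
  obtains L :: "real^3 \<Rightarrow> complex" where
    "smooth_on {x. x$1 \<in> I \<and> \<bar>x$2\<bar> < r\<^sup>2} L"
    "\<And>s t. s \<in> I \<Longrightarrow> \<bar>t\<bar> < r \<Longrightarrow> L (vector [s, t^2, t^3]) = q (s, of_real t)"
proof
  define c where "c = (\<lambda>\<theta>::real. of_real r * exp (2 * of_real pi * \<i> * of_real \<theta>))"
  \<comment> \<open>On the circle d\<zeta> = 2 pi \<i> \<zeta> d\<theta>, so \<open>f\<close>
    integrates \<open>q\<close> against the kernel (\<zeta> + z/\<zeta>^2) / (\<zeta>^2 - y). It is
    smooth in y and z for |y| < r^2, and at y = t^2, z = t^3 it equals 1/(\<zeta> - t) -
    t/\<zeta>^2.\<close>
  define f where "f = (\<lambda>(x :: real^3, \<theta>). q (x$1, c \<theta>) *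
    (((c \<theta>)\<^sup>2 + of_real (x$3) * inverse (c \<theta>)) * inverse ((c \<theta>)\<^sup>2 - of_real (x$2))))"
  define L where "L = (\<lambda>x. integral {0..1} (\<lambda>\<theta>. f (x, \<theta>)))"
  let ?S = "{x :: real^3. x$1 \<in> I \<and> \<bar>x$2\<bar> < r\<^sup>2}"
  have S: "open ?S"
  proof -
    have "?S = (\<lambda>x. x$1) -` I \<inter> (\<lambda>x. \<bar>x$2\<bar>) -` {..<r\<^sup>2}" by auto
    also have "open \<dots>" using I by (intro open_Int open_vimage continuous_intros) auto
    finally show ?thesis .
  qed
  let ?T = "?S \<times> (UNIV :: real set)"
  have T: "open ?T" using S by (intro open_Times) auto
  have nc: "norm (c \<theta>) = r" for \<theta> using r by (simp add: c_def norm_mult)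
  have c0: "c \<theta> \<noteq> 0" for \<theta> using nc[of \<theta>] r by auto
  have smc: "smooth_on ?T (\<lambda>p. c (snd p))"
  proof -
    have "smooth_on ?T (\<lambda>p. of_real (snd p) :: complex)"
      by (rule smooth_on_bounded_linear)
        (intro bounded_linear_compose[OF bounded_linear_of_real bounded_linear_snd])
    then have "smooth_on ?T (\<lambda>p. (\<lambda>z. of_real r * exp (2 * of_real pi * \<i> * z)) (of_real (snd p)))"
      by (rule smooth_on_holomorphic_comp[OF T open_UNIV subset_UNIV]) (intro holomorphic_intros)
    then show ?thesis by (simp add: c_def)
  qed
  have smx: "smooth_on ?T (\<lambda>p. fst p $ i)" for i
    by (rule smooth_on_bounded_linear)
      (intro bounded_linear_compose[OF bounded_linear_vec_nth bounded_linear_fst])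
  then have smx': "smooth_on ?T (\<lambda>p. of_real (fst p $ i) :: complex)" for i
    by (rule smooth_on_linear_comp[OF T bounded_linear_of_real])
  have sminv: "smooth_on ?T (\<lambda>p. inverse (h p))" if "smooth_on ?T h" "\<And>p. p \<in> ?T \<Longrightarrow> h p \<noteq> 0"
    for h :: "(real^3) \<times> real \<Rightarrow> complex"
    by (rule smooth_on_holomorphic_comp[OF T, of "- {0}" h inverse])
      (use that in \<open>auto intro!: holomorphic_intros\<close>)
  have nz: "(c \<theta>)\<^sup>2 - of_real y \<noteq> 0" if "\<bar>y\<bar> < r\<^sup>2" for \<theta> y
  proof
    assume "(c \<theta>)\<^sup>2 - of_real y = 0"
    then have "norm ((c \<theta>)\<^sup>2) = norm (of_real y :: complex)" by simp
    then show False using that by (simp add: norm_power nc)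
  qed
  have smq: "smooth_on ?T (\<lambda>p. q (fst p $ 1, c (snd p)))"
  proof (rule smooth_on_compose[OF T open_Times[OF I open_ball] _ _ q])
    have l: "bounded_linear (\<lambda>a::real. (a, 0::complex))" "bounded_linear (\<lambda>b::complex. (0::real, b))"
      by (simp_all add: bounded_linear_Pair bounded_linear_zero bounded_linear_ident)
    have "smooth_on ?T (\<lambda>p. (fst p $ 1, 0) + (0, c (snd p)))"
      by (rule smooth_on_add[OF T smooth_on_linear_comp[OF T l(1) smx] smooth_on_linear_comp[OF T l(2) smc]])
    then show "smooth_on ?T (\<lambda>p. (fst p $ 1, c (snd p)))" by simp
  qed (use nc r in auto)
  have "smooth_on ?T (\<lambda>p. q (fst p $ 1, c (snd p)) *
    (((c (snd p))\<^sup>2 + of_real (fst p $ 3) * inverse (c (snd p))) * inverse ((c (snd p))\<^sup>2 - of_real (fst p $ 2))))"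
    by (rule smooth_on_mult[OF T smq smooth_on_mult[OF T smooth_on_add[OF T smooth_on_power[OF T smc]
        smooth_on_mult[OF T smx' sminv[OF smc]]] sminv[OF smooth_on_diff[OF T smooth_on_power[OF T smc] smx']]]])
      (use c0 nz in auto)
  then have "smooth_on ?T f" unfolding f_def by (simp add: case_prod_unfold)
  then show "smooth_on ?S L" unfolding L_def by (rule smooth_on_parametric_integral[OF S])
  fix s t :: real assume s: "s \<in> I" and t: "\<bar>t\<bar> < r"
  let ?q = "\<lambda>\<zeta>. q (s, \<zeta>)"
  have cont: "continuous_on (cball 0 r) ?q" and hol': "?q holomorphic_on ball 0 r"
    using hol[OF s] r by (auto intro!: holomorphic_on_imp_continuous_on elim!: holomorphic_on_subset)
  have 1: "((\<lambda>u. ?q u / (u - of_real t)) has_contour_integral (2 * of_real pi * \<i> * ?q (of_real t))) (circlepath 0 r)"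
    by (rule Cauchy_integral_circlepath[OF cont hol']) (use t in simp)
  have 2: "((\<lambda>u. ?q u / (u - 0) ^ Suc 1) has_contour_integral ((2 * pi * \<i>) / fact 1 * (deriv ^^ 1) ?q 0)) (circlepath 0 r)"
    by (rule Cauchy_has_contour_integral_higher_derivative_circlepath[OF cont hol']) (use r in simp)
  \<comment> \<open>Cauchy's formula for the value at t, minus t times the one for the derivative at
    0. The latter is zero by \<open>d0\<close>, so the kernel changes but the value does
    not.\<close>
  have "((\<lambda>u. ?q u / (u - of_real t) - of_real t * (?q u / (u - 0) ^ Suc 1)) has_contour_integral
      (2 * of_real pi * \<i> * ?q (of_real t))) (circlepath 0 r)"
    using has_contour_integral_diff[OF 1 has_contour_integral_lmul[OF 2, of "of_real t"]] d0[OF s] by simp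
  then have "((\<lambda>\<theta>. (?q (c \<theta>) / (c \<theta> - of_real t) - of_real t * (?q (c \<theta>) / (c \<theta>)\<^sup>2)) * (2 * of_real pi * \<i> * c \<theta>))
      has_integral (2 * of_real pi * \<i> * ?q (of_real t))) {0..1}"
    unfolding has_contour_integral_def
  proof (rule has_integral_eq[rotated])
    fix \<theta> :: real assume "\<theta> \<in> {0..1}"
    moreover have "circlepath 0 r \<theta> = c \<theta>" by (simp add: circlepath c_def)
    ultimately show "(?q (circlepath 0 r \<theta>) / (circlepath 0 r \<theta> - of_real t) -
          of_real t * (?q (circlepath 0 r \<theta>) / (circlepath 0 r \<theta> - 0) ^ Suc 1)) *
          vector_derivative (circlepath 0 r) (at \<theta> within {0..1}) =
        (?q (c \<theta>) / (c \<theta> - of_real t) - of_real t * (?q (c \<theta>) / (c \<theta>)\<^sup>2)) * (2 * of_real pi * \<i> * c \<theta>)"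
      by (simp add: vector_derivative_circlepath01 c_def power2_eq_square mult.assoc)
  qed
  then have "((\<lambda>\<theta>. inverse (2 * of_real pi * \<i>) * ((?q (c \<theta>) / (c \<theta> - of_real t) - of_real t * (?q (c \<theta>) / (c \<theta>)\<^sup>2)) * (2 * of_real pi * \<i> * c \<theta>)))
      has_integral (inverse (2 * of_real pi * \<i>) * (2 * of_real pi * \<i> * ?q (of_real t)))) {0..1}"
    by (rule has_integral_mult_right)
  moreover have "inverse (2 * of_real pi * \<i>) * ((?q (c \<theta>) / (c \<theta> - of_real t) - of_real t * (?q (c \<theta>) / (c \<theta>)\<^sup>2)) * (2 * of_real pi * \<i> * c \<theta>))
     = f (vector [s, t^2, t^3], \<theta>)" for \<theta>
  proof -
    define w Q where "w = c \<theta>" and "Q = ?q w"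
    have w: "w \<noteq> 0" "w - of_real t \<noteq> 0" "w + of_real t \<noteq> 0"
      using nc[of \<theta>] t c0 by (auto simp: w_def eq_neg_iff_add_eq_0[symmetric])
    have w2: "w\<^sup>2 - (of_real t)\<^sup>2 \<noteq> 0" using w by (simp add: power2_eq_square square_diff_square_factored)
    have e: "(1 / (w - of_real t) - of_real t / w\<^sup>2) * w =
        (w\<^sup>2 + of_real t ^ 3 * inverse w) * inverse (w\<^sup>2 - (of_real t)\<^sup>2)"
    proof -
      have "(1 / (w - of_real t) - of_real t / w\<^sup>2) * w = (w\<^sup>2 - of_real t * (w - of_real t)) / (w * (w - of_real t))"
        using w by (simp add: field_simps power2_eq_square)
      also have "\<dots> = ((w\<^sup>2 - of_real t * (w - of_real t)) * (w + of_real t)) / (w * ((w - of_real t) * (w + of_real t)))"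
        using w by (simp add: mult.assoc)
      also have "\<dots> = (w^3 + of_real t ^ 3) / (w * (w\<^sup>2 - (of_real t)\<^sup>2))"
        by (simp add: algebra_simps power2_eq_square power3_eq_cube)
      also have "\<dots> = (w\<^sup>2 + of_real t ^ 3 * inverse w) * inverse (w\<^sup>2 - (of_real t)\<^sup>2)"
        using w(1) w2 by (simp add: field_simps power2_eq_square power3_eq_cube)
      finally show ?thesis .
    qed
    have "inverse (2 * of_real pi * \<i>) * ((Q / (w - of_real t) - of_real t * (Q / w\<^sup>2)) * (2 * of_real pi * \<i> * w))
        = Q * ((1 / (w - of_real t) - of_real t / w\<^sup>2) * w)"
      by (simp add: algebra_simps)
    then show ?thesis unfolding e by (simp add: f_def w_def[symmetric] Q_def[symmetric])
  qed
  moreover have "inverse (2 * of_real pi * \<i>) * (2 * of_real pi * \<i> * ?q (of_real t)) = ?q (of_real t)"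
    by (simp add: field_simps)
  ultimately have "((\<lambda>\<theta>. f (vector [s, t^2, t^3], \<theta>)) has_integral ?q (of_real t)) {0..1}"
    by (simp only:)
  then show "L (vector [s, t^2, t^3]) = q (s, of_real t)"
    unfolding L_def by (rule integral_unique)
qed

section \<open>Cuspidal edges\<close>

lemma diffeomorphism_has_derivative:
  assumes "diffeomorphism A B h" "x \<in> A"
  shows "(h has_derivative frechet_derivative h (at x)) (at x)"
  using assms smooth_on_has_derivative unfolding diffeomorphism_def by blast

lemma diffeomorphism_derivative_inverse:
  assumes "diffeomorphism A B h" "x \<in> A"
  shows "frechet_derivative (inv_into A h) (at (h x)) (frechet_derivative h (at x) v) = v"
proof -
  have h: "bij_betw h A B" "open A" "h x \<in> B"
    using assms by (auto simp: diffeomorphism_def bij_betw_def)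
  have "((\<lambda>y. inv_into A h (h y)) has_derivative
      (\<lambda>v. frechet_derivative (inv_into A h) (at (h x)) (frechet_derivative h (at x) v))) (at x)"
    using has_derivative_compose[OF diffeomorphism_has_derivative[OF assms]
        diffeomorphism_has_derivative[OF diffeomorphism_inverse[OF assms(1)] h(3)]] .
  moreover have "((\<lambda>y. inv_into A h (h y)) has_derivative (\<lambda>v. v)) (at x)"
    by (rule has_derivative_transform_within_open[OF has_derivative_ident h(2) assms(2)])
      (use h(1) in \<open>auto simp: bij_betw_def\<close>)
  ultimately show ?thesis using has_derivative_unique by metis
qed

lemma diffeomorphism_derivative_eq_0:
  assumes "diffeomorphism A B h" "x \<in> A" "frechet_derivative h (at x) v = 0"
  shows "v = 0"
proof -
  have "h x \<in> B" using assms by (auto simp: diffeomorphism_def bij_betw_def)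
  then have "linear (frechet_derivative (inv_into A h) (at (h x)))"
    using diffeomorphism_has_derivative[OF diffeomorphism_inverse[OF assms(1)]] has_derivative_linear by blast
  then show ?thesis using diffeomorphism_derivative_inverse[OF assms(1,2), of v] assms(3) by (simp add: linear_0)
qed

lemma norm_vector2: "norm (vector [a, b] :: real^2) = sqrt (a\<^sup>2 + b\<^sup>2)"
  by (simp add: norm_eq_sqrt_inner inner_vec_def sum_2 power2_eq_square)

lemma bounded_linear_vector2:
  "bounded_linear (\<lambda>a. vector [a, 0] :: real^2)" "bounded_linear (\<lambda>b. vector [0, b] :: real^2)"
  by (auto intro!: linear_conv_bounded_linear[THEN iffD1] linearI simp: vec_eq_iff forall_2)

text \<open>The model is singular along its first axis, has the second axis as kernel there, and is
  immersive along the first. The inverse of the source diffeomorphism carries these three facts over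
  to \<open>\<psi>\<close>.\<close>

lemma cuspidal_edge_at_singular_curve:
  assumes "cuspidal_edge_at \<psi> p" and U: "open U" "p \<in> U"
    and der: "\<And>z. z \<in> U \<Longrightarrow> (\<psi> has_derivative \<psi>' z) (at z)"
  obtains \<sigma> v \<epsilon> where "\<sigma> 0 = p" "(\<sigma> has_vector_derivative v) (at (0::real))" "\<psi>' p v \<noteq> 0" "\<epsilon> > 0"
    "\<And>s. \<bar>s\<bar> < \<epsilon> \<Longrightarrow> \<sigma> s \<in> U \<and> (\<exists>w. w \<noteq> 0 \<and> \<psi>' (\<sigma> s) w = 0)"
proof -
  obtain A B C D and h :: "complex \<Rightarrow> real^2" and k :: "real^3 \<Rightarrow> real^3" where h: "diffeomorphism A B h" "p \<in> A" "h p = 0"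
    and k: "diffeomorphism C D k" "\<psi> ` A \<subseteq> C"
    and kh: "\<And>x. x \<in> A \<Longrightarrow> k (\<psi> x) = vector [h x $ 1, (h x $ 2)^2, (h x $ 2)^3]"
    using assms(1) unfolding cuspidal_edge_at_def germ_equivalent_def
    by (elim exE conjE) (rule that, assumption+, erule bspec)
  define g where "g = inv_into A h"
  have AB: "open A" "open B" "bij_betw h A B" using h by (auto simp: diffeomorphism_def)
  have g: "g y \<in> A" "h (g y) = y" if "y \<in> B" for y
    using that AB(3) unfolding g_def by (auto simp: bij_betw_def inv_into_into f_inv_into_f)
  have dg: "diffeomorphism B A g" unfolding g_def by (rule diffeomorphism_inverse[OF h(1)])
  have derg: "(g has_derivative frechet_derivative g (at y)) (at y)" if "y \<in> B" for y
    by (rule diffeomorphism_has_derivative[OF dg that])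
  have B0: "0 \<in> B" using h AB by (auto simp: bij_betw_def)
  have g0: "g 0 = p" using h AB unfolding g_def by (metis bij_betw_inv_into_left)
  have kg: "k (\<psi> (g y)) = vector [y $ 1, (y $ 2)^2, (y $ 2)^3]" if "y \<in> B" for y :: "real^2"
    using kh g that by metis
  have "isCont g 0" using has_derivative_continuous[OF derg[OF B0]] .
  then have "(g \<longlongrightarrow> p) (nhds 0)"
    unfolding isCont_def tendsto_at_iff_tendsto_nhds by (simp add: g0)
  then have "eventually (\<lambda>y. g y \<in> U) (nhds 0)"
    by (rule topological_tendstoD) (use U in auto)
  moreover have "eventually (\<lambda>y. y \<in> B) (nhds 0)" using AB B0 by (metis eventually_nhds)
  ultimately have "eventually (\<lambda>y. g y \<in> U \<and> y \<in> B) (nhds 0)" by (rule eventually_conj)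
  then obtain \<epsilon> where \<epsilon>: "\<epsilon> > 0" "\<And>y. norm y < \<epsilon> \<Longrightarrow> g y \<in> U \<and> y \<in> B"
    unfolding eventually_nhds_metric by (auto simp: dist_norm)
  \<comment> \<open>The identity \<open>kg\<close> is differentiated on both sides. Evaluated where
    \<open>y $ 2 = 0\<close>, the vector (1, 0) shows that \<open>\<psi>' p v\<close> is nonzero and
    (0, 1) gives the null direction.\<close>
  have chain: "frechet_derivative k (at (\<psi> (g y))) (\<psi>' (g y) (frechet_derivative g (at y) v)) =
      vector [v$1, 2 * y$2 * v$2, 3 * (y$2)^2 * v$2]" if y: "norm y < \<epsilon>" for y v :: "real^2"
  proof -
    have y': "g y \<in> U" "y \<in> B" using \<epsilon>(2)[OF y] by auto
    have dk: "(k has_derivative frechet_derivative k (at (\<psi> (g y)))) (at (\<psi> (g y)))"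
      using diffeomorphism_has_derivative[OF k(1)] k(2) g(1)[OF y'(2)] by blast
    have "((\<lambda>y. k (\<psi> (g y))) has_derivative
       (\<lambda>v. frechet_derivative k (at (\<psi> (g y))) (\<psi>' (g y) (frechet_derivative g (at y) v)))) (at y)"
      using has_derivative_compose[OF has_derivative_compose[OF derg[OF y'(2)] der[OF y'(1)]] dk] .
    moreover have "((\<lambda>y. k (\<psi> (g y))) has_derivative (\<lambda>v::real^2. vector [v$1, 2 * y$2 * v$2, 3 * (y$2)^2 * v$2])) (at y)"
    proof (rule has_derivative_transform_within_open[OF _ AB(2) y'(2)])
      show "((\<lambda>y::real^2. vector [y $ 1, (y $ 2)^2, (y $ 2)^3] :: real^3) has_derivative
          (\<lambda>v::real^2. vector [v$1, 2 * y$2 * v$2, 3 * (y$2)^2 * v$2])) (at y)"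
        unfolding has_derivative_componentwise_within[of "\<lambda>y::real^2. vector [y $ 1, (y $ 2)^2, (y $ 2)^3] :: real^3"]
        by (auto simp: Basis_vec_def inner_axis forall_3 intro!: derivative_eq_intros bounded_linear_imp_has_derivative[OF bounded_linear_vec_nth])
    qed (use kg in auto)
    ultimately have "(\<lambda>v. frechet_derivative k (at (\<psi> (g y))) (\<psi>' (g y) (frechet_derivative g (at y) v))) =
        (\<lambda>v. vector [v$1, 2 * y$2 * v$2, 3 * (y$2)^2 * v$2])"
      by (rule has_derivative_unique)
    from fun_cong[OF this, of v] show ?thesis .
  qed
  have klin: "linear (frechet_derivative k (at (\<psi> (g y))))" if "y \<in> B" for y
    by (rule has_derivative_linear[OF diffeomorphism_has_derivative[OF k(1)]])
      (use k(2) g(1)[OF that] in auto)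
  define v where "v = frechet_derivative g (at 0) (vector [1, 0])"
  have z: "vector [0, 0] = (0 :: real^2)" by (simp add: vec_eq_iff forall_2)
  show thesis
  proof (rule that[of "\<lambda>s. g (vector [s, 0])" v \<epsilon>])
    show "g (vector [0, 0]) = p" using g0 z by simp
    have "((\<lambda>s::real. vector [s, 0] :: real^2) has_derivative (\<lambda>s. vector [s, 0])) (at 0)"
      by (rule bounded_linear_imp_has_derivative[OF bounded_linear_vector2(1)])
    then have "((\<lambda>s::real. g (vector [s, 0])) has_derivative (\<lambda>s. frechet_derivative g (at 0) (vector [s, 0]))) (at 0)"
      using has_derivative_compose[of "\<lambda>s::real. vector [s, 0] :: real^2" _ 0 UNIV g] derg[OF B0] z by simp
    moreover have "frechet_derivative g (at 0) (vector [s, 0]) = s *\<^sub>R v" for s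
    proof -
      have "vector [s, 0] = s *\<^sub>R (vector [1, 0] :: real^2)" by (simp add: vec_eq_iff forall_2)
      then show ?thesis using has_derivative_linear[OF derg[OF B0]] by (simp add: v_def linear_cmul)
    qed
    ultimately show "((\<lambda>s::real. g (vector [s, 0])) has_vector_derivative v) (at 0)"
      by (simp add: has_vector_derivative_def)
    show "\<psi>' p v \<noteq> 0"
    proof
      assume "\<psi>' p v = 0"
      then have "(vector [1, 0, 0] :: real^3) = 0"
        using chain[of 0 "vector [1, 0]"] \<epsilon> g0 linear_0[OF klin[OF B0]] by (simp add: v_def)
      then show False by (simp add: vec_eq_iff forall_3)
    qed
    show "\<epsilon> > 0" by fact
    fix s :: real assume "\<bar>s\<bar> < \<epsilon>"
    then have s: "norm (vector [s, 0] :: real^2) < \<epsilon>" by (simp add: norm_vector2)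
    define y where "y = (vector [s, 0] :: real^2)"
    have y: "g y \<in> U" "y \<in> B" using \<epsilon>(2)[OF s] by (auto simp: y_def)
    define w where "w = frechet_derivative g (at y) (vector [0, 1])"
    have "vector [v$1, 2 * y$2 * v$2, 3 * (y$2)^2 * v$2] = (0 :: real^3)" if "v = vector [0, 1]" for v :: "real^2"
      by (simp add: that y_def vec_eq_iff forall_3)
    then have "frechet_derivative k (at (\<psi> (g y))) (\<psi>' (g y) w) = 0"
      using chain[of y "vector [0,1]"] s by (simp add: w_def y_def)
    then have "\<psi>' (g y) w = 0"
      using diffeomorphism_derivative_eq_0[OF k(1)] k(2) g(1)[OF y(2)] by blast
    moreover have "w \<noteq> 0"
    proof
      assume "w = 0"
      then have "vector [0, 1] = (0 :: real^2)"
        using diffeomorphism_derivative_eq_0[OF dg y(2)] unfolding w_def by blast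
      then show False by (simp add: vec_eq_iff forall_2)
    qed
    ultimately show "g (vector [s, 0]) \<in> U \<and> (\<exists>w. w \<noteq> 0 \<and> \<psi>' (g (vector [s, 0])) w = 0)"
      using y unfolding y_def by blast
  qed
qed

text \<open>The two diffeomorphisms of the germ equivalence are the local inverses of
  \<open>\<kappa>\<close> and \<open>L\<close>.\<close>

lemma cuspidal_edge_atI:
  fixes \<kappa> :: "real^2 \<Rightarrow> complex" and L :: "real^3 \<Rightarrow> real^3"
  assumes S: "open S" "0 \<in> S" "smooth_on S \<kappa>" "inj (frechet_derivative \<kappa> (at 0))" "\<kappa> 0 = p"
    and W: "open W" "0 \<in> W" "smooth_on W L" "inj (frechet_derivative L (at 0))"
    and eq: "\<And>x. x \<in> S \<Longrightarrow> \<psi> (\<kappa> x) = L (vector [x$1, (x$2)^2, (x$2)^3])"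
  shows "cuspidal_edge_at \<psi> p"
proof -
  let ?c = "\<lambda>x::real^2. vector [x$1, (x$2)^2, (x$2)^3] :: real^3"
  obtain V where V: "V \<subseteq> W" "0 \<in> V" "diffeomorphism V (L ` V) L"
    using local_diffeomorphism[OF W(1,3,2,4)] by auto
  have contc: "continuous_on UNIV ?c"
    unfolding continuous_on_componentwise[of UNIV ?c]
    by (auto simp: Basis_vec_def inner_axis forall_3 intro!: continuous_intros)
  \<comment> \<open>The source is shrunk so that the model maps it into \<open>V\<close>, where
    \<open>L\<close> is injective.\<close>
  define S' where "S' = S \<inter> ?c -` V"
  have "open (?c -` V)"
    using V contc by (intro open_vimage) (auto simp: diffeomorphism_def)
  then have S': "open S'" "S' \<subseteq> S" using S by (auto simp: S'_def)
  have "?c 0 = 0" by (simp add: vec_eq_iff forall_3)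
  then have "0 \<in> S'" using S V by (simp add: S'_def)
  then obtain T where T: "T \<subseteq> S'" "0 \<in> T" "diffeomorphism T (\<kappa> ` T) \<kappa>"
    using local_diffeomorphism[OF S'(1) smooth_on_subset[OF S(3) S'(2)] _ S(4)] by auto
  have inj: "inj_on \<kappa> T" "inj_on L V" using T V by (auto simp: diffeomorphism_def bij_betw_def)
  have "germ_equivalent \<psi> p ?c 0"
    unfolding germ_equivalent_def
  proof (intro exI conjI ballI)
    show "diffeomorphism (\<kappa> ` T) T (inv_into T \<kappa>)" by (rule diffeomorphism_inverse[OF T(3)])
    show "diffeomorphism (L ` V) V (inv_into V L)" by (rule diffeomorphism_inverse[OF V(3)])
    show "p \<in> \<kappa> ` T" using S(5) T(2) by blast
    show "inv_into T \<kappa> p = 0" using inv_into_f_f[OF inj(1) T(2)] S(5) by simp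
    have *: "\<psi> (\<kappa> x) = L (?c x) \<and> ?c x \<in> V" if "x \<in> T" for x
      using that T(1) eq by (auto simp: S'_def)
    show "\<psi> ` \<kappa> ` T \<subseteq> L ` V" using * by auto
    fix z assume "z \<in> \<kappa> ` T"
    then obtain x where x: "x \<in> T" "z = \<kappa> x" by blast
    then show "inv_into V L (\<psi> z) = ?c (inv_into T \<kappa> z)"
      using * inv_into_f_f[OF inj(1)] inv_into_f_f[OF inj(2)] by simp
  qed
  then show ?thesis by (simp add: cuspidal_edge_at_def)
qed

section \<open>Fronts with a conormal map\<close>

lemma bounded_bilinear_cross3: "bounded_bilinear cross3"
  by (rule bilinear_conv_bounded_bilinear[THEN iffD1])
    (auto simp: bilinear_def cross_add_left cross_add_right cross_mult_left cross_mult_right intro!: linearI)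

text \<open>Cramer's rule; the determinant of v and \<open>\<eta>\<close> is
  \<open>Im (v * cnj \<eta>)\<close> up to sign, and independence makes it nonzero.\<close>

lemma complex_independent:
  fixes v \<eta> u :: complex
  assumes "\<And>c. v \<noteq> c *\<^sub>R \<eta>" "\<eta> \<noteq> 0"
  obtains a b where "u = a *\<^sub>R \<eta> + b *\<^sub>R v"
proof -
  define k where "k = Im (v * cnj \<eta>)"
  have k0: "k \<noteq> 0"
  proof
    assume "k = 0"
    then obtain r where "v * cnj \<eta> = of_real r"
      by (metis k_def complex_is_Real_iff Reals_cases)
    then have "v * (cnj \<eta> * \<eta>) = of_real r * \<eta>" by (metis mult.assoc)
    moreover have "cnj \<eta> * \<eta> = of_real ((cmod \<eta>)\<^sup>2)" by (metis complex_norm_square mult.commute)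
    ultimately have "v * of_real ((cmod \<eta>)\<^sup>2) = of_real r * \<eta>" by simp
    then have "v = (r / (cmod \<eta>)\<^sup>2) *\<^sub>R \<eta>"
      using assms(2) by (simp add: scaleR_conv_of_real field_simps)
    then show False using assms(1) by blast
  qed
  show thesis
  proof
    have "k *\<^sub>R u = Im (v * cnj u) *\<^sub>R \<eta> + Im (u * cnj \<eta>) *\<^sub>R v"
      by (simp add: k_def complex_eq_iff algebra_simps)
    then have "(1/k) *\<^sub>R (k *\<^sub>R u) = (1/k) *\<^sub>R (Im (v * cnj u) *\<^sub>R \<eta> + Im (u * cnj \<eta>) *\<^sub>R v)"
      by (rule arg_cong)
    then show "u = (Im (v * cnj u) / k) *\<^sub>R \<eta> + (Im (u * cnj \<eta>) / k) *\<^sub>R v"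
      using k0 by (simp add: scaleR_add_right)
  qed
qed

text \<open>Pairing the relation with n, then n', then m' makes it triangular: n kills
  \<open>Lx\<close> and \<open>Ly\<close> and gives D/3 on \<open>Lz\<close>, n' then isolates b,
  and m' isolates a, each time with a nonzero multiple of D = [n, n', m']. Only the n-component of
  \<open>Lz\<close> is needed, so \<open>Lz\<close> itself may stay unknown.\<close>

lemma normal_form_independent:
  fixes n n' m' Lx Ly Lz :: "real^3"
  assumes Lx: "Lx = x *\<^sub>R cross3 n n'" and x: "x \<noteq> 0"
    and Ly: "2 *\<^sub>R Ly = cross3 n (m' - \<mu> *\<^sub>R n')"
    and Lz: "n' \<bullet> (2 *\<^sub>R Ly) + 3 * (n \<bullet> Lz) = 0"
    and d: "n \<bullet> cross3 n' m' \<noteq> 0"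
    and abc: "a *\<^sub>R Lx + b *\<^sub>R Ly + c *\<^sub>R Lz = 0"
  shows "a = 0 \<and> b = 0 \<and> c = 0"
proof -
  define D where "D = n \<bullet> cross3 n' m'"
  have "2 * (n \<bullet> Ly) = n \<bullet> (2 *\<^sub>R Ly)" by simp
  also have "\<dots> = 0" unfolding Ly by (simp add: dot_cross_self)
  finally have nLy: "n \<bullet> Ly = 0" by simp
  have nLx: "n \<bullet> Lx = 0" unfolding Lx by (simp add: dot_cross_self)
  have "n' \<bullet> (2 *\<^sub>R Ly) = - D" unfolding Ly D_def by (simp add: cross3_simps)
  then have nLz: "3 * (n \<bullet> Lz) = D" using Lz by simp
  have "n \<bullet> (a *\<^sub>R Lx + b *\<^sub>R Ly + c *\<^sub>R Lz) = 0" using abc by simp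
  then have "c * (n \<bullet> Lz) = 0" using nLx nLy by (simp add: inner_add_right)
  then have c: "c = 0" using nLz d D_def by auto
  have e: "(2 * a) *\<^sub>R Lx + b *\<^sub>R (2 *\<^sub>R Ly) = 0"
  proof -
    have "(2 * a) *\<^sub>R Lx + b *\<^sub>R (2 *\<^sub>R Ly) = 2 *\<^sub>R (a *\<^sub>R Lx + b *\<^sub>R Ly + c *\<^sub>R Lz)"
      by (simp add: c scaleR_add_right)
    then show ?thesis using abc by simp
  qed
  have "n' \<bullet> ((2 * a) *\<^sub>R Lx + b *\<^sub>R (2 *\<^sub>R Ly)) = - b * D"
    unfolding Lx Ly D_def by (simp add: cross3_simps)
  then have b: "b = 0" using e d D_def by simp
  have "m' \<bullet> ((2 * a) *\<^sub>R Lx + b *\<^sub>R (2 *\<^sub>R Ly)) = 2 * a * x * D"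
    unfolding Lx b D_def by (simp add: cross3_simps)
  then have "a = 0" using e d x D_def by simp
  then show ?thesis using b c by simp
qed

lemma triple_rotate:
  fixes n X Y :: "real^3"
  shows "n \<bullet> cross3 (a *\<^sub>R X + b *\<^sub>R Y) ((- b) *\<^sub>R X + a *\<^sub>R Y) = (a\<^sup>2 + b\<^sup>2) * (n \<bullet> cross3 X Y)"
  by (simp add: cross3_simps power2_eq_square)

lemma has_vector_derivative_compose:
  assumes "(f has_vector_derivative f') (at t)" "(g has_derivative g') (at (f t))"
  shows "((\<lambda>t. g (f t)) has_vector_derivative g' f') (at t)"
  using has_derivative_compose[OF assms(1)[unfolded has_vector_derivative_def] assms(2)]
    linear_cmul[OF has_derivative_linear[OF assms(2)]] by (simp add: has_vector_derivative_def)

lemma vector_derivative_along_line: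
  assumes "(f has_derivative f') (at (p + t *\<^sub>R e))"
  shows "((\<lambda>t. f (p + t *\<^sub>R e)) has_vector_derivative f' e) (at t)"
  by (rule has_vector_derivative_compose[of "\<lambda>t. p + t *\<^sub>R e", OF _ assms])
    (auto simp: has_vector_derivative_def intro!: derivative_eq_intros)

lemma complex_orthogonal_decomposition:
  fixes z e :: complex
  assumes "e \<noteq> 0"
  shows "z = (Re (z * cnj e) / (cmod e)\<^sup>2) *\<^sub>R e + (Im (z * cnj e) / (cmod e)\<^sup>2) *\<^sub>R (\<i> * e)"
proof -
  define a b where "a = Re (z * cnj e)" and "b = Im (z * cnj e)"
  have w: "z * cnj e = of_real a + \<i> * of_real b" unfolding a_def b_def by (rule complex_eq)
  have "z * (of_real (cmod e))\<^sup>2 = z * (e * cnj e)"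
    by (simp only: complex_norm_square[symmetric] of_real_power)
  also have "\<dots> = z * cnj e * e" by (simp only: mult_ac)
  finally have "z * (of_real (cmod e))\<^sup>2 = z * cnj e * e" .
  then have "z * (of_real (cmod e))\<^sup>2 = (of_real a + \<i> * of_real b) * e" unfolding w .
  then have "z = (a / (cmod e)\<^sup>2) *\<^sub>R e + (b / (cmod e)\<^sup>2) *\<^sub>R (\<i> * e)"
    using assms by (simp add: scaleR_conv_of_real field_simps)
  then show ?thesis by (simp only: a_def b_def)
qed

text \<open>This isolates what the geometric criterion draws on: \<open>N\<close> is orthogonal to
  the image of the differential of \<open>\<psi>\<close>, which is a rotated copy of the
  differential of \<open>N\<close>. Weierstrass data do not appear here.\<close>

locale conormal_surface =
  fixes B :: "complex set" and N \<psi> :: "complex \<Rightarrow> real^3"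
  assumes open_B: "open B" and smooth_N: "smooth_on B N"
    and der_\<psi>: "z \<in> B \<Longrightarrow>
      (\<psi> has_derivative (\<lambda>w. cross3 (N z) (frechet_derivative N (at z) (\<i> * w)))) (at z)"
begin

abbreviation dN :: "complex \<Rightarrow> complex \<Rightarrow> real^3" where
  "dN z \<equiv> frechet_derivative N (at z)"

text \<open>Stands in for \<open>Lambda\<close>, from which it differs by the factor
  \<open>norm (N z)\<close>; unlike \<open>Lambda\<close> it involves \<open>N\<close>
  alone.\<close>

definition lam :: "complex \<Rightarrow> real" where
  "lam z = N z \<bullet> cross3 (dN z 1) (dN z \<i>)"

lemma der_N: "z \<in> B \<Longrightarrow> (N has_derivative dN z) (at z)"
  using smooth_on_has_derivative[OF smooth_N] .

lemma linear_dN: "z \<in> B \<Longrightarrow> linear (dN z)"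
  using has_derivative_linear[OF der_N] .

text \<open>Multiplication by w is a linear map of the plane with determinant |w|^2.\<close>

lemma triple_dN:
  assumes "z \<in> B"
  shows "N z \<bullet> cross3 (dN z w) (dN z (\<i> * w)) = (cmod w)\<^sup>2 * lam z"
proof -
  interpret linear "dN z" using linear_dN[OF assms] .
  have "w = Re w *\<^sub>R 1 + Im w *\<^sub>R \<i>" "\<i> * w = (- Im w) *\<^sub>R 1 + Re w *\<^sub>R \<i>"
    by (simp_all add: complex_eq_iff)
  then have "dN z w = Re w *\<^sub>R dN z 1 + Im w *\<^sub>R dN z \<i>"
    "dN z (\<i> * w) = (- Im w) *\<^sub>R dN z 1 + Re w *\<^sub>R dN z \<i>"
    by (metis add scaleR)+
  then show ?thesis
    using triple_rotate[of "N z" "Re w" _ "Im w"] by (simp add: lam_def cmod_power2)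
qed

lemma smooth_dN: "smooth_on B (\<lambda>z. dN z w)"
  by (rule smooth_on_frechet_derivative[OF smooth_N])

lemma smooth_lam: "smooth_on B lam"
  unfolding lam_def
  by (rule smooth_on_inner[OF open_B smooth_N smooth_on_bilinear[OF open_B bounded_bilinear_cross3 smooth_dN smooth_dN]])

lemma der_lam: "z \<in> B \<Longrightarrow> (lam has_derivative frechet_derivative lam (at z)) (at z)"
  using smooth_on_has_derivative[OF smooth_lam] .

lemma lam_eq_0:
  assumes "z \<in> B" "w \<noteq> 0" "cross3 (N z) (dN z (\<i> * w)) = 0"
  shows "lam z = 0"
proof -
  have "N z \<bullet> cross3 (dN z w) (dN z (\<i> * w)) = - (dN z w \<bullet> cross3 (N z) (dN z (\<i> * w)))"
    by (simp add: cross3_simps)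
  then show ?thesis using assms triple_dN[OF assms(1), of w] by simp
qed

text \<open>\<open>lam\<close> vanishes along the singular curve, so its differential kills the
  tangent v. As the differential of \<open>\<psi>\<close> kills \<open>\<eta>\<close> but not v, the
  two are independent; if the differential of \<open>lam\<close> killed \<open>\<eta>\<close> too,
  it would be zero.\<close>

lemma cuspidal_edge_at_imp_transversal:
  assumes p: "p \<in> B" and cusp: "cuspidal_edge_at \<psi> p"
    and \<eta>: "\<eta> \<noteq> 0" "cross3 (N p) (dN p (\<i> * \<eta>)) = 0"
    and nondeg: "frechet_derivative lam (at p) \<noteq> (\<lambda>_. 0)"
  shows "frechet_derivative lam (at p) \<eta> \<noteq> 0"
proof
  assume 0: "frechet_derivative lam (at p) \<eta> = 0"
  obtain \<sigma> v \<epsilon> where \<sigma>: "\<sigma> 0 = p" "(\<sigma> has_vector_derivative v) (at (0::real))"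
    "cross3 (N p) (dN p (\<i> * v)) \<noteq> 0" "\<epsilon> > 0"
    "\<And>s. \<bar>s\<bar> < \<epsilon> \<Longrightarrow> \<sigma> s \<in> B \<and> (\<exists>w. w \<noteq> 0 \<and> cross3 (N (\<sigma> s)) (dN (\<sigma> s) (\<i> * w)) = 0)"
    using cuspidal_edge_at_singular_curve[OF cusp open_B p der_\<psi>] by blast
  have "((\<lambda>s. lam (\<sigma> s)) has_derivative (\<lambda>s. frechet_derivative lam (at p) (s *\<^sub>R v))) (at 0)"
    using has_derivative_compose[of \<sigma> "\<lambda>s. s *\<^sub>R v" 0 UNIV lam] der_lam[OF p] \<sigma>(1,2)
    by (simp add: has_vector_derivative_def)
  moreover have "((\<lambda>s. lam (\<sigma> s)) has_derivative (\<lambda>s. 0)) (at 0)"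
  proof (rule has_derivative_transform_within_open[OF has_derivative_const])
    show "open {-\<epsilon><..<\<epsilon>}" "0 \<in> {-\<epsilon><..<\<epsilon>}" using \<sigma>(4) by auto
    fix s assume "s \<in> {-\<epsilon><..<\<epsilon>}"
    then have "\<bar>s\<bar> < \<epsilon>" by auto
    then show "0 = lam (\<sigma> s)" using \<sigma>(5) lam_eq_0 by metis
  qed
  ultimately have "(\<lambda>s. frechet_derivative lam (at p) (s *\<^sub>R v)) = (\<lambda>s. 0)"
    by (rule has_derivative_unique)
  from fun_cong[OF this, of 1] have v0: "frechet_derivative lam (at p) v = 0" by simp
  have lin: "linear (frechet_derivative lam (at p))" using has_derivative_linear[OF der_lam[OF p]] .
  have "v \<noteq> c *\<^sub>R \<eta>" for c
  proof
    assume "v = c *\<^sub>R \<eta>"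
    then have "cross3 (N p) (dN p (\<i> * v)) = c *\<^sub>R cross3 (N p) (dN p (\<i> * \<eta>))"
      using linear_cmul[OF linear_dN[OF p], of c "\<i> * \<eta>"] by (simp add: cross_mult_right)
    then show False using \<sigma>(3) \<eta>(2) by simp
  qed
  then have "frechet_derivative lam (at p) u = 0" for u
    using complex_independent[of v \<eta> u] \<eta>(1) 0 v0 linear_add[OF lin] linear_cmul[OF lin] by (metis add_0 scaleR_zero_right)
  then show False using nondeg by blast
qed


text \<open>The first partial derivative of \<open>L\<close> at 0 comes from the image of the
  singular curve. The other two come from the ray p + t e: its image has velocity n \<times> m
  there, which must equal 2 t L_y + 3 t^2 L_z, and both sides are compared to second order in
  t.\<close>

lemma normal_form_inj_derivative:
  fixes L :: "real^3 \<Rightarrow> real^3"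
  assumes p: "p \<in> B" "N p \<noteq> 0" and lam: "lam p = 0"
    and null: "cross3 (N p) (dN p (\<i> * e)) = 0"
    and trans: "frechet_derivative lam (at p) e \<noteq> 0"
    and W: "open W" "0 \<in> W" "smooth_on W L"
    and \<gamma>: "open I" "0 \<in> I" "\<gamma> 0 = p" "(\<gamma> has_vector_derivative \<gamma>') (at (0::real))" "Im (cnj e * \<gamma>') = 1"
    and L\<gamma>: "\<And>s. s \<in> I \<Longrightarrow> L (vector [s, 0, 0]) = \<psi> (\<gamma> s)"
    and r: "r > 0" and Le: "\<And>t. \<bar>t\<bar> < r \<Longrightarrow> L (vector [0, t^2, t^3]) = \<psi> (p + t *\<^sub>R e)"
      "\<And>t. \<bar>t\<bar> < r \<Longrightarrow> vector [0, t^2, t^3] \<in> W" "\<And>t. \<bar>t\<bar> < r \<Longrightarrow> p + t *\<^sub>R e \<in> B"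
  shows "inj (frechet_derivative L (at 0))"
proof -
  let ?D = "\<lambda>x. frechet_derivative L (at x)"
  let ?e1 = "vector [1, 0, 0] :: real^3" and ?e2 = "vector [0, 1, 0] :: real^3" and ?e3 = "vector [0, 0, 1] :: real^3"
  have derL: "(L has_derivative ?D x) (at x)" if "x \<in> W" for x
    using smooth_on_has_derivative[OF W(3) that] .
  have exp3: "?D x v = (v$1) *\<^sub>R ?D x ?e1 + (v$2) *\<^sub>R ?D x ?e2 + (v$3) *\<^sub>R ?D x ?e3" if "x \<in> W" for x and v :: "real^3"
  proof -
    have "v = (v$1) *\<^sub>R ?e1 + (v$2) *\<^sub>R ?e2 + (v$3) *\<^sub>R ?e3" by (simp add: vec_eq_iff forall_3)
    then have "?D x v = ?D x ((v$1) *\<^sub>R ?e1 + (v$2) *\<^sub>R ?e2 + (v$3) *\<^sub>R ?e3)" by simp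
    then show ?thesis
      using has_derivative_linear[OF derL[OF that]] by (simp only: linear_add linear_cmul)
  qed
  define c where "c = (\<lambda>t::real. vector [0, t^2, t^3] :: real^3)"
  have c0: "c 0 = 0" by (simp add: c_def vec_eq_iff forall_3)
  have derc: "(c has_vector_derivative vector [0, 2 * t, 3 * t^2]) (at t)" for t
    unfolding has_vector_derivative_def has_derivative_componentwise_within[of c]
    by (auto simp: c_def Basis_vec_def inner_axis forall_3 intro!: derivative_eq_intros)
  define n where "n = (\<lambda>t. N (p + t *\<^sub>R e))"
  define m where "m = (\<lambda>t. dN (p + t *\<^sub>R e) (\<i> * e))"
  define n' where "n' = dN p e"
  define m' where "m' = frechet_derivative (\<lambda>z. dN z (\<i> * e)) (at p) e"
  have n: "(n has_vector_derivative n') (at 0)"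
    unfolding n_def n'_def using vector_derivative_along_line[of N "dN p" p 0 e] der_N[OF p(1)] by simp
  have m: "(m has_vector_derivative m') (at 0)"
    unfolding m_def m'_def
    using vector_derivative_along_line[of "\<lambda>z. dN z (\<i> * e)" _ p 0 e] smooth_on_has_derivative[OF smooth_dN p(1)] by simp
  have mu: "\<exists>\<mu>. dN p (\<i> * e) = \<mu> *\<^sub>R N p"
    using null p(2) by (auto simp: cross_eq_0 collinear_lemma)
  then obtain \<mu> where \<mu>: "m 0 = \<mu> *\<^sub>R n 0" by (auto simp: m_def n_def)
  \<comment> \<open>The velocity along the ray divided by t; this exhibits L_y and L_z as the value
    and first derivative at 0, up to factors 2 and 3.\<close>
  define \<phi> where "\<phi> = (\<lambda>t. 2 *\<^sub>R ?D (c t) ?e2 + (3 * t) *\<^sub>R ?D (c t) ?e3)"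
  have nm: "cross3 (n t) (m t) = t *\<^sub>R \<phi> t" if t: "\<bar>t\<bar> < r" for t
  proof -
    have "((\<lambda>t. \<psi> (p + t *\<^sub>R e)) has_vector_derivative cross3 (n t) (m t)) (at t)"
      unfolding n_def m_def using vector_derivative_along_line[OF der_\<psi>[OF Le(3)[OF t]]] .
    moreover have "((\<lambda>t. L (c t)) has_vector_derivative ?D (c t) (vector [0, 2 * t, 3 * t^2])) (at t)"
      by (rule has_vector_derivative_compose[OF derc]) (use derL[OF Le(2)[OF t]] in \<open>simp add: c_def\<close>)
    then have "((\<lambda>t. \<psi> (p + t *\<^sub>R e)) has_vector_derivative ?D (c t) (vector [0, 2 * t, 3 * t^2])) (at t)"
      by (rule has_vector_derivative_transform_within_open[of _ _ _ "{-r<..<r}"])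
        (use t Le(1) in \<open>auto simp: c_def\<close>)
    ultimately have "cross3 (n t) (m t) = ?D (c t) (vector [0, 2 * t, 3 * t^2])"
      by (rule vector_derivative_unique_at)
    also have "\<dots> = t *\<^sub>R \<phi> t"
      using exp3[OF Le(2)[OF t], of "vector [0, 2 * t, 3 * t^2]"]
      by (simp add: \<phi>_def c_def scaleR_add_right power2_eq_square mult_ac)
    finally show ?thesis .
  qed
  \<comment> \<open>The cusp \<open>c\<close> has velocity 0 at t = 0, so the partial derivatives of
    \<open>L\<close> along it are stationary and contribute nothing to the derivative of
    \<open>\<phi>\<close>.\<close>
  have derDc: "((\<lambda>t. ?D (c t) v) has_vector_derivative 0) (at 0)" for v
  proof -
    let ?E = "frechet_derivative (\<lambda>x. ?D x v) (at 0)"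
    have E: "((\<lambda>x. ?D x v) has_derivative ?E) (at 0)"
      using smooth_on_has_derivative[OF smooth_on_frechet_derivative[OF W(3)] W(2)] .
    have "((\<lambda>t. ?D (c t) v) has_vector_derivative ?E (vector [0, 2 * 0, 3 * 0^2])) (at 0)"
      by (rule has_vector_derivative_compose[OF derc]) (simp add: c0 E)
    moreover have "vector [0, 2 * 0, 3 * 0^2] = (0 :: real^3)" by (simp add: vec_eq_iff forall_3)
    ultimately show ?thesis using linear_0[OF has_derivative_linear[OF E]] by simp
  qed
  have \<phi>: "(\<phi> has_vector_derivative 3 *\<^sub>R ?D 0 ?e3) (at 0)"
  proof -
    have "((\<lambda>t::real. 3 * t) has_vector_derivative 3) (at 0)"
      by (auto simp: has_vector_derivative_def intro!: derivative_eq_intros)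
    then have "(\<phi> has_vector_derivative (2 *\<^sub>R 0 + ((3 * 0) *\<^sub>R 0 + 3 *\<^sub>R ?D (c 0) ?e3))) (at 0)"
      unfolding \<phi>_def
      by (intro has_vector_derivative_add bounded_linear.has_vector_derivative[OF bounded_linear_scaleR_right derDc]
          bounded_bilinear.has_vector_derivative[OF bounded_bilinear_scaleR _ derDc])
    then show ?thesis by (simp add: c0)
  qed
  have \<phi>0: "\<phi> 0 = 2 *\<^sub>R ?D 0 ?e2" by (simp add: \<phi>_def c0)
  have Ly: "2 *\<^sub>R ?D 0 ?e2 = cross3 (n 0) (m' - \<mu> *\<^sub>R n')"
  proof -
    have "((\<lambda>t. t *\<^sub>R \<phi> t) has_vector_derivative (0 *\<^sub>R (3 *\<^sub>R ?D 0 ?e3) + 1 *\<^sub>R \<phi> 0)) (at 0)"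
      by (rule bounded_bilinear.has_vector_derivative[OF bounded_bilinear_scaleR has_vector_derivative_id \<phi>])
    then have "((\<lambda>t. t *\<^sub>R \<phi> t) has_vector_derivative \<phi> 0) (at 0)" by simp
    then have "((\<lambda>t. cross3 (n t) (m t)) has_vector_derivative \<phi> 0) (at 0)"
      by (rule has_vector_derivative_transform_within_open[of "\<lambda>t. t *\<^sub>R \<phi> t" _ _ "{-r<..<r}"])
        (use r nm in auto)
    moreover have "((\<lambda>t. cross3 (n t) (m t)) has_vector_derivative (cross3 (n 0) m' + cross3 n' (m 0))) (at 0)"
      by (rule bounded_bilinear.has_vector_derivative[OF bounded_bilinear_cross3 n m])
    ultimately have "\<phi> 0 = cross3 (n 0) m' + cross3 n' (m 0)" by (rule vector_derivative_unique_at)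
    also have "\<dots> = cross3 (n 0) (m' - \<mu> *\<^sub>R n')" unfolding \<mu> by (simp add: cross3_simps)
    finally show ?thesis by (simp add: \<phi>0)
  qed
  have Lz: "n' \<bullet> (2 *\<^sub>R ?D 0 ?e2) + 3 * (n 0 \<bullet> ?D 0 ?e3) = 0"
  proof -
    have "((\<lambda>t. n t \<bullet> \<phi> t) has_vector_derivative (n 0 \<bullet> (3 *\<^sub>R ?D 0 ?e3) + n' \<bullet> \<phi> 0)) (at 0)"
      by (rule bounded_bilinear.has_vector_derivative[OF bounded_bilinear_inner n \<phi>])
    \<comment> \<open>For nonzero t one divides n \<bullet> (n \<times> m) = 0 by t; at t = 0 the
      formula \<open>Ly\<close> is used instead. Differentiating then determines n \<bullet>
      L_z.\<close>
    moreover have n\<phi>: "n t \<bullet> \<phi> t = 0" if t: "\<bar>t\<bar> < r" for t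
    proof (cases "t = 0")
      case True
      have "n 0 \<bullet> \<phi> 0 = 0" unfolding \<phi>0 Ly by (rule dot_cross_self)
      then show ?thesis using True by simp
    next
      case False
      have "t * (n t \<bullet> \<phi> t) = n t \<bullet> cross3 (n t) (m t)" by (simp add: nm[OF t])
      then show ?thesis using False by (simp add: dot_cross_self)
    qed
    have "((\<lambda>t. n t \<bullet> \<phi> t) has_vector_derivative 0) (at 0)"
      by (rule has_vector_derivative_transform_within_open[OF has_vector_derivative_const, where S = "{-r<..<r}"])
        (use r n\<phi> in auto)
    ultimately have "n 0 \<bullet> (3 *\<^sub>R ?D 0 ?e3) + n' \<bullet> \<phi> 0 = 0" by (rule vector_derivative_unique_at)
    then show ?thesis by (simp add: \<phi>0)
  qed
  have e0: "e \<noteq> 0" using \<gamma>(5) by auto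
  \<comment> \<open>Components of \<i> \<open>\<gamma>'\<close> along e and \<i> e. The second is
    annihilated by the null condition, and the normalisation of \<open>\<gamma>'\<close> makes the
    first equal to -1/|e|^2.\<close>
  define x y where "x = Re (\<i> * \<gamma>' * cnj e) / (cmod e)\<^sup>2" and "y = Im (\<i> * \<gamma>' * cnj e) / (cmod e)\<^sup>2"
  have "Re (\<i> * \<gamma>' * cnj e) = -1" using \<gamma>(5) by (simp add: algebra_simps)
  then have x0: "x \<noteq> 0" using e0 by (simp add: x_def)
  have Lx: "?D 0 ?e1 = x *\<^sub>R cross3 (n 0) n'"
  proof -
    have s: "((\<lambda>s::real. vector [s, 0, 0] :: real^3) has_vector_derivative ?e1) (at 0)"
      unfolding has_vector_derivative_def has_derivative_componentwise_within[of "\<lambda>s::real. vector [s, 0, 0] :: real^3"]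
      by (auto simp: Basis_vec_def inner_axis forall_3 intro!: derivative_eq_intros)
    have z: "vector [0, 0, 0] = (0 :: real^3)" by (simp add: vec_eq_iff forall_3)
    have "((\<lambda>s. L (vector [s, 0, 0])) has_vector_derivative ?D 0 ?e1) (at 0)"
      by (rule has_vector_derivative_compose[OF s]) (simp add: z derL[OF W(2)])
    then have "((\<lambda>s. \<psi> (\<gamma> s)) has_vector_derivative ?D 0 ?e1) (at 0)"
      by (rule has_vector_derivative_transform_within_open[OF _ \<gamma>(1,2)]) (use L\<gamma> in auto)
    moreover have "((\<lambda>s. \<psi> (\<gamma> s)) has_vector_derivative cross3 (N p) (dN p (\<i> * \<gamma>'))) (at 0)"
      using has_vector_derivative_compose[OF \<gamma>(4), of \<psi>] der_\<psi>[OF p(1)] by (simp add: \<gamma>(3))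
    ultimately have "?D 0 ?e1 = cross3 (N p) (dN p (\<i> * \<gamma>'))" by (rule vector_derivative_unique_at)
    moreover have "\<i> * \<gamma>' = x *\<^sub>R e + y *\<^sub>R (\<i> * e)"
      unfolding x_def y_def by (rule complex_orthogonal_decomposition[OF e0])
    ultimately have "?D 0 ?e1 = cross3 (N p) (x *\<^sub>R dN p e + y *\<^sub>R dN p (\<i> * e))"
      by (simp only: linear_add[OF linear_dN[OF p(1)]] linear_cmul[OF linear_dN[OF p(1)]])
    then show ?thesis using null by (simp add: cross_add_right cross_mult_right n_def n'_def)
  qed
  \<comment> \<open>The triple product [N, dN(e), dN(\<i> e)] = |e|^2 lam is differentiated along
    the ray. Since m is a multiple of n at 0, every term but [n, n', m'] has a repeated
    direction.\<close>
  have d: "n 0 \<bullet> cross3 n' m' \<noteq> 0"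
  proof -
    have dn: "((\<lambda>t. dN (p + t *\<^sub>R e) e) has_vector_derivative frechet_derivative (\<lambda>z. dN z e) (at p) e) (at 0)"
      using vector_derivative_along_line[of "\<lambda>z. dN z e" _ p 0 e] smooth_on_has_derivative[OF smooth_dN p(1)] by simp
    have "((\<lambda>t. n t \<bullet> cross3 (dN (p + t *\<^sub>R e) e) (m t)) has_vector_derivative
       (n 0 \<bullet> (cross3 (dN (p + 0 *\<^sub>R e) e) m' + cross3 (frechet_derivative (\<lambda>z. dN z e) (at p) e) (m 0))
        + n' \<bullet> cross3 (dN (p + 0 *\<^sub>R e) e) (m 0))) (at 0)"
      by (rule bounded_bilinear.has_vector_derivative[OF bounded_bilinear_inner n
          bounded_bilinear.has_vector_derivative[OF bounded_bilinear_cross3 dn m]])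
    moreover have "n 0 \<bullet> (cross3 (dN (p + 0 *\<^sub>R e) e) m' + cross3 z (m 0))
        + n' \<bullet> cross3 (dN (p + 0 *\<^sub>R e) e) (m 0) = n 0 \<bullet> cross3 n' m'" for z
      unfolding \<mu> by (simp add: n'_def[symmetric] inner_add_right cross_mult_right dot_cross_self)
    ultimately have "((\<lambda>t. n t \<bullet> cross3 (dN (p + t *\<^sub>R e) e) (m t)) has_vector_derivative n 0 \<bullet> cross3 n' m') (at 0)"
      by (simp only:)
    then have "((\<lambda>t. (cmod e)\<^sup>2 * lam (p + t *\<^sub>R e)) has_vector_derivative n 0 \<bullet> cross3 n' m') (at 0)"
      by (rule has_vector_derivative_transform_within_open[of _ _ _ "{-r<..<r}"])
        (use r triple_dN[OF Le(3), of _ e] in \<open>simp_all add: n_def m_def abs_less_iff\<close>)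
    moreover have "((\<lambda>t. (cmod e)\<^sup>2 * lam (p + t *\<^sub>R e)) has_vector_derivative
        (cmod e)\<^sup>2 * frechet_derivative lam (at p) e) (at 0)"
      using vector_derivative_along_line[of lam _ p 0 e] der_lam[OF p(1)]
      by (intro bounded_linear.has_vector_derivative[OF bounded_linear_mult_right]) simp
    ultimately have "n 0 \<bullet> cross3 n' m' = (cmod e)\<^sup>2 * frechet_derivative lam (at p) e"
      by (rule vector_derivative_unique_at)
    then show ?thesis using trans e0 by simp
  qed
  show ?thesis
  proof (rule linear_injective_0[OF has_derivative_linear[OF derL[OF W(2)]], THEN iffD2], intro allI impI)
    fix v :: "real^3" assume "?D 0 v = 0"
    then have "(v$1) *\<^sub>R ?D 0 ?e1 + (v$2) *\<^sub>R ?D 0 ?e2 + (v$3) *\<^sub>R ?D 0 ?e3 = 0"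
      using exp3[OF W(2), of v] by (simp only:)
    from normal_form_independent[OF Lx x0 Ly Lz d this]
    have "v$1 = 0 \<and> v$2 = 0 \<and> v$3 = 0" .
    then show "v = 0" by (simp add: vec_eq_iff forall_3)
  qed
qed

text \<open>The implicit function theorem, with \<open>lam\<close> completed to a chart by a linear
  coordinate whose kernel is spanned by e; transversality makes the pair a local diffeomorphism.
  Using that coordinate as parameter yields \<open>Im (cnj e * \<gamma>') = 1\<close>.\<close>

lemma singular_curve:
  assumes p: "p \<in> B" and lam: "lam p = 0" and trans: "frechet_derivative lam (at p) e \<noteq> 0"
  obtains I \<gamma> \<gamma>' where "open I" "0 \<in> I" "smooth_on I \<gamma>" "\<gamma> 0 = p"
    "(\<gamma> has_vector_derivative \<gamma>') (at (0::real))" "Im (cnj e * \<gamma>') = 1"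
    "\<And>s. s \<in> I \<Longrightarrow> \<gamma> s \<in> B \<and> lam (\<gamma> s) = 0"
proof -
  have bl: "bounded_linear (\<lambda>z. Im (cnj e * z))"
    by (rule bounded_linear_compose[OF bounded_linear_Im bounded_linear_mult_right])
  have pair: "bounded_linear (\<lambda>a::real. (a, 0::real))" "bounded_linear (\<lambda>b::real. (0::real, b))"
    by (simp_all add: bounded_linear_Pair bounded_linear_zero bounded_linear_ident)
  define f where "f = (\<lambda>z. (lam z, Im (cnj e * z) - Im (cnj e * p)))"
  have "smooth_on B (\<lambda>z. (lam z, 0) + (0, Im (cnj e * z) - Im (cnj e * p)))"
    by (rule smooth_on_add[OF open_B smooth_on_linear_comp[OF open_B pair(1) smooth_lam]
        smooth_on_linear_comp[OF open_B pair(2) smooth_on_diff[OF open_B smooth_on_bounded_linear[OF bl] smooth_on_const]]])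
  then have smf: "smooth_on B f" by (simp add: f_def)
  have derf: "(f has_derivative (\<lambda>v. (frechet_derivative lam (at p) v, Im (cnj e * v)))) (at p)"
    unfolding f_def
    using has_derivative_Pair[OF der_lam[OF p] has_derivative_diff[OF bounded_linear_imp_has_derivative[OF bl] has_derivative_const]]
    by simp
  have lin: "linear (frechet_derivative lam (at p))" using has_derivative_linear[OF der_lam[OF p]] .
  have e0: "e \<noteq> 0" using trans linear_0[OF lin] by auto
  have "inj (frechet_derivative f (at p))"
    unfolding has_derivative_frechet[OF derf]
  proof (rule linear_injective_0[OF has_derivative_linear[OF derf], THEN iffD2], intro allI impI)
    fix v assume v: "(frechet_derivative lam (at p) v, Im (cnj e * v)) = 0"
    then have "Im (v * cnj e) = 0" by (simp add: zero_prod_def mult.commute)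
    then have v': "v = (Re (v * cnj e) / (cmod e)\<^sup>2) *\<^sub>R e"
      using complex_orthogonal_decomposition[OF e0, of v] by simp
    then have "frechet_derivative lam (at p) v = (Re (v * cnj e) / (cmod e)\<^sup>2) * frechet_derivative lam (at p) e"
      using linear_cmul[OF lin] by (metis real_scaleR_def)
    then have "Re (v * cnj e) / (cmod e)\<^sup>2 = 0" using v trans by (simp add: zero_prod_def)
    then show "v = 0" using v' by (metis scaleR_zero_left)
  qed
  then obtain V where V: "V \<subseteq> B" "p \<in> V" "diffeomorphism V (f ` V) f"
    using local_diffeomorphism[OF open_B smf p] by auto
  define g where "g = inv_into V f"
  have op: "open (f ` V)" and smg: "smooth_on (f ` V) g"
    using V(3) by (auto simp: diffeomorphism_def g_def)
  have inj: "inj_on f V" using V(3) by (auto simp: diffeomorphism_def bij_betw_def)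
  have g: "g y \<in> V" "f (g y) = y" if "y \<in> f ` V" for y
    using that by (auto simp: g_def inv_into_into f_inv_into_f)
  have fp: "f p = (0, 0)" by (simp add: f_def lam)
  define I where "I = (\<lambda>s::real. (0::real, s)) -` (f ` V)"
  have I: "open I" unfolding I_def by (intro open_vimage op continuous_intros)
  have I0: "0 \<in> I" using V(2) fp unfolding I_def by (metis imageI vimageI)
  define \<gamma> where "\<gamma> = (\<lambda>s. g (0, s))"
  have sm\<gamma>: "smooth_on I \<gamma>" unfolding \<gamma>_def
    by (rule smooth_on_compose[OF I op _ smooth_on_bounded_linear[OF pair(2)] smg]) (auto simp: I_def)
  have \<gamma>0: "\<gamma> 0 = p" unfolding \<gamma>_def g_def fp[symmetric] by (rule inv_into_f_f[OF inj V(2)])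
  have \<gamma>: "\<gamma> s \<in> B \<and> lam (\<gamma> s) = 0 \<and> Im (cnj e * \<gamma> s) = s + Im (cnj e * p)" if "s \<in> I" for s
  proof -
    have "(0, s) \<in> f ` V" using that by (simp add: I_def)
    from g[OF this] V(1) show ?thesis by (auto simp: f_def \<gamma>_def)
  qed
  define \<gamma>' where "\<gamma>' = frechet_derivative \<gamma> (at 0) 1"
  have d\<gamma>: "(\<gamma> has_derivative frechet_derivative \<gamma> (at 0)) (at 0)"
    using smooth_on_has_derivative[OF sm\<gamma> I0] .
  have "frechet_derivative \<gamma> (at 0) = (\<lambda>s. s *\<^sub>R \<gamma>')"
  proof
    fix s show "frechet_derivative \<gamma> (at 0) s = s *\<^sub>R \<gamma>'"
      unfolding \<gamma>'_def linear_cmul[OF has_derivative_linear[OF d\<gamma>], symmetric] by simp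
  qed
  then have vd: "(\<gamma> has_vector_derivative \<gamma>') (at 0)" using d\<gamma> by (simp add: has_vector_derivative_def)
  have "((\<lambda>s. Im (cnj e * \<gamma> s)) has_vector_derivative Im (cnj e * \<gamma>')) (at 0)"
    by (rule bounded_linear.has_vector_derivative[OF bl vd])
  moreover have "((\<lambda>s. s + Im (cnj e * p)) has_vector_derivative 1) (at 0)"
    by (auto simp: has_vector_derivative_def intro!: derivative_eq_intros)
  then have "((\<lambda>s. Im (cnj e * \<gamma> s)) has_vector_derivative 1) (at 0)"
    by (rule has_vector_derivative_transform_within_open[OF _ I I0]) (use \<gamma> in simp)
  ultimately have "Im (cnj e * \<gamma>') = 1" by (rule vector_derivative_unique_at)
  with that[OF I I0 sm\<gamma> \<gamma>0 vd] \<gamma> show thesis by blast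
qed

text \<open>
  \<open>q\<close> extends \<open>t \<mapsto> \<psi> (z + t w)\<close> holomorphically to complex \<open>t\<close>. Along the ruling
  \<open>(s, t) \<mapsto> \<gamma> s + t \<eta> (\<gamma> s)\<close> by null directions over the singular curve the linear term in \<open>t\<close> vanishes.
\<close>

lemma transversal_imp_cuspidal_edge_at:
  fixes \<eta> :: "complex \<Rightarrow> complex" and q :: "3 \<Rightarrow> complex \<times> complex \<times> complex \<Rightarrow> complex"
  defines "T \<equiv> {(z, w, \<zeta>). z + \<zeta> * w \<in> B \<and> z + cnj \<zeta> * w \<in> B}"
  assumes p: "p \<in> B" "N p \<noteq> 0" and lam: "lam p = 0" and sm\<eta>: "smooth_on B \<eta>"
    and null: "\<And>z. z \<in> B \<Longrightarrow> lam z = 0 \<Longrightarrow> cross3 (N z) (dN z (\<i> * \<eta> z)) = 0"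
    and trans: "frechet_derivative lam (at p) (\<eta> p) \<noteq> 0"
    and smq: "\<And>j. smooth_on T (q j)"
    and holq: "\<And>j z w. (\<lambda>\<zeta>. q j (z, w, \<zeta>)) holomorphic_on {\<zeta>. (z, w, \<zeta>) \<in> T}"
    and q: "\<And>j z w t. z + t *\<^sub>R w \<in> B \<Longrightarrow> q j (z, w, of_real t) = of_real (\<psi> (z + t *\<^sub>R w) $ j)"
  shows "cuspidal_edge_at \<psi> p"
proof -
  obtain I0 \<gamma> \<gamma>' where I0: "open I0" "0 \<in> I0" "smooth_on I0 \<gamma>" and \<gamma>0: "\<gamma> 0 = p"
    and \<gamma>': "(\<gamma> has_vector_derivative \<gamma>') (at (0::real))" "Im (cnj (\<eta> p) * \<gamma>') = 1"
    and \<gamma>: "\<And>s. s \<in> I0 \<Longrightarrow> \<gamma> s \<in> B \<and> lam (\<gamma> s) = 0"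
    using singular_curve[OF p(1) lam trans] by blast
  have sm\<eta>\<gamma>0: "smooth_on I0 (\<lambda>s. \<eta> (\<gamma> s))"
    by (rule smooth_on_compose[OF I0(1) open_B _ I0(3) sm\<eta>]) (use \<gamma> in auto)
  obtain \<rho> where \<rho>: "\<rho> > 0" "ball p \<rho> \<subseteq> B" using open_B p(1) openE by blast
  \<comment> \<open>By continuity \<open>M\<close> bounds \<open>\<eta>\<close> along the curve
    after shrinking to \<open>I\<close>. With R = \<rho>/(2 M) a ruling moves by at most \<rho>/2
    from a point within \<rho>/2 of p, hence stays in the ball, also for complex parameters.\<close>
  define M where "M = cmod (\<eta> p) + 1"
  have M: "M > 0" unfolding M_def by (simp add: add_nonneg_pos)
  define I where "I = (I0 \<inter> \<gamma> -` ball p (\<rho>/2)) \<inter> (I0 \<inter> (\<lambda>s. \<eta> (\<gamma> s)) -` ball 0 M)"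
  have I: "open I" unfolding I_def
    by (intro open_Int continuous_open_preimage smooth_on_imp_continuous_on I0 sm\<eta>\<gamma>0 open_ball)
  have I00: "0 \<in> I" using I0 \<rho> by (simp add: I_def \<gamma>0 M_def)
  have II: "I \<subseteq> I0" by (auto simp: I_def)
  have sm\<gamma>: "smooth_on I \<gamma>" and sm\<eta>\<gamma>: "smooth_on I (\<lambda>s. \<eta> (\<gamma> s))"
    using smooth_on_subset[OF _ II] I0(3) sm\<eta>\<gamma>0 by blast+
  define R where "R = \<rho> / (2 * M)"
  define r where "r = R / 2"
  have "R > 0" using \<rho> M by (simp add: R_def)
  then have R: "R > 0" "0 < r" "r < R" by (simp_all add: r_def)
  have inB: "\<gamma> s + \<zeta> * \<eta> (\<gamma> s) \<in> B" if "s \<in> I" "cmod \<zeta> < R" for s \<zeta>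
  proof -
    have s: "dist p (\<gamma> s) < \<rho>/2" "cmod (\<eta> (\<gamma> s)) < M" using that(1) by (auto simp: I_def)
    have "cmod (\<zeta> * \<eta> (\<gamma> s)) \<le> R * M"
      unfolding norm_mult by (rule mult_mono) (use that(2) s(2) R in auto)
    also have "R * M = \<rho>/2" using M by (simp add: R_def)
    finally have "dist (\<gamma> s) (\<gamma> s + \<zeta> * \<eta> (\<gamma> s)) \<le> \<rho>/2" by (simp add: dist_norm)
    then have "dist p (\<gamma> s + \<zeta> * \<eta> (\<gamma> s)) < \<rho>"
      using s(1) dist_triangle[of p "\<gamma> s + \<zeta> * \<eta> (\<gamma> s)" "\<gamma> s"] by linarith
    then show ?thesis using \<rho>(2) by auto
  qed
  have inBr: "\<gamma> s + t *\<^sub>R \<eta> (\<gamma> s) \<in> B" if "s \<in> I" "\<bar>t\<bar> < R" for s t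
    using inB[OF that(1), of "of_real t"] that(2) by (simp add: scaleR_conv_of_real)
  have inT: "(\<gamma> s, \<eta> (\<gamma> s), \<zeta>) \<in> T" if "s \<in> I" "cmod \<zeta> < R" for s \<zeta>
    using inB[OF that] inB[OF that(1), of "cnj \<zeta>"] that(2) by (simp add: T_def)
  define Q where "Q = (\<lambda>j (s, \<zeta>). q j (\<gamma> s, \<eta> (\<gamma> s), \<zeta>))"
  have opT: "open T"
  proof -
    have "T = (\<lambda>x. fst x + snd (snd x) * fst (snd x)) -` B \<inter> (\<lambda>x. fst x + cnj (snd (snd x)) * fst (snd x)) -` B"
      by (auto simp: T_def)
    also have "open \<dots>" by (intro open_Int open_vimage open_B continuous_intros)
    finally show ?thesis .
  qed
  let ?IR = "I \<times> ball (0::complex) R"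
  have oIR: "open ?IR" by (intro open_Times I open_ball)
  have smQ: "smooth_on ?IR (Q j)" for j
  proof -
    have l: "bounded_linear (\<lambda>a::complex. (a, 0::complex \<times> complex))"
        "bounded_linear (\<lambda>b::complex. (0::complex, b, 0::complex))" "bounded_linear (\<lambda>b::complex. (0::complex, 0::complex, b))"
      by (simp_all add: bounded_linear_Pair bounded_linear_zero bounded_linear_ident)
    have fst: "smooth_on ?IR (\<lambda>x. h (fst x))" if "smooth_on I h" for h :: "real \<Rightarrow> complex"
      by (rule smooth_on_compose[OF oIR I _ smooth_on_bounded_linear[OF bounded_linear_fst] that]) auto
    have "smooth_on ?IR (\<lambda>x. (\<gamma> (fst x), 0) + ((0, \<eta> (\<gamma> (fst x)), 0) + (0, 0, snd x)))"
      by (rule smooth_on_add[OF oIR smooth_on_linear_comp[OF oIR l(1) fst[OF sm\<gamma>]]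
         smooth_on_add[OF oIR smooth_on_linear_comp[OF oIR l(2) fst[OF sm\<eta>\<gamma>]]
          smooth_on_linear_comp[OF oIR l(3) smooth_on_bounded_linear[OF bounded_linear_snd]]]])
    then have "smooth_on ?IR (\<lambda>x. (\<gamma> (fst x), \<eta> (\<gamma> (fst x)), snd x))" by simp
    from smooth_on_compose[OF oIR opT _ this smq[of j]]
    have "smooth_on ?IR (\<lambda>x. q j (\<gamma> (fst x), \<eta> (\<gamma> (fst x)), snd x))"
      using inT by force
    then show ?thesis by (simp add: Q_def case_prod_unfold)
  qed
  have holQ: "(\<lambda>\<zeta>. Q j (s, \<zeta>)) holomorphic_on ball 0 R" if "s \<in> I" for j s
  proof -
    have "(\<lambda>\<zeta>. q j (\<gamma> s, \<eta> (\<gamma> s), \<zeta>)) holomorphic_on ball 0 R"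
      by (rule holomorphic_on_subset[OF holq]) (use inT that in auto)
    then show ?thesis by (simp add: Q_def)
  qed
  \<comment> \<open>A complex derivative can be read off along the real axis. There
    \<open>Q j\<close> is a component of \<open>\<psi>\<close> on the ruling, with velocity zero
    because the ruling starts in a null direction at a singular point.\<close>
  have d0: "deriv (\<lambda>\<zeta>. Q j (s, \<zeta>)) 0 = 0" if s: "s \<in> I" for j s
  proof -
    have sB: "\<gamma> s \<in> B" "lam (\<gamma> s) = 0" using \<gamma> s II by auto
    have "((\<lambda>\<zeta>. Q j (s, \<zeta>)) has_field_derivative deriv (\<lambda>\<zeta>. Q j (s, \<zeta>)) 0) (at 0)"
      by (rule holomorphic_derivI[OF holQ[OF s] open_ball]) (use R in auto)
    then have "((\<lambda>\<zeta>. Q j (s, \<zeta>)) has_derivative (\<lambda>h. deriv (\<lambda>\<zeta>. Q j (s, \<zeta>)) 0 * h)) (at (of_real 0))"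
      by (simp add: has_field_derivative_def)
    moreover have "(of_real has_vector_derivative (1::complex)) (at (0::real))"
      by (auto simp: has_vector_derivative_def scaleR_conv_of_real intro!: derivative_eq_intros)
    ultimately have 1: "((\<lambda>t::real. Q j (s, of_real t)) has_vector_derivative deriv (\<lambda>\<zeta>. Q j (s, \<zeta>)) 0 * 1) (at 0)"
      by (intro has_vector_derivative_compose[where f = of_real and g = "\<lambda>\<zeta>. Q j (s, \<zeta>)"])
    have bl: "bounded_linear (\<lambda>v::real^3. complex_of_real (v $ j))"
      by (rule bounded_linear_compose[OF bounded_linear_of_real bounded_linear_vec_nth])
    have "((\<lambda>t. \<psi> (\<gamma> s + t *\<^sub>R \<eta> (\<gamma> s))) has_vector_derivative cross3 (N (\<gamma> s)) (dN (\<gamma> s) (\<i> * \<eta> (\<gamma> s)))) (at 0)"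
      using vector_derivative_along_line[of \<psi> _ "\<gamma> s" 0 "\<eta> (\<gamma> s)"] der_\<psi>[OF sB(1)] by simp
    then have "((\<lambda>t. \<psi> (\<gamma> s + t *\<^sub>R \<eta> (\<gamma> s))) has_vector_derivative 0) (at 0)"
      unfolding null[OF sB] .
    from bounded_linear.has_vector_derivative[OF bl this]
    have "((\<lambda>t. complex_of_real (\<psi> (\<gamma> s + t *\<^sub>R \<eta> (\<gamma> s)) $ j)) has_vector_derivative 0) (at 0)" by simp
    then have "((\<lambda>t::real. Q j (s, of_real t)) has_vector_derivative 0) (at 0)"
      by (rule has_vector_derivative_transform_within_open[where S = "{-R<..<R}"])
        (use R q inBr[OF s] in \<open>auto simp: Q_def abs_less_iff\<close>)
    then show ?thesis using vector_derivative_unique_at[OF 1] by simp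
  qed
  let ?W = "{x :: real^3. x$1 \<in> I \<and> \<bar>x$2\<bar> < r\<^sup>2}"
  have "\<exists>L. smooth_on ?W L \<and> (\<forall>s t. s \<in> I \<longrightarrow> \<bar>t\<bar> < r \<longrightarrow> L (vector [s, t^2, t^3]) = Q j (s, of_real t))" for j
  proof (rule cusp_factorization[OF I R(2,3) smQ[of j]])
    fix L assume "smooth_on ?W L" "\<And>s t. s \<in> I \<Longrightarrow> \<bar>t\<bar> < r \<Longrightarrow> L (vector [s, t^2, t^3]) = Q j (s, of_real t)"
    then show ?thesis by blast
  qed (use holQ d0 in auto)
  then have "\<forall>j. \<exists>L. smooth_on ?W L \<and> (\<forall>s t. s \<in> I \<longrightarrow> \<bar>t\<bar> < r \<longrightarrow> L (vector [s, t^2, t^3]) = Q j (s, of_real t))"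
    by (rule allI)
  from choice[OF this] obtain Lc where Lc: "\<And>j. smooth_on ?W (Lc j)"
    "\<And>j s t. s \<in> I \<Longrightarrow> \<bar>t\<bar> < r \<Longrightarrow> Lc j (vector [s, t^2, t^3]) = Q j (s, of_real t)"
    by blast
  \<comment> \<open>Off the image of the model \<open>Lc j\<close> need not be real. Real parts keep
    both smoothness and the identity on that image.\<close>
  define L :: "real^3 \<Rightarrow> real^3" where "L = (\<lambda>x. \<chi> j. Re (Lc j x))"
  have W: "open ?W"
  proof -
    have "?W = (\<lambda>x. x$1) -` I \<inter> (\<lambda>x. \<bar>x$2\<bar>) -` {..<r\<^sup>2}" by auto
    also have "open \<dots>" by (intro open_Int open_vimage I continuous_intros open_lessThan)
    finally show ?thesis .
  qed
  have smL: "smooth_on ?W L"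
    by (rule smooth_on_vec_lambda[OF W]) (use smooth_on_linear_comp[OF W bounded_linear_Re Lc(1)] in \<open>simp add: L_def\<close>)
  have L: "L (vector [s, t^2, t^3]) = \<psi> (\<gamma> s + t *\<^sub>R \<eta> (\<gamma> s))" if "s \<in> I" "\<bar>t\<bar> < r" for s t
    using Lc(2)[OF that] q[OF inBr[OF that(1)], of t] that R by (simp add: L_def Q_def vec_eq_iff)
  have injL: "inj (frechet_derivative L (at 0))"
  proof (rule normal_form_inj_derivative[OF p lam null[OF p(1) lam] trans W _ smL I I00 \<gamma>0 \<gamma>' _ R(2)])
    show "L (vector [s, 0, 0]) = \<psi> (\<gamma> s)" if "s \<in> I" for s using L[OF that, of 0] R by simp
    fix t :: real assume t: "\<bar>t\<bar> < r"
    show "L (vector [0, t^2, t^3]) = \<psi> (p + t *\<^sub>R \<eta> p)" using L[OF I00 t] by (simp add: \<gamma>0)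
    have "\<bar>t\<bar>\<^sup>2 < r\<^sup>2" using t by (intro power_strict_mono) auto
    then show "vector [0, t^2, t^3] \<in> ?W" using I00 by simp
    show "p + t *\<^sub>R \<eta> p \<in> B" using inBr[OF I00, of t] t R by (simp add: \<gamma>0)
  qed (use I00 R in auto)
  let ?S = "{x :: real^2. x$1 \<in> I \<and> \<bar>x$2\<bar> < r}"
  have S: "open ?S"
  proof -
    have "?S = (\<lambda>x. x$1) -` I \<inter> (\<lambda>x. \<bar>x$2\<bar>) -` {..<r}" by auto
    also have "open \<dots>" by (intro open_Int open_vimage I continuous_intros open_lessThan)
    finally show ?thesis .
  qed
  \<comment> \<open>The chart given by the ruling; its differential at 0 has columns
    \<open>\<gamma>'\<close> and \<open>\<eta> p\<close>, independent by the normalisation of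
    \<open>\<gamma>'\<close>.\<close>
  define \<kappa> :: "real^2 \<Rightarrow> complex" where "\<kappa> = (\<lambda>x. \<gamma> (x$1) + (x$2) *\<^sub>R \<eta> (\<gamma> (x$1)))"
  have comp1: "smooth_on ?S (\<lambda>x. h (x$1))" if "smooth_on I h" for h :: "real \<Rightarrow> complex"
    by (rule smooth_on_compose[OF S I _ smooth_on_bounded_linear[OF bounded_linear_vec_nth] that]) auto
  have sm\<kappa>: "smooth_on ?S \<kappa>"
    unfolding \<kappa>_def
    by (rule smooth_on_add[OF S comp1[OF sm\<gamma>] smooth_on_scaleR[OF S smooth_on_bounded_linear[OF bounded_linear_vec_nth] comp1[OF sm\<eta>\<gamma>]]])
  have S0: "0 \<in> ?S" using I00 R by simp
  have der\<kappa>: "frechet_derivative \<kappa> (at 0) = (\<lambda>x. (x$1) *\<^sub>R \<gamma>' + (x$2) *\<^sub>R \<eta> p)"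
  proof (rule has_derivative_frechet)
    have v: "((\<lambda>x::real^2. x $ i) has_derivative (\<lambda>x. x $ i)) (at 0)" for i
      by (rule bounded_linear_imp_has_derivative[OF bounded_linear_vec_nth])
    have g: "((\<lambda>x::real^2. \<gamma> (x $ 1)) has_derivative (\<lambda>x. (x $ 1) *\<^sub>R \<gamma>')) (at 0)"
      using has_derivative_compose[OF v, of \<gamma> "\<lambda>s. s *\<^sub>R \<gamma>'"] \<gamma>'(1) by (simp add: has_vector_derivative_def)
    have e: "((\<lambda>x::real^2. \<eta> (\<gamma> (x $ 1))) has_derivative (\<lambda>x. frechet_derivative (\<lambda>s. \<eta> (\<gamma> s)) (at 0) (x $ 1))) (at 0)"
      using has_derivative_compose[OF v, of "\<lambda>s. \<eta> (\<gamma> s)"] smooth_on_has_derivative[OF sm\<eta>\<gamma> I00] by simp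
    show "(\<kappa> has_derivative (\<lambda>x. (x$1) *\<^sub>R \<gamma>' + (x$2) *\<^sub>R \<eta> p)) (at 0)"
      unfolding \<kappa>_def using has_derivative_add[OF g has_derivative_scaleR[OF v e]] by (simp add: \<gamma>0)
  qed
  have inj\<kappa>: "inj (frechet_derivative \<kappa> (at 0))"
  proof (rule linear_injective_0[OF has_derivative_linear[OF smooth_on_has_derivative[OF sm\<kappa> S0]], THEN iffD2], intro allI impI)
    fix x :: "real^2" assume "frechet_derivative \<kappa> (at 0) x = 0"
    then have 0: "(x$1) *\<^sub>R \<gamma>' + (x$2) *\<^sub>R \<eta> p = 0" by (simp add: der\<kappa>)
    have "Im (cnj (\<eta> p) * ((x$1) *\<^sub>R \<gamma>' + (x$2) *\<^sub>R \<eta> p)) = x$1 * Im (cnj (\<eta> p) * \<gamma>')"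
      by (simp add: algebra_simps)
    then have x1: "x$1 = 0" using 0 \<gamma>'(2) by simp
    have "\<eta> p \<noteq> 0" using \<gamma>'(2) by auto
    then have "x$2 = 0" using 0 x1 by simp
    then show "x = 0" using x1 by (simp add: vec_eq_iff forall_2)
  qed
  show ?thesis
  proof (rule cuspidal_edge_atI[OF S S0 sm\<kappa> inj\<kappa> _ W _ smL injL])
    show "\<kappa> 0 = p" by (simp add: \<kappa>_def \<gamma>0)
    show "\<psi> (\<kappa> x) = L (vector [x$1, (x$2)^2, (x$2)^3])" if "x \<in> ?S" for x
      using L that by (simp add: \<kappa>_def)
  qed (use I00 R in auto)
qed

end

section \<open>Local representation of an affine maxface\<close>

text \<open>A sheet over an evenly covered neighbourhood gives a holomorphic branch k of the inverse
  of \<open>q\<close>. The product relation for the derivatives will cancel the factor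
  \<open>deriv q\<close> in \<open>weierstrass_pair\<close>.\<close>

lemma covering_local_section:
  assumes "open U" "universal_cover U D q" "p \<in> U"
  obtains T k where "open T" "p \<in> T" "T \<subseteq> U" "k holomorphic_on T"
    "\<And>z. z \<in> T \<Longrightarrow> k z \<in> D \<and> q (k z) = z \<and> deriv q (k z) * deriv k z = 1"
proof -
  have D: "open D" "q holomorphic_on D" "covering_space D q U"
    using assms(2) by (auto simp: universal_cover_def)
  have qD: "q ` D = U" using D(3) by (simp add: covering_space_def)
  obtain T v where T: "p \<in> T" "openin (top_of_set U) T" "\<Union>v = D \<inter> q -` T"
    "\<And>u. u \<in> v \<Longrightarrow> openin (top_of_set D) u" "\<And>u. u \<in> v \<Longrightarrow> \<exists>q'. homeomorphism u T q q'"
    using D(3) assms(3) unfolding covering_space_def by meson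
  obtain w where "w \<in> D" "q w = p" using qD assms(3) by blast
  then obtain u where u: "u \<in> v" "w \<in> u" using T(1,3) by blast
  have oT: "open T" "T \<subseteq> U" using T(2) assms(1) openin_open_eq by blast+
  have ou: "open u" "u \<subseteq> D" using T(4)[OF u(1)] D(1) openin_open_eq by blast+
  obtain q' where hom: "homeomorphism u T q q'" using T(5)[OF u(1)] by blast
  have inj: "inj_on q u" using hom by (metis homeomorphism_def inj_on_inverseI)
  have im: "q ` u = T" using hom by (simp add: homeomorphism_def)
  obtain k where k: "k holomorphic_on q ` u" "\<And>z. z \<in> u \<Longrightarrow> deriv q z * deriv k (q z) = 1"
    "\<And>z. z \<in> u \<Longrightarrow> k (q z) = z"
    using holomorphic_has_inverse[OF holomorphic_on_subset[OF D(2) ou(2)] ou(1) inj] by blast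
  have "k z \<in> D \<and> q (k z) = z \<and> deriv q (k z) * deriv k z = 1" if "z \<in> T" for z
  proof -
    have "z \<in> q ` u" using that im by simp
    then obtain x where "x \<in> u" "z = q x" by blast
    then show ?thesis using k(2,3) ou(2) by auto
  qed
  then show thesis using that[OF oT(1) T(1) oT(2)] k(1) im by blast
qed

text \<open>One component of the integral formula for \<open>\<psi>\<close>. The part \<Phi>
  \<times> d\<Phi> is holomorphic with primitive K (up to the factor \<i>). For the mixed part, \<i>
  cnj \<Phi> \<times> \<Phi> is real, and its differential is 2 Re(\<i> cnj \<Phi> \<times>
  d\<Phi>).\<close>

lemma lelieuvre_potential_derivative:
  fixes a b K :: "complex \<Rightarrow> complex"
  assumes a: "(a has_field_derivative a') (at z)" and b: "(b has_field_derivative b') (at z)"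
    and K: "(K has_field_derivative \<i> * (a z * b' - b z * a')) (at z)"
  shows "((\<lambda>z. 2 * Re (K z) + Re (\<i> * (cnj (a z) * b z - cnj (b z) * a z))) has_derivative
    (\<lambda>w. 2 * Re (\<i> * ((a z + cnj (a z)) * b' - (b z + cnj (b z)) * a') * w))) (at z)"
proof -
  have da: "(a has_derivative (\<lambda>w. a' * w)) (at z)" and db: "(b has_derivative (\<lambda>w. b' * w)) (at z)"
    and dK: "(K has_derivative (\<lambda>w. \<i> * (a z * b' - b z * a') * w)) (at z)"
    using a b K by (simp_all add: has_field_derivative_def)
  have ca: "((\<lambda>z. cnj (a z)) has_derivative (\<lambda>w. cnj (a' * w))) (at z)"
    and cb: "((\<lambda>z. cnj (b z)) has_derivative (\<lambda>w. cnj (b' * w))) (at z)"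
    by (rule bounded_linear.has_derivative[OF bounded_linear_cnj da] bounded_linear.has_derivative[OF bounded_linear_cnj db])+
  have re: "((\<lambda>z. Re (f z)) has_derivative (\<lambda>w. Re (f' w))) (at z)" if "(f has_derivative f') (at z)" for f f'
    by (rule bounded_linear.has_derivative[OF bounded_linear_Re that])
  have "((\<lambda>z. 2 * Re (K z) + Re (\<i> * (cnj (a z) * b z - cnj (b z) * a z))) has_derivative
    (\<lambda>w. 2 * Re (\<i> * (a z * b' - b z * a') * w) + Re (\<i> * ((cnj (a z) * (b' * w) + cnj (a' * w) * b z) -
       (cnj (b z) * (a' * w) + cnj (b' * w) * a z))))) (at z)"
    by (intro has_derivative_add has_derivative_mult_right re has_derivative_diff has_derivative_mult da db ca cb dK)
  moreover have "2 * Re (\<i> * (a z * b' - b z * a') * w) + Re (\<i> * ((cnj (a z) * (b' * w) + cnj (a' * w) * b z) -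
       (cnj (b z) * (a' * w) + cnj (b' * w) * a z))) =
     2 * Re (\<i> * ((a z + cnj (a z)) * b' - (b z + cnj (b z)) * a') * w)" for w
    by (simp add: algebra_simps)
  ultimately show ?thesis by simp
qed

lemma ccross3_components:
  fixes a b :: "complex^3"
  shows
  "ccross3 a b $ 1 = a$2 * b$3 - a$3 * b$2"
  "ccross3 a b $ 2 = a$3 * b$1 - a$1 * b$3"
  "ccross3 a b $ 3 = a$1 * b$2 - a$2 * b$1"
  by (simp_all add: ccross3_def)

text \<open>An isotropic vector of C^3: the sum of the squares of its entries is 0.\<close>

definition weierstrass_null :: "complex \<Rightarrow> complex^3" where
  "weierstrass_null g = vector [1 - g\<^sup>2, \<i> * (1 + g\<^sup>2), 2 * g]"

text \<open>Replaces the path integrals by a closed formula in holomorphic functions and their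
  conjugates. The formula serves twice: to differentiate \<open>\<psi>\<close>, and to extend it to
  complex parameters along lines.\<close>

lemma affine_maxface_local_representation:
  fixes \<Phi> :: "complex \<Rightarrow> complex^3" and N \<psi> :: "complex \<Rightarrow> real^3"
  assumes max: "affine_maxface U D q \<Phi> N \<psi>" and wp: "weierstrass_pair U D q \<Phi> g \<omega>h"
    and p: "p \<in> U" and np: "\<not> is_pole g p"
  obtains r F H c where "r > 0" "ball p r \<subseteq> U" "g holomorphic_on ball p r"
    "\<And>j. F j holomorphic_on ball p r" "\<And>j :: 3. H j holomorphic_on ball p r"
    "\<And>z j. z \<in> ball p r \<Longrightarrow> N z $ j = 2 * Re (F j z)"
    "\<And>z j. z \<in> ball p r \<Longrightarrow> (F j has_field_derivative \<omega>h z / 2 * weierstrass_null (g z) $ j) (at z)"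
    "\<And>z j. z \<in> ball p r \<Longrightarrow> (H j has_field_derivative
       \<i> * ccross3 (\<chi> j. F j z) ((\<omega>h z / 2) *s weierstrass_null (g z)) $ j) (at z)"
    "\<And>z j. z \<in> ball p r \<Longrightarrow> \<psi> z $ j = c j + (2 * Re (H j z) + Re (\<i> * ccross3 (\<chi> j. cnj (F j z)) (\<chi> j. F j z) $ j))"
proof -
  have U: "open U" and uc: "universal_cover U D q" and hol\<Phi>: "\<And>j. (\<lambda>w. \<Phi> w $ j) holomorphic_on D"
    and N: "\<And>w. w \<in> D \<Longrightarrow> cvec (N (q w)) = \<Phi> w + cnj_vec (\<Phi> w)"
    and \<psi>: "\<And>\<gamma> j. valid_path \<gamma> \<Longrightarrow> path_image \<gamma> \<subseteq> D \<Longrightarrow>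
        \<psi> (q (pathfinish \<gamma>)) $ j - \<psi> (q (pathstart \<gamma>)) $ j =
             2 * Re (\<i> * contour_integral \<gamma> (\<lambda>w. ccross3 (\<Phi> w + cnj_vec (\<Phi> w)) (deriv_vec \<Phi> w) $ j))"
    using max unfolding affine_maxface_def holomorphic_vec_on_def by blast+
  have D: "open D" using uc by (simp add: universal_cover_def)
  have g: "g nicely_meromorphic_on U" and \<omega>h: "\<omega>h holomorphic_on U"
    and d\<Phi>: "\<And>w. w \<in> D \<Longrightarrow> \<not> is_pole g (q w) \<Longrightarrow> deriv_vec \<Phi> w =
          (\<omega>h (q w) * deriv q w / 2) *s weierstrass_null (g (q w))"
    using wp unfolding weierstrass_pair_def weierstrass_null_def by blast+
  obtain T k where T: "open T" "p \<in> T" "T \<subseteq> U" "k holomorphic_on T"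
    and k: "\<And>z. z \<in> T \<Longrightarrow> k z \<in> D \<and> q (k z) = z \<and> deriv q (k z) * deriv k z = 1"
    using covering_local_section[OF U uc p] by blast
  \<comment> \<open>The Weierstrass formula is available only away from poles, so a whole disc free
    of them is needed.\<close>
  have "g analytic_on {p}" using nicely_meromorphic_on_imp_analytic_at[OF g p np] .
  then obtain T' where T': "open T'" "p \<in> T'" "g holomorphic_on T'"
    unfolding analytic_at by blast
  obtain r where r: "r > 0" "ball p r \<subseteq> T \<inter> T'"
    using openE[OF open_Int[OF T(1) T'(1)]] T(2) T'(2) by blast
  let ?B = "ball p r"
  have rT: "?B \<subseteq> T" "?B \<subseteq> T'" using r by auto
  have nopole: "\<not> is_pole g z" if "z \<in> ?B" for z
    using not_is_pole_holomorphic[OF T'(1) _ T'(3)] that rT by blast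
  have holk: "k holomorphic_on ?B" using holomorphic_on_subset[OF T(4) rT(1)] .
  have kD: "k ` ?B \<subseteq> D" and qk: "\<And>z. z \<in> ?B \<Longrightarrow> q (k z) = z"
    and dk: "\<And>z. z \<in> ?B \<Longrightarrow> deriv q (k z) * deriv k z = 1"
    using k rT by blast+
  have derk: "(k has_field_derivative deriv k z) (at z)" if "z \<in> ?B" for z
    using holomorphic_derivI[OF holk open_ball that] .
  define F where "F = (\<lambda>j z. \<Phi> (k z) $ j)"
  have holF: "F j holomorphic_on ?B" for j
    unfolding F_def using holomorphic_on_compose_gen[OF holk hol\<Phi> kD] by (simp add: o_def)
  define F' where "F' = (\<lambda>z. (\<omega>h z / 2) *s weierstrass_null (g z))"
  have d\<Phi>k: "deriv_vec \<Phi> (k z) $ j * deriv k z = F' z $ j" if z: "z \<in> ?B" for z j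
  proof -
    have "k z \<in> D" using z kD by blast
    then have "deriv_vec \<Phi> (k z) $ j * deriv k z = \<omega>h z / 2 * weierstrass_null (g z) $ j * (deriv q (k z) * deriv k z)"
      using d\<Phi>[of "k z"] qk[OF z] nopole[OF z] by simp
    then show ?thesis using dk[OF z] by (simp add: F'_def)
  qed
  have dF: "(F j has_field_derivative F' z $ j) (at z)" if z: "z \<in> ?B" for z j
  proof -
    have "k z \<in> D" using z kD by blast
    then have "((\<lambda>w. \<Phi> w $ j) has_field_derivative deriv_vec \<Phi> (k z) $ j) (at (k z))"
      using holomorphic_derivI[OF hol\<Phi> D] by (simp add: deriv_vec_def)
    from DERIV_chain2[OF this derk[OF z]] show ?thesis by (simp add: F_def d\<Phi>k[OF z])
  qed
  have Nz: "N z $ j = 2 * Re (F j z)" if z: "z \<in> ?B" for z j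
  proof -
    have "k z \<in> D" using z kD by blast
    then have "cvec (N z) $ j = (\<Phi> (k z) + cnj_vec (\<Phi> (k z))) $ j" using N qk[OF z] by metis
    then have "complex_of_real (N z $ j) = F j z + cnj (F j z)"
      by (simp add: cvec_def cnj_vec_def F_def)
    then show ?thesis by (simp add: complex_add_cnj complex_eq_iff)
  qed
  have holg: "g holomorphic_on ?B" using holomorphic_on_subset[OF T'(3) rT(2)] .
  have hol\<omega>: "\<omega>h holomorphic_on ?B" using holomorphic_on_subset[OF \<omega>h] rT T(3) by blast
  have holF': "(\<lambda>z. F' z $ j) holomorphic_on ?B" for j
    using exhaust_3[of j] unfolding F'_def weierstrass_null_def
    by (auto intro!: holomorphic_intros holg hol\<omega>)
  have holcross: "(\<lambda>z. \<i> * ccross3 (\<chi> j. F j z) (F' z) $ j) holomorphic_on ?B" for j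
    using exhaust_3[of j] by (auto simp: ccross3_components intro!: holomorphic_intros holF holF')
  have "\<exists>h. \<forall>z\<in>?B. (h has_field_derivative \<i> * ccross3 (\<chi> j. F j z) (F' z) $ j) (at z)" for j
  proof -
    obtain h where "\<And>z. z \<in> ?B \<Longrightarrow> (h has_field_derivative \<i> * ccross3 (\<chi> j. F j z) (F' z) $ j) (at z within ?B)"
      using holomorphic_convex_primitive'[OF convex_ball open_ball holcross[of j]] by blast
    then show ?thesis using at_within_open[OF _ open_ball] by metis
  qed
  then have "\<forall>j. \<exists>h. \<forall>z\<in>?B. (h has_field_derivative \<i> * ccross3 (\<chi> j. F j z) (F' z) $ j) (at z)" by blast
  from choice[OF this] obtain H where dH: "\<And>j z. z \<in> ?B \<Longrightarrow> (H j has_field_derivative \<i> * ccross3 (\<chi> j. F j z) (F' z) $ j) (at z)"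
    by blast
  have holH: "H j holomorphic_on ?B" for j
    unfolding holomorphic_on_open[OF open_ball] using dH by blast
  \<comment> \<open>The candidate antiderivative: H accounts for \<Phi> \<times> d\<Phi>, the second
    term for cnj \<Phi> \<times> d\<Phi>.\<close>
  define G where "G = (\<lambda>j z. 2 * Re (H j z) + Re (\<i> * ccross3 (\<chi> j. cnj (F j z)) (\<chi> j. F j z) $ j))"
  define C where "C = (\<lambda>j z. ccross3 (\<chi> j. F j z + cnj (F j z)) (F' z) $ j)"
  have dG: "(G j has_derivative (\<lambda>w. 2 * Re (\<i> * C j z * w))) (at z)" if z: "z \<in> ?B" for j z
  proof -
    consider "j = 1" | "j = 2" | "j = 3" using exhaust_3 by blast
    then show ?thesis
    proof cases
      case 1
      have "(H 1 has_field_derivative \<i> * (F 2 z * F' z $ 3 - F 3 z * F' z $ 2)) (at z)"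
        using dH[OF z, of 1] by (simp only: ccross3_components vec_lambda_beta)
      from lelieuvre_potential_derivative[OF dF[OF z] dF[OF z] this] show ?thesis
        unfolding 1 G_def C_def by (simp only: ccross3_components vec_lambda_beta)
    next
      case 2
      have "(H 2 has_field_derivative \<i> * (F 3 z * F' z $ 1 - F 1 z * F' z $ 3)) (at z)"
        using dH[OF z, of 2] by (simp only: ccross3_components vec_lambda_beta)
      from lelieuvre_potential_derivative[OF dF[OF z] dF[OF z] this] show ?thesis
        unfolding 2 G_def C_def by (simp only: ccross3_components vec_lambda_beta)
    next
      case 3
      have "(H 3 has_field_derivative \<i> * (F 1 z * F' z $ 2 - F 2 z * F' z $ 1)) (at z)"
        using dH[OF z, of 3] by (simp only: ccross3_components vec_lambda_beta)
      from lelieuvre_potential_derivative[OF dF[OF z] dF[OF z] this] show ?thesis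
        unfolding 3 G_def C_def by (simp only: ccross3_components vec_lambda_beta)
    qed
  qed
  have incr: "\<psi> z $ j - \<psi> p $ j = G j z - G j p" if z: "z \<in> ?B" for z j
  proof -
    let ?l = "linepath p z"
    have seg: "closed_segment p z \<subseteq> ?B"
      using z r(1) by (intro closed_segment_subset) auto
    have lB: "?l t \<in> ?B" if "t \<in> {0..1}" for t
      using that seg linepath_in_path[of t p z] by (auto simp: path_image_def)
    \<comment> \<open>The segment is lifted to the cover, where the increment of
      \<open>\<psi>\<close> is prescribed as a contour integral; pulled back to the segment, that
      integral is evaluated with \<open>G\<close>.\<close>
    define \<gamma> where "\<gamma> = k \<circ> ?l"
    have v\<gamma>: "valid_path \<gamma>" unfolding \<gamma>_def
      by (rule valid_path_compose_holomorphic[OF valid_path_linepath holk open_ball]) (use seg in simp)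
    have "path_image \<gamma> \<subseteq> D" using seg kD by (auto simp: \<gamma>_def path_image_compose)
    from \<psi>[OF v\<gamma> this, of j] have inc: "\<psi> z $ j - \<psi> p $ j = 2 * Re (\<i> * contour_integral \<gamma>
         (\<lambda>w. ccross3 (\<Phi> w + cnj_vec (\<Phi> w)) (deriv_vec \<Phi> w) $ j))"
      using qk[OF z] qk[of p] r(1) by (simp add: \<gamma>_def pathfinish_compose pathstart_compose)
    have "contour_integral \<gamma> (\<lambda>w. ccross3 (\<Phi> w + cnj_vec (\<Phi> w)) (deriv_vec \<Phi> w) $ j) =
        integral {0..1} (\<lambda>t. C j (?l t) * (z - p))"
      unfolding contour_integral_integral
    proof (rule integral_cong)
      fix t :: real assume t: "t \<in> {0..1}"
      have "(\<gamma> has_vector_derivative (z - p) * deriv k (?l t)) (at t)"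
        unfolding \<gamma>_def by (rule field_vector_diff_chain_at[OF has_vector_derivative_linepath_within derk[OF lB[OF t]]])
      then have "vector_derivative \<gamma> (at t) = (z - p) * deriv k (?l t)"
        by (rule vector_derivative_at)
      \<comment> \<open>The velocity of the lifted path supplies exactly the factor
        \<open>deriv k\<close> that converts the derivative of \<Phi> into
        \<open>F'\<close>.\<close>
      moreover have "ccross3 (\<Phi> (\<gamma> t) + cnj_vec (\<Phi> (\<gamma> t))) (deriv_vec \<Phi> (\<gamma> t)) $ j * deriv k (?l t) = C j (?l t)"
        using exhaust_3[of j] unfolding C_def
        by (auto simp: ccross3_components d\<Phi>k[OF lB[OF t], symmetric] \<gamma>_def F_def cnj_vec_def left_diff_distrib mult.assoc)
      ultimately show "ccross3 (\<Phi> (\<gamma> t) + cnj_vec (\<Phi> (\<gamma> t))) (deriv_vec \<Phi> (\<gamma> t)) $ j * vector_derivative \<gamma> (at t)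
          = C j (?l t) * (z - p)" by (metis mult.assoc mult.commute)
    qed
    moreover have "continuous_on {0..1} (\<lambda>t. C j (?l t) * (z - p))"
    proof -
      have "continuous_on ?B (F i)" "continuous_on ?B (\<lambda>z. F' z $ i)" for i
        by (intro holomorphic_on_imp_continuous_on holF holF')+
      then have "continuous_on ?B (C j)" using exhaust_3[of j] unfolding C_def
        by (elim disjE) (simp_all only: ccross3_components vec_lambda_beta continuous_on_diff continuous_on_mult
            continuous_on_add continuous_on_cnj)
      then have "continuous_on {0..1} (\<lambda>t. C j (?l t))"
        by (rule continuous_on_compose2) (use lB in \<open>auto intro!: continuous_intros\<close>)
      then show ?thesis by (intro continuous_intros)
    qed
    then have int: "(\<lambda>t. C j (?l t) * (z - p)) integrable_on {0..1}" by (rule integrable_continuous_real)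
    have "bounded_linear (\<lambda>x. 2 * Re (\<i> * x))"
      by (rule bounded_linear_compose[OF bounded_linear_mult_right
          bounded_linear_compose[OF bounded_linear_Re bounded_linear_mult_right]])
    from integral_linear[OF int this]
    have "integral {0..1} (\<lambda>t. 2 * Re (\<i> * (C j (?l t) * (z - p)))) =
        2 * Re (\<i> * integral {0..1} (\<lambda>t. C j (?l t) * (z - p)))" by (simp add: o_def)
    moreover have "((\<lambda>t. 2 * Re (\<i> * (C j (?l t) * (z - p)))) has_integral (G j (?l 1) - G j (?l 0))) {0..1}"
    proof (rule fundamental_theorem_of_calculus)
      fix t :: real assume t: "t \<in> {0..1}"
      have "((\<lambda>t. G j (?l t)) has_vector_derivative 2 * Re (\<i> * C j (?l t) * (z - p))) (at t)"
        by (rule has_vector_derivative_compose[OF has_vector_derivative_linepath_within dG[OF lB[OF t]]])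
      then show "((\<lambda>t. G j (?l t)) has_vector_derivative 2 * Re (\<i> * (C j (?l t) * (z - p)))) (at t within {0..1})"
        by (simp add: has_vector_derivative_at_within mult.assoc)
    qed simp
    then have "integral {0..1} (\<lambda>t. 2 * Re (\<i> * (C j (?l t) * (z - p)))) = G j z - G j p"
      by (simp add: integral_unique linepath_def)
    ultimately show ?thesis using inc by simp
  qed
  have \<psi>G: "\<psi> z $ j = (\<psi> p $ j - G j p) + G j z" if "z \<in> ?B" for z j using incr[OF that, of j] by linarith
  show thesis
  proof (rule that[of r F H "\<lambda>j. \<psi> p $ j - G j p"])
    show "r > 0" by fact
    show "?B \<subseteq> U" using rT T(3) by blast
    show "g holomorphic_on ?B" by fact
    show "F j holomorphic_on ?B" "H j holomorphic_on ?B" for j by fact+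
    fix z j assume z: "z \<in> ?B"
    show "N z $ j = 2 * Re (F j z)" using Nz[OF z] .
    show "(F j has_field_derivative \<omega>h z / 2 * weierstrass_null (g z) $ j) (at z)"
      using dF[OF z] by (simp add: F'_def)
    show "(H j has_field_derivative
       \<i> * ccross3 (\<chi> j. F j z) ((\<omega>h z / 2) *s weierstrass_null (g z)) $ j) (at z)"
      using dH[OF z] by (simp add: F'_def)
    show "\<psi> z $ j = \<psi> p $ j - G j p + (2 * Re (H j z) + Re (\<i> * ccross3 (\<chi> j. cnj (F j z)) (\<chi> j. F j z) $ j))"
      using \<psi>G[OF z] by (simp add: G_def)
  qed
qed

section \<open>The criterion in terms of the Weierstrass pair\<close>

lemma has_derivative_vec:
  fixes f :: "'a::real_normed_vector \<Rightarrow> real^'n"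
  assumes "\<And>j. ((\<lambda>x. f x $ j) has_derivative (\<lambda>h. f' h $ j)) (at a within S)"
  shows "(f has_derivative f') (at a within S)"
  unfolding has_derivative_componentwise_within[of f] using assms by (auto simp: Basis_vec_def inner_axis)

text \<open>Up to the factor \<open>1 + \<bar>g\<bar>\<^sup>2\<close>, the Gauss map of the minimal immersion with Weierstrass function \<open>g\<close>.\<close>

definition gauss_vector :: "complex \<Rightarrow> real^3" where
  "gauss_vector g = vector [2 * Re g, 2 * Im g, (cmod g)\<^sup>2 - 1]"

text \<open>The complex bilinear product of n with \<open>weierstrass_null g\<close>; at n = N it is
  the function A.\<close>

definition null_pairing :: "real^3 \<Rightarrow> complex \<Rightarrow> complex" where
  "null_pairing n g = of_real (n$1) * (1 - g\<^sup>2) + \<i> * of_real (n$2) * (1 + g\<^sup>2) + 2 * g * of_real (n$3)"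

text \<open>Real and imaginary parts of the isotropic vector are orthogonal of length 1 + |g|^2 and
  span the plane orthogonal to the Gauss vector, which has the same length. Hence both sides are (1
  + |g|^2)^2 times the projection of n to that plane.\<close>

lemma Re_weierstrass_null_pairing:
  "Re (weierstrass_null g $ j * cnj (null_pairing n g)) =
    (1 + (cmod g)\<^sup>2)\<^sup>2 * n$j - gauss_vector g $ j * (n \<bullet> gauss_vector g)"
  unfolding gauss_vector_def cmod_power2 using exhaust_3[of j]
  by (auto simp: weierstrass_null_def null_pairing_def inner_vec_def sum_3 power2_eq_square algebra_simps)

text \<open>The two factors are orthogonal vectors of length |w| (1 + |g|^2), and their cross
  product is a positive multiple of the Gauss vector unless w = 0.\<close>

lemma triple_weierstrass:
  "n \<bullet> cross3 (\<chi> j. Re (w * weierstrass_null g $ j)) (\<chi> j. Re (w * weierstrass_null g $ j * \<i>)) =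
    (cmod w)\<^sup>2 * (1 + (cmod g)\<^sup>2) * (n \<bullet> gauss_vector g)"
  unfolding gauss_vector_def cmod_power2
  by (simp add: weierstrass_null_def inner_vec_def sum_3 cross3_def power2_eq_square algebra_simps)

lemma weierstrass_null_orthogonal_gauss_vector:
  "(\<chi> j. Re (w * weierstrass_null g $ j)) \<bullet> gauss_vector g = 0"
  unfolding gauss_vector_def cmod_power2
  by (simp add: weierstrass_null_def inner_vec_def sum_3 power2_eq_square algebra_simps)

text \<open>The last factor on the right is what differentiating the Gauss vector in g produces when
  paired with n; this relates the differential of \<open>lam\<close> to A on the singular
  set.\<close>

lemma cnj_null_pairing:
  assumes "n \<bullet> gauss_vector g = 0"
  shows "cnj (null_pairing n g) = of_real (1 + (cmod g)\<^sup>2) * (of_real (n$1) - \<i> * of_real (n$2) + cnj g * of_real (n$3))"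
proof -
  have "cnj (null_pairing n g) + cnj g * of_real (n \<bullet> gauss_vector g) = of_real (1 + (cmod g)\<^sup>2) * (of_real (n$1) - \<i> * of_real (n$2) + cnj g * of_real (n$3))"
    unfolding gauss_vector_def cmod_power2
    by (simp add: complex_eq_iff null_pairing_def inner_vec_def sum_3 power2_eq_square algebra_simps)
  then show ?thesis using assms by simp
qed

text \<open>The singularity relation is solved for the third entry of n, whose coefficient is |g|^2
  - 1.\<close>

lemma null_pairing_norm_neq_1:
  assumes "n \<bullet> gauss_vector g = 0"
  shows "of_real ((cmod g)\<^sup>2 - 1) * null_pairing n g =
    of_real (- (1 + (cmod g)\<^sup>2)) * (of_real (n$1) * (1 + g\<^sup>2) + \<i> * of_real (n$2) * (1 - g\<^sup>2))"
proof -
  have "of_real ((cmod g)\<^sup>2 - 1) * null_pairing n g =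
    of_real (- (1 + (cmod g)\<^sup>2)) * (of_real (n$1) * (1 + g\<^sup>2) + \<i> * of_real (n$2) * (1 - g\<^sup>2)) + 2 * g * of_real (n \<bullet> gauss_vector g)"
    unfolding gauss_vector_def cmod_power2
    by (simp add: complex_eq_iff null_pairing_def inner_vec_def sum_3 power2_eq_square algebra_simps)
  then show ?thesis using assms by simp
qed

text \<open>On the unit circle the relation reads N1 Re g + N2 Im g = 0 and no longer involves N3.
  It eliminates N1 in the first formula and N2 in the second.\<close>

lemma null_pairing_norm_1:
  assumes "n \<bullet> gauss_vector g = 0" "cmod g = 1"
  shows "of_real (Re g) * null_pairing n g = 2 * \<i> * g * (of_real (n$2) - \<i> * of_real (n$3) * of_real (Re g))"
    and "of_real (Im g) * null_pairing n g = - 2 * \<i> * g * (of_real (n$1) + \<i> * of_real (n$3) * of_real (Im g))"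
proof -
  obtain a b where g: "g = Complex a b" by (cases g)
  have s: "n$1 * a + n$2 * b = 0" using assms by (simp add: g gauss_vector_def inner_vec_def sum_3 mult_ac)
  have ab: "a * a + b * b = 1" using assms(2) by (simp add: g cmod_def power2_eq_square)
  \<comment> \<open>Division by g turns 1 - g^2 into -2 \<i> Im g and 1 + g^2 into 2 Re g when |g| =
    1; the remainder carries the factor 1 - |g|^2.\<close>
  have p: "null_pairing n g = 2 * g * (of_real (n$3) + \<i> * of_real (n$2 * a - n$1 * b))"
  proof -
    have "null_pairing n g = 2 * g * (of_real (n$3) + \<i> * of_real (n$2 * a - n$1 * b)) + of_real (1 - (a * a + b * b)) * (of_real (n$1) + \<i> * of_real (n$2))"
      by (simp add: g complex_eq_iff null_pairing_def power2_eq_square algebra_simps)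
    then show ?thesis by (simp add: ab)
  qed
  \<comment> \<open>(N1, N2) is orthogonal to the unit vector (a, b), hence it is N2 a - N1 b times
    (-b, a).\<close>
  have "a * (n$2 * a - n$1 * b) = n$2 * (a * a + b * b) - b * (n$1 * a + n$2 * b)" by (simp add: algebra_simps)
  then have 1: "a * (n$2 * a - n$1 * b) = n$2" using s ab by simp
  have "b * (n$2 * a - n$1 * b) = a * (n$1 * a + n$2 * b) - n$1 * (a * a + b * b)" by (simp add: algebra_simps)
  then have 2: "b * (n$2 * a - n$1 * b) = - n$1" using s ab by simp
  have "of_real (Re g) * null_pairing n g = 2 * g * (of_real (a * n$3) + \<i> * of_real (a * (n$2 * a - n$1 * b)))"
    unfolding p by (simp add: g algebra_simps)
  then show "of_real (Re g) * null_pairing n g = 2 * \<i> * g * (of_real (n$2) - \<i> * of_real (n$3) * of_real (Re g))"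
    unfolding 1 by (simp add: g algebra_simps)
  have "of_real (Im g) * null_pairing n g = 2 * g * (of_real (b * n$3) + \<i> * of_real (b * (n$2 * a - n$1 * b)))"
    unfolding p by (simp add: g algebra_simps)
  then show "of_real (Im g) * null_pairing n g = - 2 * \<i> * g * (of_real (n$1) + \<i> * of_real (n$3) * of_real (Im g))"
    unfolding 2 by (simp add: g algebra_simps)
qed

lemma Re_mult_real: "Re (of_real r * z) = r * Re z"
  by simp

lemma Im_mult_real: "Im (of_real r * z) = r * Im z"
  by simp

text \<open>Passing to a real multiple changes the square by a positive factor only; this is why
  each case of the criterion may use its own multiple of A.\<close>

lemma Im_square_eq_iff:
  fixes A B :: complex and r s :: real
  assumes "of_real r * A = of_real s * B" "r \<noteq> 0" "s \<noteq> 0"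
  shows "Im (A\<^sup>2 * u) \<noteq> 0 \<longleftrightarrow> Im (B\<^sup>2 * u) \<noteq> 0"
proof -
  have "of_real (r\<^sup>2) * (A\<^sup>2 * u) = of_real (s\<^sup>2) * (B\<^sup>2 * u)"
    using arg_cong[OF assms(1), of "\<lambda>x. x\<^sup>2 * u"] by (simp add: power_mult_distrib mult.assoc)
  from arg_cong[OF this, of Im] have "r\<^sup>2 * Im (A\<^sup>2 * u) = s\<^sup>2 * Im (B\<^sup>2 * u)"
    by (simp only: Im_mult_real)
  then show ?thesis using assms(2,3) by (metis mult_eq_0_iff power_eq_0_iff)
qed

lemma Im_null_pairing_iff:
  fixes n :: "real^3" and g \<omega> g' :: complex
  assumes S: "n \<bullet> gauss_vector g = 0"
  defines "N1 \<equiv> complex_of_real (n$1)" and "N2 \<equiv> complex_of_real (n$2)" and "N3 \<equiv> complex_of_real (n$3)"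
  shows "Im ((null_pairing n g)\<^sup>2 * (cnj g' * \<omega>)) \<noteq> 0 \<longleftrightarrow>
    (cmod g \<noteq> 1 \<and> Im ((N1 * (1 + g\<^sup>2) + \<i> * N2 * (1 - g\<^sup>2))\<^sup>2 * cnj g' * \<omega>) \<noteq> 0) \<or>
    (cmod g = 1 \<and>
      ((Re g \<noteq> 0 \<and> Im ((N2 - \<i> * N3 * of_real (Re g))\<^sup>2 * cnj g' * g\<^sup>2 * \<omega>) \<noteq> 0) \<or>
       (Im g \<noteq> 0 \<and> Im ((N1 + \<i> * N3 * of_real (Im g))\<^sup>2 * cnj g' * g\<^sup>2 * \<omega>) \<noteq> 0)))"
proof -
  let ?P = "Im ((null_pairing n g)\<^sup>2 * (cnj g' * \<omega>)) \<noteq> 0"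
  have ne: "?P \<longleftrightarrow> Im ((N1 * (1 + g\<^sup>2) + \<i> * N2 * (1 - g\<^sup>2))\<^sup>2 * cnj g' * \<omega>) \<noteq> 0" if "cmod g \<noteq> 1"
  proof -
    have "(cmod g)\<^sup>2 - 1 \<noteq> 0"
      using that power2_eq_1_iff[of "cmod g"] norm_ge_zero[of g] by auto
    moreover have "- (1 + (cmod g)\<^sup>2) \<noteq> 0" using zero_le_power2[of "cmod g"] by linarith
    ultimately have nz: "(cmod g)\<^sup>2 - 1 \<noteq> 0" "- (1 + (cmod g)\<^sup>2) \<noteq> 0" .
    then show ?thesis
      using Im_square_eq_iff[of "(cmod g)\<^sup>2 - 1" "null_pairing n g" "- (1 + (cmod g)\<^sup>2)"
          "N1 * (1 + g\<^sup>2) + \<i> * N2 * (1 - g\<^sup>2)" "cnj g' * \<omega>", OF _ nz] null_pairing_norm_neq_1[OF S]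
      by (simp add: N1_def N2_def mult.assoc)
  qed
  have eqR: "?P \<longleftrightarrow> Im ((N2 - \<i> * N3 * of_real (Re g))\<^sup>2 * cnj g' * g\<^sup>2 * \<omega>) \<noteq> 0" if "cmod g = 1" "Re g \<noteq> 0"
  proof -
    \<comment> \<open>Squaring the factor \<i> g gives - g^2: the g^2 of the case |g| = 1 stems from
      here, and the sign does not affect nonvanishing.\<close>
    have "?P \<longleftrightarrow> Im ((\<i> * g * (N2 - \<i> * N3 * of_real (Re g)))\<^sup>2 * (cnj g' * \<omega>)) \<noteq> 0"
      by (rule Im_square_eq_iff[of "Re g" _ 2])
        (use null_pairing_norm_1(1)[OF S that(1)] that in \<open>simp_all add: N2_def N3_def mult.assoc\<close>)
    also have "(\<i> * g * (N2 - \<i> * N3 * of_real (Re g)))\<^sup>2 * (cnj g' * \<omega>) =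
        - ((N2 - \<i> * N3 * of_real (Re g))\<^sup>2 * cnj g' * g\<^sup>2 * \<omega>)"
      by (simp add: power_mult_distrib mult_ac)
    finally show ?thesis by (simp only: uminus_complex.sel neg_equal_0_iff_equal)
  qed
  have eqI: "?P \<longleftrightarrow> Im ((N1 + \<i> * N3 * of_real (Im g))\<^sup>2 * cnj g' * g\<^sup>2 * \<omega>) \<noteq> 0" if "cmod g = 1" "Im g \<noteq> 0"
  proof -
    have "?P \<longleftrightarrow> Im ((\<i> * g * (N1 + \<i> * N3 * of_real (Im g)))\<^sup>2 * (cnj g' * \<omega>)) \<noteq> 0"
      by (rule Im_square_eq_iff[of "Im g" _ "-2"])
        (use null_pairing_norm_1(2)[OF S that(1)] that in \<open>simp_all add: N1_def N3_def mult.assoc\<close>)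
    also have "(\<i> * g * (N1 + \<i> * N3 * of_real (Im g)))\<^sup>2 * (cnj g' * \<omega>) =
        - ((N1 + \<i> * N3 * of_real (Im g))\<^sup>2 * cnj g' * g\<^sup>2 * \<omega>)"
      by (simp add: power_mult_distrib mult_ac)
    finally show ?thesis by (simp only: uminus_complex.sel neg_equal_0_iff_equal)
  qed
  \<comment> \<open>At least one alternative applies on the unit circle; where both do, each is
    equivalent to \<open>?P\<close>, so they agree.\<close>
  have "Re g \<noteq> 0 \<or> Im g \<noteq> 0" if "cmod g = 1" using that by (auto simp: cmod_def)
  then show ?thesis using ne eqR eqI by blast
qed


section \<open>From the maxface to its conormal surface\<close>

lemma dim_range_inj:
  fixes f :: "'a::euclidean_space \<Rightarrow> 'b::euclidean_space"
  assumes "linear f" "inj f"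
  shows "dim (range f) = DIM('a)"
  using dim_image_eq[of f UNIV] assms by (simp add: inj_on_subset)

text \<open>With X and Y the partial derivatives of \<open>N\<close> in u and v, the first two rows
  are those of \<open>\<psi>\<close>; the minus sign comes from \<i> \<i> = -1.\<close>

lemma det_lelieuvre_frame:
  fixes n X Y :: "real^3"
  assumes "n \<noteq> 0"
  shows "det (vector [cross3 n Y, - cross3 n X, n /\<^sub>R norm n] :: real^3^3) = norm n * (n \<bullet> cross3 X Y)"
proof -
  have "det (vector [cross3 n Y, - cross3 n X, n /\<^sub>R norm n] :: real^3^3) =
      inverse (norm n) * (cross3 n Y \<bullet> cross3 (- cross3 n X) n)"
    by (simp add: dot_cross_det[symmetric] cross_mult_right)
  also have "cross3 n Y \<bullet> cross3 (- cross3 n X) n = (n \<bullet> n) * (n \<bullet> cross3 X Y)"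
    by (simp add: cross3_simps)
  also have "n \<bullet> n = norm n * norm n" by (simp add: power2_norm_eq_inner[symmetric] power2_eq_square)
  finally show ?thesis using assms by simp
qed

lemma affine_maxface_cuspidal_edge_iff:
  fixes \<Phi> :: "complex \<Rightarrow> complex^3" and N \<psi> :: "complex \<Rightarrow> real^3"
  assumes max: "affine_maxface U D q \<Phi> N \<psi>" and nz: "\<forall>z\<in>U. N z \<noteq> 0"
    and wp: "weierstrass_pair U D q \<Phi> g \<omega>h" and p: "p \<in> U"
    and nd: "nondegenerate_singular_point N \<psi> p" and np: "\<not> is_pole g p"
  shows "N p \<bullet> gauss_vector (g p) = 0" "null_pairing (N p) (g p) * deriv g p \<noteq> 0"
    "cuspidal_edge_at \<psi> p \<longleftrightarrow> Im ((null_pairing (N p) (g p))\<^sup>2 * (cnj (deriv g p) * \<omega>h p)) \<noteq> 0"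
proof -
  obtain r F H c where r: "r > 0" "ball p r \<subseteq> U" and holg: "g holomorphic_on ball p r"
    and holF: "\<And>j. F j holomorphic_on ball p r" and holH: "\<And>j :: 3. H j holomorphic_on ball p r"
    and NF: "\<And>z j. z \<in> ball p r \<Longrightarrow> N z $ j = 2 * Re (F j z)"
    and dF: "\<And>z j. z \<in> ball p r \<Longrightarrow> (F j has_field_derivative \<omega>h z / 2 * weierstrass_null (g z) $ j) (at z)"
    and dH: "\<And>z j. z \<in> ball p r \<Longrightarrow> (H j has_field_derivative
       \<i> * ccross3 (\<chi> j. F j z) ((\<omega>h z / 2) *s weierstrass_null (g z)) $ j) (at z)"
    and \<psi>: "\<And>z j. z \<in> ball p r \<Longrightarrow> \<psi> z $ j = c j + (2 * Re (H j z) + Re (\<i> * ccross3 (\<chi> j. cnj (F j z)) (\<chi> j. F j z) $ j))"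
    using affine_maxface_local_representation[OF max wp p np] by metis
  let ?B = "ball p r"
  define v where "v = (\<lambda>z. weierstrass_null (g z))"
  have dFv: "(F j has_field_derivative \<omega>h z / 2 * v z $ j) (at z)" if "z \<in> ?B" for z j
    using dF[OF that] by (simp only: v_def)
  have pB: "p \<in> ?B" using r by simp
  have U: "open U" using max by (simp add: affine_maxface_def)
  have immersion: "\<And>z. z \<in> U \<Longrightarrow> inj (frechet_derivative N (at z))" and smN: "smooth_on U N"
    using max by (auto simp: affine_maxface_def conformal_minimal_immersion_def)
  have hol\<omega>: "\<omega>h holomorphic_on ?B"
    using wp holomorphic_on_subset r(2) by (auto simp: weierstrass_pair_def)
  have derN: "(N has_derivative (\<lambda>w. \<chi> j. Re (\<omega>h z * v z $ j * w))) (at z)" if z: "z \<in> ?B" for z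
  proof (rule has_derivative_vec)
    fix j
    have "((\<lambda>z. 2 * Re (F j z)) has_derivative (\<lambda>w. 2 * Re (\<omega>h z / 2 * v z $ j * w))) (at z)"
      using dF[OF z, of j] unfolding has_field_derivative_def v_def
      by (intro has_derivative_mult_right bounded_linear.has_derivative[OF bounded_linear_Re])
    then have "((\<lambda>z. N z $ j) has_derivative (\<lambda>w. 2 * Re (\<omega>h z / 2 * v z $ j * w))) (at z)"
      by (rule has_derivative_transform_within_open[OF _ open_ball z]) (simp add: NF)
    moreover have "2 * Re (\<omega>h z / 2 * v z $ j * w) = Re (\<omega>h z * v z $ j * w)" for w
    proof -
      have "\<omega>h z * v z $ j * w = of_real 2 * (\<omega>h z / 2 * v z $ j * w)" by simp
      then show ?thesis by (simp only: Re_mult_real)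
    qed
    ultimately show "((\<lambda>z. N z $ j) has_derivative (\<lambda>w. (\<chi> j. Re (\<omega>h z * v z $ j * w)) $ j)) (at z)"
      by (simp only: vec_lambda_beta)
  qed
  have dN: "frechet_derivative N (at z) w = (\<chi> j. Re (\<omega>h z * v z $ j * w))" if "z \<in> ?B" for z w
    using has_derivative_frechet[OF derN[OF that]] by simp
  have der\<psi>: "(\<psi> has_derivative (\<lambda>w. cross3 (N z) (frechet_derivative N (at z) (\<i> * w)))) (at z)" if z: "z \<in> ?B" for z
  proof (rule has_derivative_vec)
    fix j
    have *: "((\<lambda>z. \<psi> z $ j) has_derivative (\<lambda>w. cross3 (N z) (frechet_derivative N (at z) (\<i> * w)) $ j)) (at z)"
      if d: "((\<lambda>z. 2 * Re (H j z) + Re (\<i> * ccross3 (\<chi> j. cnj (F j z)) (\<chi> j. F j z) $ j)) has_derivative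
         (\<lambda>w. cross3 (N z) (frechet_derivative N (at z) (\<i> * w)) $ j)) (at z)"
    proof (rule has_derivative_transform_within_open[OF _ open_ball z])
      show "((\<lambda>z. c j + (2 * Re (H j z) + Re (\<i> * ccross3 (\<chi> j. cnj (F j z)) (\<chi> j. F j z) $ j))) has_derivative
         (\<lambda>w. cross3 (N z) (frechet_derivative N (at z) (\<i> * w)) $ j)) (at z)"
        using has_derivative_add[OF has_derivative_const d] by simp
    qed (simp add: \<psi>)
    have e: "2 * Re (\<i> * ((F a z + cnj (F a z)) * (\<omega>h z / 2 * v z $ b) - (F b z + cnj (F b z)) * (\<omega>h z / 2 * v z $ a)) * w) =
       N z $ a * Re (\<omega>h z * v z $ b * (\<i> * w)) - Re (\<omega>h z * v z $ a * (\<i> * w)) * N z $ b" for a b w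
    proof -
      have "of_real 2 * (\<i> * ((F a z + cnj (F a z)) * (\<omega>h z / 2 * v z $ b) - (F b z + cnj (F b z)) * (\<omega>h z / 2 * v z $ a)) * w) =
          of_real (N z $ a) * (\<omega>h z * v z $ b * (\<i> * w)) - of_real (N z $ b) * (\<omega>h z * v z $ a * (\<i> * w))"
        unfolding complex_add_cnj NF[OF z, symmetric] by (simp add: field_simps)
      from arg_cong[OF this, of Re] show ?thesis by (simp only: Re_mult_real minus_complex.sel mult.commute)
    qed
    consider "j = 1" | "j = 2" | "j = 3" using exhaust_3 by blast
    then show "((\<lambda>z. \<psi> z $ j) has_derivative (\<lambda>w. cross3 (N z) (frechet_derivative N (at z) (\<i> * w)) $ j)) (at z)"
    proof cases
      case 1
      have "(H 1 has_field_derivative \<i> * (F 2 z * (\<omega>h z / 2 * v z $ 3) - F 3 z * (\<omega>h z / 2 * v z $ 2))) (at z)"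
        using dH[OF z, of 1] by (simp only: ccross3_components vec_lambda_beta vector_smult_component v_def)
      note lelieuvre_potential_derivative[OF dFv[OF z] dFv[OF z] this, unfolded e]
      then show ?thesis
        by (intro *) (simp only: 1 ccross3_components cross_components vec_lambda_beta dN[OF z])
    next
      case 2
      have "(H 2 has_field_derivative \<i> * (F 3 z * (\<omega>h z / 2 * v z $ 1) - F 1 z * (\<omega>h z / 2 * v z $ 3))) (at z)"
        using dH[OF z, of 2] by (simp only: ccross3_components vec_lambda_beta vector_smult_component v_def)
      note lelieuvre_potential_derivative[OF dFv[OF z] dFv[OF z] this, unfolded e]
      then show ?thesis
        by (intro *) (simp only: 2 ccross3_components cross_components vec_lambda_beta dN[OF z])
    next
      case 3
      have "(H 3 has_field_derivative \<i> * (F 1 z * (\<omega>h z / 2 * v z $ 2) - F 2 z * (\<omega>h z / 2 * v z $ 1))) (at z)"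
        using dH[OF z, of 3] by (simp only: ccross3_components vec_lambda_beta vector_smult_component v_def)
      note lelieuvre_potential_derivative[OF dFv[OF z] dFv[OF z] this, unfolded e]
      then show ?thesis
        by (intro *) (simp only: 3 ccross3_components cross_components vec_lambda_beta dN[OF z])
    qed
  qed
  interpret conormal_surface ?B N \<psi>
    by unfold_locales (use smooth_on_subset[OF smN r(2)] der\<psi> in auto)
  define S where "S = (\<lambda>z. N z \<bullet> gauss_vector (g z))"
  define A where "A = (\<lambda>z. null_pairing (N z) (g z))"
  define \<kappa> where "\<kappa> = (\<lambda>z. (cmod (\<omega>h z))\<^sup>2 * (1 + (cmod (g z))\<^sup>2))"
  have lamS: "lam z = \<kappa> z * S z" if z: "z \<in> ?B" for z
    unfolding lam_def dN[OF z] mult_1_right \<kappa>_def S_def v_def by (rule triple_weierstrass)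
  \<comment> \<open>A zero of \<open>\<omega>h\<close> would make the differential of
    \<open>N\<close> vanish, against immersivity.\<close>
  have \<omega>0: "\<omega>h z \<noteq> 0" if z: "z \<in> ?B" for z
  proof
    assume "\<omega>h z = 0"
    then have "frechet_derivative N (at z) 1 = frechet_derivative N (at z) 0" by (simp add: dN[OF z])
    then show False using immersion[of z] z r(2) by (metis injD subsetD zero_neq_one)
  qed
  have \<kappa>0: "\<kappa> z > 0" if "z \<in> ?B" for z using \<omega>0[OF that] by (simp add: \<kappa>_def add_pos_nonneg)
  have Np: "N p \<noteq> 0" using nz p by blast
  have lam0: "lam p = 0"
  proof (rule ccontr)
    assume l: "lam p \<noteq> 0"
    have f: "frechet_derivative \<psi> (at p) = (\<lambda>w. cross3 (N p) (frechet_derivative N (at p) (\<i> * w)))"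
      by (rule has_derivative_frechet[OF der\<psi>[OF pB]])
    have lin: "linear (frechet_derivative \<psi> (at p))"
      unfolding f by (rule has_derivative_linear[OF der\<psi>[OF pB]])
    have "inj (frechet_derivative \<psi> (at p))"
      by (rule linear_injective_0[OF lin, THEN iffD2]) (use lam_eq_0[OF pB] l f in metis)
    then show False using dim_range_inj[OF lin] nd by (simp add: nondegenerate_singular_point_def singular_point_def)
  qed
  show Sp: "N p \<bullet> gauss_vector (g p) = 0"
    using lam0 lamS[OF pB] \<kappa>0[OF pB] by (simp add: S_def)
  have Lam: "Lambda N \<psi> z = norm (N z) * lam z" if z: "z \<in> ?B" for z
  proof -
    have d\<psi>: "frechet_derivative \<psi> (at z) w = cross3 (N z) (frechet_derivative N (at z) (\<i> * w))" for w
      using has_derivative_frechet[OF der\<psi>[OF z]] by simp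
    have "frechet_derivative N (at z) (\<i> * \<i>) = - frechet_derivative N (at z) 1"
      using linear_neg[OF linear_dN[OF z], of 1] by simp
    then have "d_v \<psi> z = - cross3 (N z) (frechet_derivative N (at z) 1)"
      unfolding d_v_def d\<psi> by simp
    moreover have "d_u \<psi> z = cross3 (N z) (frechet_derivative N (at z) \<i>)"
      unfolding d_u_def d\<psi> by simp
    moreover have "N z \<noteq> 0" using nz z r(2) by blast
    note det_lelieuvre_frame[OF this]
    ultimately show ?thesis
      unfolding Lambda_def lam_def by (simp only:)
  qed
  \<comment> \<open>\<open>Lambda\<close> is \<open>norm (N z) * lam z\<close>, and since
    \<open>lam p = 0\<close> the product rule leaves only the multiple of the differential of
    \<open>lam\<close>.\<close>
  have Dlam: "frechet_derivative lam (at p) \<noteq> (\<lambda>_. 0)"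
  proof
    assume 0: "frechet_derivative lam (at p) = (\<lambda>_. 0)"
    have "((\<lambda>z. norm (N z)) has_derivative (\<lambda>w. frechet_derivative N (at p) w \<bullet> sgn (N p))) (at p)"
      using has_derivative_compose[OF der_N[OF pB] has_derivative_norm[OF Np]] .
    from has_derivative_mult[OF this der_lam[OF pB]]
    have "((\<lambda>z. norm (N z) * lam z) has_derivative (\<lambda>w. 0)) (at p)" by (simp add: 0 lam0)
    then have "(Lambda N \<psi> has_derivative (\<lambda>w. 0)) (at p)"
      by (rule has_derivative_transform_within_open[OF _ open_ball pB]) (simp add: Lam)
    then show False using nd has_derivative_frechet by (auto simp: nondegenerate_singular_point_def)
  qed
  have dlam: "frechet_derivative lam (at p) w = 2 * (cmod (\<omega>h p))\<^sup>2 * Re (deriv g p * w * cnj (A p))" for w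
  proof -
    have dg: "(g has_derivative (\<lambda>w. deriv g p * w)) (at p)"
      using holomorphic_derivI[OF holg open_ball pB] by (simp add: has_field_derivative_def)
    have d\<omega>: "(\<omega>h has_derivative (\<lambda>w. deriv \<omega>h p * w)) (at p)"
      using holomorphic_derivI[OF hol\<omega> open_ball pB] by (simp add: has_field_derivative_def)
    have sq: "\<exists>f''. ((\<lambda>z. (cmod (f z))\<^sup>2) has_derivative f'') (at p)" if "(f has_derivative f') (at p)" for f f'
      unfolding power2_norm_eq_inner using has_derivative_inner[OF that that] by blast
    \<comment> \<open>Only differentiability of \<open>\<kappa>\<close> matters: its derivative
      \<open>k\<close> will be multiplied by \<open>S p\<close>, which is 0.\<close>
    obtain k where "(\<kappa> has_derivative k) (at p)"
    proof -
      obtain g2 w2 where "((\<lambda>z. (cmod (g z))\<^sup>2) has_derivative g2) (at p)" "((\<lambda>z. (cmod (\<omega>h z))\<^sup>2) has_derivative w2) (at p)"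
        using sq[OF dg] sq[OF d\<omega>] by blast
      from has_derivative_mult[OF this(2) has_derivative_add[OF has_derivative_const this(1)]]
      show thesis using that unfolding \<kappa>_def by blast
    qed
    define W' where "W' = (\<lambda>w. vector [2 * Re (deriv g p * w), 2 * Im (deriv g p * w), 2 * Re (cnj (g p) * (deriv g p * w))] :: real^3)"
    have dW: "((\<lambda>z. gauss_vector (g z)) has_derivative W') (at p)"
    proof (rule has_derivative_vec)
      fix j :: 3
      have re: "((\<lambda>z. Re (g z)) has_derivative (\<lambda>w. Re (deriv g p * w))) (at p)"
        and im: "((\<lambda>z. Im (g z)) has_derivative (\<lambda>w. Im (deriv g p * w))) (at p)"
        by (rule bounded_linear.has_derivative[OF bounded_linear_Re dg] bounded_linear.has_derivative[OF bounded_linear_Im dg])+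
      have "((\<lambda>z. (Re (g z) * Re (g z) + Im (g z) * Im (g z)) - 1) has_derivative
          (\<lambda>w. ((Re (g p) * Re (deriv g p * w) + Re (deriv g p * w) * Re (g p)) +
             (Im (g p) * Im (deriv g p * w) + Im (deriv g p * w) * Im (g p))) - 0)) (at p)"
        by (intro has_derivative_diff has_derivative_add has_derivative_mult re im has_derivative_const)
      then have "((\<lambda>z. (cmod (g z))\<^sup>2 - 1) has_derivative (\<lambda>w. 2 * Re (cnj (g p) * (deriv g p * w)))) (at p)"
        unfolding cmod_power2 by (simp add: power2_eq_square algebra_simps)
      then show "((\<lambda>z. gauss_vector (g z) $ j) has_derivative (\<lambda>w. W' w $ j)) (at p)"
        using exhaust_3[of j] has_derivative_mult_right[OF re, of 2] has_derivative_mult_right[OF im, of 2]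
        unfolding gauss_vector_def W'_def by (elim disjE) (simp_all only: vector_3)
    qed
    have dS: "(S has_derivative (\<lambda>w. N p \<bullet> W' w + frechet_derivative N (at p) w \<bullet> gauss_vector (g p))) (at p)"
      unfolding S_def by (rule has_derivative_inner[OF der_N[OF pB] dW])
    have "(lam has_derivative (\<lambda>w. \<kappa> p * (N p \<bullet> W' w + frechet_derivative N (at p) w \<bullet> gauss_vector (g p)) + k w * S p)) (at p)"
      by (rule has_derivative_transform_within_open[OF has_derivative_mult[OF \<open>(\<kappa> has_derivative k) (at p)\<close> dS] open_ball pB])
        (simp add: lamS)
    from fun_cong[OF has_derivative_frechet[OF this], of w]
    have "frechet_derivative lam (at p) w = \<kappa> p * (N p \<bullet> W' w + frechet_derivative N (at p) w \<bullet> gauss_vector (g p)) + k w * S p" .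
    moreover have "frechet_derivative N (at p) w \<bullet> gauss_vector (g p) = 0"
      using weierstrass_null_orthogonal_gauss_vector[of "\<omega>h p * w" "g p"] by (simp only: dN[OF pB] v_def mult_ac)
    ultimately have "frechet_derivative lam (at p) w = \<kappa> p * (N p \<bullet> W' w)"
      using Sp by (simp add: S_def)
    also have "N p \<bullet> W' w = 2 * Re (deriv g p * w * (of_real (N p $ 1) - \<i> * of_real (N p $ 2) + cnj (g p) * of_real (N p $ 3)))"
      by (simp add: W'_def inner_vec_def sum_3 algebra_simps)
    also have "\<kappa> p * \<dots> = 2 * (cmod (\<omega>h p))\<^sup>2 * Re (deriv g p * w * cnj (A p))"
    proof -
      have "Re (deriv g p * w * cnj (A p)) = Re (of_real (1 + (cmod (g p))\<^sup>2) *
          (deriv g p * w * (of_real (N p $ 1) - \<i> * of_real (N p $ 2) + cnj (g p) * of_real (N p $ 3))))"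
        unfolding A_def cnj_null_pairing[OF Sp] by (simp only: mult_ac)
      then show ?thesis unfolding Re_mult_real \<kappa>_def by (simp only: mult_ac)
    qed
    finally show ?thesis .
  qed
  show Ag: "null_pairing (N p) (g p) * deriv g p \<noteq> 0"
  proof
    assume "null_pairing (N p) (g p) * deriv g p = 0"
    then have "frechet_derivative lam (at p) = (\<lambda>_. 0)" by (auto simp: dlam A_def)
    then show False using Dlam by blast
  qed
  \<comment> \<open>Chosen so that the factor \<i> in \<open>dN z (\<i> * \<eta> z)\<close> cancels
    and Re(v cnj A) remains. The formula makes sense on the whole disc, so \<open>\<eta>\<close> is
    a smooth field there, though null only where \<open>lam\<close> vanishes.\<close>
  define \<eta> where "\<eta> = (\<lambda>z. - \<i> * cnj (\<omega>h z * A z))"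
  have \<eta>p: "\<eta> p \<noteq> 0" using Ag \<omega>0[OF pB] by (simp add: \<eta>_def A_def)
  have null: "cross3 (N z) (frechet_derivative N (at z) (\<i> * \<eta> z)) = 0" if z: "z \<in> ?B" "lam z = 0" for z
  proof -
    have S0: "N z \<bullet> gauss_vector (g z) = 0" using lamS[OF z(1)] z(2) \<kappa>0[OF z(1)] by (simp add: S_def)
    have "frechet_derivative N (at z) (\<i> * \<eta> z) = ((cmod (\<omega>h z))\<^sup>2 * (1 + (cmod (g z))\<^sup>2)\<^sup>2) *\<^sub>R N z"
    proof (rule vec_eq_iff[THEN iffD2], intro allI)
      fix j
      have e: "\<omega>h z * v z $ j * (\<i> * \<eta> z) = of_real ((cmod (\<omega>h z))\<^sup>2) * (v z $ j * cnj (A z))"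
        unfolding complex_norm_square by (simp add: \<eta>_def mult_ac)
      have "Re (v z $ j * cnj (A z)) = (1 + (cmod (g z))\<^sup>2)\<^sup>2 * N z $ j"
        using Re_weierstrass_null_pairing[of "g z" j "N z"] by (simp only: v_def A_def S0 mult_zero_right diff_0_right)
      then show "frechet_derivative N (at z) (\<i> * \<eta> z) $ j = (((cmod (\<omega>h z))\<^sup>2 * (1 + (cmod (g z))\<^sup>2)\<^sup>2) *\<^sub>R N z) $ j"
        unfolding dN[OF z(1)] vec_lambda_beta e Re_mult_real
        by (simp only: vector_scaleR_component real_scaleR_def mult.assoc)
    qed
    then show ?thesis by (simp add: cross_mult_right)
  qed
  have trans: "frechet_derivative lam (at p) (\<eta> p) \<noteq> 0 \<longleftrightarrow> Im ((A p)\<^sup>2 * (cnj (deriv g p) * \<omega>h p)) \<noteq> 0"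
  proof -
    have "deriv g p * \<eta> p * cnj (A p) = - \<i> * cnj ((A p)\<^sup>2 * (cnj (deriv g p) * \<omega>h p))"
      by (simp add: \<eta>_def power2_eq_square mult_ac)
    moreover have "Re (- \<i> * cnj x) = - Im x" for x by simp
    ultimately have "Re (deriv g p * \<eta> p * cnj (A p)) = - Im ((A p)\<^sup>2 * (cnj (deriv g p) * \<omega>h p))"
      by (simp only:)
    then show ?thesis unfolding dlam using \<omega>0[OF pB] by (simp only: mult_eq_0_iff neg_equal_0_iff_equal) simp
  qed
  have "cuspidal_edge_at \<psi> p" if t: "frechet_derivative lam (at p) (\<eta> p) \<noteq> 0"
  proof -
    define T where "T = {(z, w, \<zeta>). z + \<zeta> * w \<in> ?B \<and> z + cnj \<zeta> * w \<in> ?B}"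
    define E where "E = (\<lambda>(f :: complex \<Rightarrow> complex) (z, w, \<zeta>). f (z + \<zeta> * w))"
    \<comment> \<open>The conjugate of f at z + t w is extended to complex t by conjugating inside
      and outside; this is holomorphic in the parameter and agrees with the conjugate of f for real
      t.\<close>
    define E' where "E' = (\<lambda>f (z, w, \<zeta>). cnj (f (z + cnj \<zeta> * w)))"
    define X where "X = (\<lambda>x. ccross3 (\<chi> j. E' (F j) x) (\<chi> j. E (F j) x))"
    \<comment> \<open>The closed formula for \<open>\<psi>\<close>, with 2 Re H written as H + cnj H
      and every conjugate replaced by its extension \<open>E'\<close>.\<close>
    define Q where "Q = (\<lambda>j x. of_real (c j) + (E (H j) x + E' (H j) x + \<i> * X x $ j))"
    have opT: "open T"
    proof -
      have "T = (\<lambda>x. fst x + snd (snd x) * fst (snd x)) -` ?B \<inter> (\<lambda>x. fst x + cnj (snd (snd x)) * fst (snd x)) -` ?B"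
        by (auto simp: T_def)
      also have "open \<dots>" by (intro open_Int open_vimage open_ball continuous_intros)
      finally show ?thesis .
    qed
    have sm1: "smooth_on T fst" "smooth_on T (\<lambda>x. fst (snd x))" "smooth_on T (\<lambda>x. snd (snd x))"
      by (intro smooth_on_bounded_linear bounded_linear_fst bounded_linear_compose[OF bounded_linear_fst bounded_linear_snd]
          bounded_linear_compose[OF bounded_linear_snd bounded_linear_snd])+
    have smE: "smooth_on T (E f)" if "f holomorphic_on ?B" for f
    proof -
      have "smooth_on T (\<lambda>x. f (fst x + snd (snd x) * fst (snd x)))"
        by (rule smooth_on_holomorphic_comp[OF opT open_ball _ smooth_on_add[OF opT sm1(1) smooth_on_mult[OF opT sm1(3,2)]] that])
          (auto simp: T_def)
      then show ?thesis by (simp add: E_def case_prod_unfold)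
    qed
    have smE': "smooth_on T (E' f)" if "f holomorphic_on ?B" for f
    proof -
      have "smooth_on T (\<lambda>x. f (fst x + cnj (snd (snd x)) * fst (snd x)))"
        by (rule smooth_on_holomorphic_comp[OF opT open_ball _ smooth_on_add[OF opT sm1(1)
              smooth_on_mult[OF opT smooth_on_linear_comp[OF opT bounded_linear_cnj sm1(3)] sm1(2)]] that])
          (auto simp: T_def)
      from smooth_on_linear_comp[OF opT bounded_linear_cnj this] show ?thesis by (simp add: E'_def case_prod_unfold)
    qed
    have smX: "smooth_on T (\<lambda>x. X x $ j)" for j
      using exhaust_3[of j] unfolding X_def
      by (elim disjE) (simp_all only: ccross3_components vec_lambda_beta smooth_on_diff opT smooth_on_mult smE smE' holF)
    have smQ: "smooth_on T (Q j)" for j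
      unfolding Q_def
      by (intro smooth_on_add[OF opT] smooth_on_mult[OF opT] smooth_on_const smE smE' smX holH)
    have holE: "(\<lambda>\<zeta>. E f (z, w, \<zeta>)) holomorphic_on {\<zeta>. (z, w, \<zeta>) \<in> T}" if "f holomorphic_on ?B" for f z w
    proof -
      have "(\<lambda>\<zeta>. f (z + \<zeta> * w)) holomorphic_on {\<zeta>. (z, w, \<zeta>) \<in> T}"
        by (rule holomorphic_on_compose_gen[OF _ that, of "\<lambda>\<zeta>. z + \<zeta> * w", unfolded o_def])
          (auto simp: T_def intro!: holomorphic_intros)
      then show ?thesis by (simp add: E_def)
    qed
    have opTs: "open {\<zeta>. (z, w, \<zeta>) \<in> T}" for z w
    proof -
      have "open ((\<lambda>\<zeta>. (z, w, \<zeta>)) -` T)" by (intro open_vimage opT continuous_intros)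
      then show ?thesis by (simp add: vimage_def)
    qed
    have holE': "(\<lambda>\<zeta>. E' f (z, w, \<zeta>)) holomorphic_on {\<zeta>. (z, w, \<zeta>) \<in> T}" if "f holomorphic_on ?B" for f z w
    proof -
      let ?h = "\<lambda>\<zeta>. f (z + \<zeta> * w)"
      have "?h holomorphic_on cnj ` {\<zeta>. (z, w, \<zeta>) \<in> T}"
        by (rule holomorphic_on_compose_gen[OF _ that, of "\<lambda>\<zeta>. z + \<zeta> * w", unfolded o_def])
          (auto simp: T_def intro!: holomorphic_intros)
      then have "(cnj \<circ> ?h \<circ> cnj) holomorphic_on {\<zeta>. (z, w, \<zeta>) \<in> T}"
        using holomorphic_on_compose_cnj_cnj[of ?h "{\<zeta>. (z, w, \<zeta>) \<in> T}"] opTs by simp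
      then show ?thesis by (simp add: E'_def o_def)
    qed
    have holX: "(\<lambda>\<zeta>. X (z, w, \<zeta>) $ j) holomorphic_on {\<zeta>. (z, w, \<zeta>) \<in> T}" for z w j
      using exhaust_3[of j] unfolding X_def
      by (elim disjE) (simp_all only: ccross3_components vec_lambda_beta holomorphic_on_diff holomorphic_on_mult holE holE' holF)
    show ?thesis
    proof (rule transversal_imp_cuspidal_edge_at[where \<eta> = \<eta> and q = Q])
      have smg: "smooth_on ?B g" "smooth_on ?B \<omega>h"
        by (rule holomorphic_imp_smooth_on[OF open_ball holg] holomorphic_imp_smooth_on[OF open_ball hol\<omega>])+
      have smNj: "smooth_on ?B (\<lambda>z. complex_of_real (N z $ j))" for j
        by (rule smooth_on_linear_comp[OF open_ball bounded_linear_of_real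
            smooth_on_vec_nth[OF smooth_N open_ball]])
      have "smooth_on ?B A" unfolding A_def null_pairing_def
        by (intro smooth_on_add[OF open_ball] smooth_on_mult[OF open_ball] smooth_on_diff[OF open_ball]
            smooth_on_power[OF open_ball] smooth_on_const smNj smg)
      then show "smooth_on ?B \<eta>" unfolding \<eta>_def
        by (intro smooth_on_mult[OF open_ball] smooth_on_const smooth_on_linear_comp[OF open_ball bounded_linear_cnj] smg)
      show "smooth_on {(z, w, \<zeta>). z + \<zeta> * w \<in> ?B \<and> z + cnj \<zeta> * w \<in> ?B} (Q j)" for j
        using smQ unfolding T_def .
      show "(\<lambda>\<zeta>. Q j (z, w, \<zeta>)) holomorphic_on {\<zeta>. (z, w, \<zeta>) \<in> {(z, w, \<zeta>). z + \<zeta> * w \<in> ?B \<and> z + cnj \<zeta> * w \<in> ?B}}" for j z w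
        unfolding T_def[symmetric] Q_def by (intro holomorphic_intros holE holE' holX holH)
      fix j z w and t :: real assume zt: "z + t *\<^sub>R w \<in> ?B"
      define y where "y = z + t *\<^sub>R w"
      have E: "E f (z, w, of_real t) = f y" "E' f (z, w, of_real t) = cnj (f y)" for f
        by (simp_all add: E_def E'_def y_def scaleR_conv_of_real)
      have "Q j (z, w, of_real t) = of_real (c j) + (H j y + cnj (H j y) + \<i> * ccross3 (\<chi> j. cnj (F j y)) (\<chi> j. F j y) $ j)"
        by (simp add: Q_def X_def E)
      \<comment> \<open>cnj F \<times> F is antisymmetric under conjugation, hence purely imaginary,
        and \<i> times it is real.\<close>
      also have "\<i> * ccross3 (\<chi> j. cnj (F j y)) (\<chi> j. F j y) $ j = of_real (Re (\<i> * ccross3 (\<chi> j. cnj (F j y)) (\<chi> j. F j y) $ j))"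
        using exhaust_3[of j] by (auto simp: ccross3_components complex_eq_iff)
      finally show "Q j (z, w, of_real t) = of_real (\<psi> (z + t *\<^sub>R w) $ j)"
        using \<psi>[OF zt, of j] by (simp add: y_def[symmetric] complex_add_cnj)
    qed (use pB Np lam0 null t in auto)
  qed
  moreover have "frechet_derivative lam (at p) (\<eta> p) \<noteq> 0" if "cuspidal_edge_at \<psi> p"
    by (rule cuspidal_edge_at_imp_transversal[OF pB that \<eta>p null[OF pB lam0] Dlam])
  ultimately show "cuspidal_edge_at \<psi> p \<longleftrightarrow> Im ((null_pairing (N p) (g p))\<^sup>2 * (cnj (deriv g p) * \<omega>h p)) \<noteq> 0"
    using trans unfolding A_def by blast
qed

theorem proposition4p5:
  fixes U D :: "complex set"
    and q g \<omega>h :: "complex \<Rightarrow> complex"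
    and \<Phi> :: "complex \<Rightarrow> complex^3"
    and N \<psi> :: "complex \<Rightarrow> real^3"
    and N1 N2 N3 :: "complex \<Rightarrow> complex"
    and p :: complex
  defines "N1 \<equiv> \<lambda>z. complex_of_real (N z $ 1)"
    and "N2 \<equiv> \<lambda>z. complex_of_real (N z $ 2)"
    and "N3 \<equiv> \<lambda>z. complex_of_real (N z $ 3)"
  assumes "affine_maxface U D q \<Phi> N \<psi>"
    and "\<forall>z\<in>U. N z \<noteq> 0"
    and "weierstrass_pair U D q \<Phi> g \<omega>h"
    and "p \<in> U"
    and "nondegenerate_singular_point N \<psi> p"
    and "\<not> is_pole g p"
  shows "cuspidal_edge_at \<psi> p \<longleftrightarrow>
    (N1 p * (1 - (g p)\<^sup>2) + \<i> * N2 p * (1 + (g p)\<^sup>2) + 2 * g p * N3 p) * deriv g p \<noteq> 0 \<and>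
    ((cmod (g p) \<noteq> 1 \<and>
      Im ((N1 p * (1 + (g p)\<^sup>2) + \<i> * N2 p * (1 - (g p)\<^sup>2))\<^sup>2 * cnj (deriv g p) * \<omega>h p) \<noteq> 0)
     \<or>
     (cmod (g p) = 1 \<and>
      ((Re (g p) \<noteq> 0 \<and>
        Im ((N2 p - \<i> * N3 p * of_real (Re (g p)))\<^sup>2 * cnj (deriv g p) * (g p)\<^sup>2 * \<omega>h p) \<noteq> 0)
       \<or>
       (Im (g p) \<noteq> 0 \<and>
        Im ((N1 p + \<i> * N3 p * of_real (Im (g p)))\<^sup>2 * cnj (deriv g p) * (g p)\<^sup>2 * \<omega>h p) \<noteq> 0))))"
proof -
  \<comment> \<open>Non-degeneracy settles the first conjunct of the right-hand side; the
    singularity relation turns the remaining cases into the single condition on A.\<close>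
  note criterion = affine_maxface_cuspidal_edge_iff[OF assms(4-9)]
  show ?thesis
    using criterion(2) unfolding criterion(3) Im_null_pairing_iff[OF criterion(1)]
    by (simp only: N1_def N2_def N3_def null_pairing_def mult.assoc simp_thms not_False_eq_True)
qed

end
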